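(* Let $X$ be a Banach space, $0<\tau<\infty$, $k\in L^1_{loc}(\mathbb{R}^+)$ with $0\in\operatorname{supp}(k)$, and let $(S_k(t))_{t\in[0,\tau]}$ be a non-degenerate local $k$-convoluted semigroup on $X$ generated by $A$. Define $\mathcal{G}_k:\mathcal{D}_{k^{\ast\infty}}\to\mathcal{B}(X)$ by $$\mathcal{G}_k(f)x:=\int_0^{n\tau}W_{k^{\ast n}}f(t)\,S_{k^{\ast n}}(t)x\,dt,\qquad x\in X,\ f\in\mathcal{D}_{k^{\ast\infty}},$$ where $n\in\mathbb{N}$ is such that $\operatorname{supp}(f)\subset[0,n\tau]$, and $(S_{k^{\ast n}}(t))_{t\in[0,n\tau]}$ is the local $k^{\ast n}$-convoluted semigroup extending the given one, described in the context. Then: (i) The map $\mathcal{G}_k$ is well defined, linear and bounded. (ii) $\mathcal{G}_k(f\ast g)=\mathcal{G}_k(f)\mathcal{G}_k(g)$ for all $f,g\in\mathcal{D}_{k^{\ast\infty}}$. (iii) $\mathcal{G}_k(f)x\in D(A)$ and $A\mathcal{G}_k(f)x=-\mathcal{G}_k(f')x-f(0)x$ for all $f\in\mathcal{D}_{k^{\ast\infty}}$ and $x\in X$.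
   Context: Convolution: $(f\ast g)(t)=\int_0^t f(t-s)g(s)\,ds$, $t\ge0$; $k^{\ast 1}=k$, $k^{\ast m}=k\ast k^{\ast(m-1)}$ for $m\ge2$. Dual convolution: $(f\circ g)(t)=\int_t^\infty f(s-t)g(s)\,ds$, $t\ge0$. The condition $0\in\operatorname{supp}(k)$ means $k$ is not a.e. zero on any interval $[0,\varepsilon)$, $\varepsilon>0$. $\mathcal{B}(X)$ is the space of bounded linear operators on $X$. Test functions: $\mathcal{D}_+$ is the space of restrictions to $[0,\infty)$ of complex $C^\infty$ functions on $\mathbb{R}$ with compact support, with the Schwartz-type topology ($\phi_n\to\phi$ iff all supports lie in a common compact set and all derivatives converge uniformly on compact sets). If $0\in\operatorname{supp}(k)$, the map $T'_k:\mathcal{D}_+\to\mathcal{D}_+$, $T'_k(f)=k\circ f$, is linear, continuous and injective; $\mathcal{D}_k:=T'_k(\mathcal{D}_+)$, and $W_k:\mathcal{D}_k\to\mathcal{D}_+$ is the inverse, so $f(t)=\int_t^\infty k(s-t)W_kf(s)\,ds$ for $f\in\mathcal{D}_k$. One has $0\in\operatorname{supp}(k^{\ast n})$ for all $n\ge 1$, and $\mathcal{D}_{k^{\ast\infty}}:=\bigcap_{n\ge1}\mathcal{D}_{k^{\ast n}}$, equipped with the topology of $\mathcal{D}_+$. Local $k$-convoluted semigroup on $[0,\sigma]$ generated by a closed operator $A$ with domain $D(A)$: a strongly continuous family $(S_k(t))_{t\in[0,\sigma]}\subset\mathcal{B}(X)$ with $S_k(t)A\subset AS_k(t)$, $\int_0^tS_k(s)x\,ds\in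 D(A)$ and $A\int_0^tS_k(s)x\,ds=S_k(t)x-\int_0^tk(s)\,ds\,x$ for all $t\in[0,\sigma]$, $x\in X$. Non-degenerate: $S_k(t)x=0$ for all $t$ implies $x=0$. Extensions: $S_{k^{\ast1}}=S_k$ on $[0,\tau]$, and for $m\ge1$, $x\in X$, $$S_{k^{\ast(m+1)}}(t)x=\int_0^tk(t-s)S_{k^{\ast m}}(s)x\,ds,\quad t\in[0,m\tau],$$ $$S_{k^{\ast(m+1)}}(t)x=S_{k^{\ast m}}(m\tau)S_k(t-m\tau)x+\int_0^{m\tau}k(t-s)S_{k^{\ast m}}(s)x\,ds+\int_0^{t-m\tau}k^{\ast m}(t-s)S_k(s)x\,ds,\quad t\in[m\tau,(m+1)\tau].$$
   Formalization: "Bounded" in (i) fails in general for the topology of D_+; proved instead are ||G_k(f)|| ≤ C_n sup|W_{k^{*n}} f| for supp f in [0,nτ], and sequential continuity when W_{k^{*n}} f_j → W_{k^{*n}} f in D_+ for all n. If all W_{k^{*n}} are continuous on D_+, this gives the original claim. *)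

theory Defs
  imports "HOL-Analysis.Analysis"
begin

section \<open>Complex Banach spaces and operators\<close>

class complex_banach = banach +
  fixes scaleC :: "complex \<Rightarrow> 'a \<Rightarrow> 'a"  (infixr \<open>*\<^sub>C\<close> 75)
  assumes scaleC_add_right: "c *\<^sub>C (x + y) = c *\<^sub>C x + c *\<^sub>C y"
    and scaleC_add_left: "(c + d) *\<^sub>C x = c *\<^sub>C x + d *\<^sub>C x"
    and scaleC_scaleC: "c *\<^sub>C d *\<^sub>C x = (c * d) *\<^sub>C x"
    and scaleC_of_real: "complex_of_real r *\<^sub>C x = r *\<^sub>R x"
    and norm_scaleC: "norm (c *\<^sub>C x) = norm c * norm x"

definition bounded_clinear :: "('a::complex_banach \<Rightarrow> 'a) \<Rightarrow> bool" where
  "bounded_clinear T \<longleftrightarrow> bounded_linear T \<and> (\<forall>c x. T (c *\<^sub>C x) = c *\<^sub>C T x)"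

text \<open>An unbounded operator is a pair of a domain \<open>D\<close> and a function \<open>A\<close>; the values of \<open>A\<close>
  outside \<open>D\<close> are irrelevant.\<close>

definition closed_operator :: "'a::complex_banach set \<Rightarrow> ('a \<Rightarrow> 'a) \<Rightarrow> bool" where
  "closed_operator D A \<longleftrightarrow>
     0 \<in> D \<and>
     (\<forall>x\<in>D. \<forall>y\<in>D. x + y \<in> D \<and> A (x + y) = A x + A y) \<and>
     (\<forall>c. \<forall>x\<in>D. c *\<^sub>C x \<in> D \<and> A (c *\<^sub>C x) = c *\<^sub>C A x) \<and>
     closed {(x, A x) | x. x \<in> D}"

section \<open>Convolutions\<close>

text \<open>Functions on \<open>[0,\<infinity>)\<close> are functions on \<^typ>\<open>real\<close> whose values at negative arguments are
  never used (kernels), or are \<open>0\<close> by convention (test functions, see below).  The integral is the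
  Henstock--Kurzweil one because the Bochner integral of the library requires a separable range
  space.  All integrands below are absolutely integrable (for the convolution powers of a kernel:
  at almost every \<open>t\<close>), so that it coincides with the Lebesgue/Bochner integral.\<close>

definition conv :: "(real \<Rightarrow> complex) \<Rightarrow> (real \<Rightarrow> complex) \<Rightarrow> real \<Rightarrow> complex" where
  "conv f g t = integral {0..t} (\<lambda>s. f (t - s) * g s)"

text \<open>\<open>conv_pow k n\<close> is the \<open>n\<close>-th convolution power for \<open>n \<ge> 1\<close>; the value at \<open>0\<close> is irrelevant.\<close>

definition conv_pow :: "(real \<Rightarrow> complex) \<Rightarrow> nat \<Rightarrow> real \<Rightarrow> complex" where
  "conv_pow k n = ((conv k) ^^ (n - 1)) k"

definition dual_conv :: "(real \<Rightarrow> complex) \<Rightarrow> (real \<Rightarrow> complex) \<Rightarrow> real \<Rightarrow> complex" where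
  "dual_conv f g t = (if t \<ge> 0 then integral {t..} (\<lambda>s. f (s - t) * g s) else 0)"

definition locally_integrable :: "(real \<Rightarrow> complex) \<Rightarrow> bool" where
  "locally_integrable k \<longleftrightarrow> (\<forall>T>0. k absolutely_integrable_on {0..T})"

definition zero_in_supp :: "(real \<Rightarrow> complex) \<Rightarrow> bool" where
  "zero_in_supp k \<longleftrightarrow> (\<forall>\<epsilon>>0. \<not> (AE t in lebesgue. t \<in> {0..<\<epsilon>} \<longrightarrow> k t = 0))"

section \<open>Test functions\<close>

definition supp :: "(real \<Rightarrow> complex) \<Rightarrow> real set" where
  "supp f = closure {t. f t \<noteq> 0}"

definition smooth :: "(real \<Rightarrow> complex) \<Rightarrow> bool" where
  "smooth \<phi> \<longleftrightarrow> (\<exists>d :: nat \<Rightarrow> real \<Rightarrow> complex. d 0 = \<phi> \<and>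
     (\<forall>n t. (d n has_vector_derivative d (Suc n) t) (at t)))"

text \<open>The restriction to \<open>[0,\<infinity>)\<close> is represented by the extension by \<open>0\<close> to the negative half-line,
  so that equality of functions is equality on \<open>[0,\<infinity>)\<close>.\<close>

definition Dplus :: "(real \<Rightarrow> complex) set" where
  "Dplus = {(\<lambda>t. if t \<ge> 0 then \<phi> t else 0) | \<phi>. smooth \<phi> \<and> compact (supp \<phi>)}"

definition deriv_plus :: "(real \<Rightarrow> complex) \<Rightarrow> real \<Rightarrow> complex" where
  "deriv_plus f t = (if t \<ge> 0 then vector_derivative f (at t within {0..}) else 0)"

definition Dplus_converges :: "(nat \<Rightarrow> real \<Rightarrow> complex) \<Rightarrow> (real \<Rightarrow> complex) \<Rightarrow> bool" where
  "Dplus_converges \<phi> \<psi> \<longleftrightarrow>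
     (\<forall>j. \<phi> j \<in> Dplus) \<and> \<psi> \<in> Dplus \<and>
     (\<exists>K. compact K \<and> (\<forall>j. supp (\<phi> j) \<subseteq> K)) \<and>
     (\<forall>m. \<forall>K. compact K \<longrightarrow>
        uniform_limit K (\<lambda>j. (deriv_plus ^^ m) (\<phi> j)) ((deriv_plus ^^ m) \<psi>) sequentially)"

definition D_of :: "(real \<Rightarrow> complex) \<Rightarrow> (real \<Rightarrow> complex) set" where
  "D_of k = dual_conv k ` Dplus"

definition W :: "(real \<Rightarrow> complex) \<Rightarrow> (real \<Rightarrow> complex) \<Rightarrow> real \<Rightarrow> complex" where
  "W k = the_inv_into Dplus (dual_conv k)"

definition D_inf :: "(real \<Rightarrow> complex) \<Rightarrow> (real \<Rightarrow> complex) set" where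
  "D_inf k = (\<Inter>n\<in>{1..}. D_of (conv_pow k n))"

section \<open>Local convoluted semigroups\<close>

definition local_convoluted_semigroup ::
  "(real \<Rightarrow> complex) \<Rightarrow> real \<Rightarrow> 'a set \<Rightarrow> ('a \<Rightarrow> 'a) \<Rightarrow> (real \<Rightarrow> 'a::complex_banach \<Rightarrow> 'a) \<Rightarrow> bool"
  where
  "local_convoluted_semigroup k \<sigma> D A S \<longleftrightarrow>
     closed_operator D A \<and>
     (\<forall>t\<in>{0..\<sigma>}. bounded_clinear (S t)) \<and>
     (\<forall>x. continuous_on {0..\<sigma>} (\<lambda>t. S t x)) \<and>
     (\<forall>t\<in>{0..\<sigma>}. \<forall>x\<in>D. S t x \<in> D \<and> S t (A x) = A (S t x)) \<and>
     (\<forall>t\<in>{0..\<sigma>}. \<forall>x. integral {0..t} (\<lambda>s. S s x) \<in> D \<and>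
        A (integral {0..t} (\<lambda>s. S s x)) = S t x - integral {0..t} k *\<^sub>C x)"

definition nondegenerate :: "real \<Rightarrow> (real \<Rightarrow> 'a::complex_banach \<Rightarrow> 'a) \<Rightarrow> bool" where
  "nondegenerate \<sigma> S \<longleftrightarrow> (\<forall>x. (\<forall>t\<in>{0..\<sigma>}. S t x = 0) \<longrightarrow> x = 0)"

text \<open>\<open>S_ext k \<tau> S n\<close> is \<open>S\<^bsub>k\<^sup>*\<^sup>n\<^esub>\<close> on \<open>[0, n\<tau>]\<close> for \<open>n \<ge> 1\<close>; the equation for \<open>0\<close> is irrelevant.\<close>

fun S_ext :: "(real \<Rightarrow> complex) \<Rightarrow> real \<Rightarrow> (real \<Rightarrow> 'a \<Rightarrow> 'a) \<Rightarrow> nat \<Rightarrow> real \<Rightarrow> 'a::complex_banach \<Rightarrow> 'a"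
  where
  "S_ext k \<tau> S 0 t x = S t x"
| "S_ext k \<tau> S (Suc 0) t x = S t x"
| "S_ext k \<tau> S (Suc (Suc p)) t x = (let m = Suc p in
     if t \<le> real m * \<tau> then integral {0..t} (\<lambda>s. k (t - s) *\<^sub>C S_ext k \<tau> S m s x)
     else S_ext k \<tau> S m (real m * \<tau>) (S (t - real m * \<tau>) x)
          + integral {0..real m * \<tau>} (\<lambda>s. k (t - s) *\<^sub>C S_ext k \<tau> S m s x)
          + integral {0..t - real m * \<tau>} (\<lambda>s. conv_pow k m (t - s) *\<^sub>C S s x))"

definition G_integrand ::
  "(real \<Rightarrow> complex) \<Rightarrow> real \<Rightarrow> (real \<Rightarrow> 'a \<Rightarrow> 'a) \<Rightarrow> nat \<Rightarrow> (real \<Rightarrow> complex) \<Rightarrow> 'a::complex_banach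
    \<Rightarrow> real \<Rightarrow> 'a" where
  "G_integrand k \<tau> S n f x t = W (conv_pow k n) f t *\<^sub>C S_ext k \<tau> S n t x"

definition admissible :: "real \<Rightarrow> (real \<Rightarrow> complex) \<Rightarrow> nat \<Rightarrow> bool" where
  "admissible \<tau> f n \<longleftrightarrow> n \<ge> 1 \<and> supp f \<subseteq> {0..real n * \<tau>}"

definition G :: "(real \<Rightarrow> complex) \<Rightarrow> real \<Rightarrow> (real \<Rightarrow> 'a \<Rightarrow> 'a) \<Rightarrow> (real \<Rightarrow> complex) \<Rightarrow> 'a::complex_banach \<Rightarrow> 'a"
  where
  "G k \<tau> S f x = (let n = SOME n. admissible \<tau> f n in
     integral {0..real n * \<tau>} (G_integrand k \<tau> S n f x))"

text \<open>Continuity of linear maps on \<open>D_inf k\<close> refers to the topology of \<open>Dplus\<close> carried over along the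
  bijections \<open>W (conv_pow k n) : D_of (conv_pow k n) \<rightarrow> Dplus\<close>.  The subspace topology of \<open>Dplus\<close>
  cannot be used: for general \<open>k\<close> the maps \<open>W k\<close> are not continuous for it, and neither is \<open>G k \<tau> S\<close>.
  Take the inverse Laplace transform \<open>k(t) = t\<^sup>-\<^sup>3\<^sup>/\<^sup>2 exp (-1/(4t)) / (2\<surd>\<pi>)\<close> of \<open>exp (-\<surd>\<lambda>)\<close> and the
  diagonal operator \<open>A\<close> on \<open>\<ell>\<^sup>2\<close> with entries \<open>a\<^sub>j = \<surd>j/(2\<tau>) + i j\<close>.  It generates a local
  \<open>k\<close>-convoluted semigroup on \<open>[0,\<tau>]\<close>, and \<open>G k \<tau> S f\<close> is the diagonal operator with entries
  \<open>\<integral> f(t) exp (a\<^sub>j t) dt\<close>.  By density of \<open>D_inf k\<close> in \<open>Dplus\<close>, continuity would bound these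
  polynomially in \<open>j\<close> for \<open>f(t) = \<psi>(t) exp (-i j t)\<close>, where they grow like \<open>exp (c \<surd>j)\<close>.\<close>

definition D_inf_converges ::
  "(real \<Rightarrow> complex) \<Rightarrow> (nat \<Rightarrow> real \<Rightarrow> complex) \<Rightarrow> (real \<Rightarrow> complex) \<Rightarrow> bool" where
  "D_inf_converges k f g \<longleftrightarrow>
     (\<forall>j. f j \<in> D_inf k) \<and> g \<in> D_inf k \<and>
     (\<forall>n\<ge>1. Dplus_converges (\<lambda>j. W (conv_pow k n) (f j)) (W (conv_pow k n) g))"

end

theory Submission
  imports Defs
begin

text \<open>
  By Titchmarsh's theorem the dual convolution with \<open>k\<close> is injective on test functions and does not
  enlarge supports when it is inverted.  Hence \<open>W\<^bsub>k\<^sup>*\<^sup>n\<^esub> f = k \<circ> W\<^bsub>k\<^sup>*\<^sup>(\<^sup>n\<^sup>+\<^sup>1\<^sup>)\<^esub> f\<close>, and Fubini's theorem makes the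
  integral defining \<open>G\<close> independent of \<open>n\<close>.  Integration by parts gives
  \<open>G f x = - \<integral> (W f)'(t) \<integral>\<^sub>0\<^sup>t S\<^sub>n(s)x ds dt\<close>, so that closedness of \<open>A\<close> and the generator relation of the
  extended semigroup \<open>S\<^sub>n\<close> yield (iii).

  The product \<open>f * g\<close> of \<open>f = k \<circ> \<phi>\<close> and \<open>g = k \<circ> \<psi>\<close> is \<open>k \<circ> (\<phi> * g - (\<phi> \<circ> k) \<circ> \<psi>)\<close>.  For (ii), let
  \<open>f\<^sub>s(t) = f(t + s)\<close>.  By (iii), \<open>w(s) = G f\<^sub>s (G g x) - G (f\<^sub>s * g) x\<close> solves \<open>w' = - A w\<close>, and it vanishes for
  large \<open>s\<close>.  Uniqueness for this Cauchy problem, which is again Titchmarsh's theorem, gives \<open>w = 0\<close>.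

  As the Bochner integral of the library needs a separable space, identities between integrals with
  values in \<open>X\<close> are reduced to scalar ones by separating functionals.
\<close>

section \<open>Fubini theorems for Henstock--Kurzweil integrals\<close>

text \<open>For (ii) the relation (iii) is not enough: \<open>w\<close> must be shown to be
  differentiable in \<open>X\<close>. Its difference quotients are estimated through the sup norm of
  \<open>W\<close> at one fixed level, which bounds \<open>G\<close>. The term
  \<open>G (conv f g)\<close> falls under the same bound because the product formula expresses
  \<open>W\<close> of a convolution linearly through \<open>W\<close> of the left factor, with the
  right factor fixed. The level is twice one that serves both factors, since supports add under
  convolution.

  The cross term of the product formula arises because \<open>conv\<close> integrates over [0, t]
  and the dual convolution over [t, \<infinity>): taking \<open>k\<close> out of one factor leaves a
  remainder over [t, t + u].

  In Titchmarsh's theorem the case of equal factors is analytic: an exponentially small Laplace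
  integral becomes, after reflection, a bounded sequence of exponential moments. The general case is
  algebraic and rests on multiplication by t being a derivation for convolution.\<close>

lemma borel_representative:
  fixes a :: "real \<Rightarrow> complex"
  assumes "a absolutely_integrable_on {p..q}"
  obtains a' N where "integrable lborel a'" "\<And>u. u \<notin> {p..q} \<Longrightarrow> a' u = 0"
    "negligible N" "\<And>u. u \<in> {p..q} - N \<Longrightarrow> a u = a' u"
proof -
  let ?a = "\<lambda>u. indicator {p..q} u *\<^sub>R a u"
  have int: "integrable lebesgue ?a"
    using assms by (simp add: set_integrable_def)
  \<comment> \<open>Integrands such as \<open>a' (t - s) * b' s\<close> are measurable for the
    product of the Borel algebras when the factors are Borel; hence the change on a null
    set.\<close>
  have "(\<lambda>u. Re (?a u)) \<in> borel_measurable (completion lborel)"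
       "(\<lambda>u. Im (?a u)) \<in> borel_measurable (completion lborel)"
    using borel_measurable_integrable[OF int] by measurable
  from this[THEN completion_ex_borel_measurable_real]
  obtain r i where [measurable]: "r \<in> borel_measurable lborel" "i \<in> borel_measurable lborel"
    and r: "AE x in lborel. Re (?a x) = r x" and i: "AE x in lborel. Im (?a x) = i x"
    by blast
  define a' where "a' = (\<lambda>u. indicator {p..q} u *\<^sub>R (complex_of_real (r u) + \<i> * complex_of_real (i u)))"
  have [measurable]: "a' \<in> borel_measurable lborel"
    unfolding a'_def by measurable
  have ae: "AE x in lborel. ?a x = a' x"
    using r i by eventually_elim (auto simp: a'_def complex_eq_iff indicator_def of_bool_def split: if_splits)
  then have ae2: "AE x in lebesgue. ?a x = a' x"
    by (rule AE_completion)
  have "integrable lebesgue a'"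
    by (rule integrable_cong_AE_imp[OF int]) (use ae2 in \<open>auto intro: measurable_completion\<close>)
  then have int': "integrable lborel a'"
    by (simp add: integrable_completion)
  have neg: "negligible {x. ?a x \<noteq> a' x}"
    using ae2 by (simp add: eventually_ae_filter_negligible) (meson negligible_subset)
  show ?thesis
    by (rule that[OF int' _ neg]) (auto simp: a'_def)
qed

text \<open>Bridge from the Henstock--Kurzweil integral over an interval to the Bochner integral
  over the line: \<open>a'\<close> vanishes outside the interval, and a bounded factor
  \<open>c\<close> does not affect integrability.\<close>

lemma integral_representative:
  fixes a a' c :: "real \<Rightarrow> complex"
  assumes a': "integrable lborel a'" "\<And>u. u \<notin> {p..q} \<Longrightarrow> a' u = 0"
    and N: "negligible N" "\<And>u. u \<in> {p..q} - N \<Longrightarrow> a u = a' u"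
    and c: "c \<in> borel_measurable borel" "\<And>u. norm (c u) \<le> M"
  shows "integral {p..q} (\<lambda>u. a u * c u) = (LINT u|lborel. a' u * c u)"
    and "(\<lambda>u. a u * c u) absolutely_integrable_on {p..q}"
proof -
  have int: "integrable lborel (\<lambda>u. a' u * c u)"
  proof (rule Bochner_Integration.integrable_bound)
    show "integrable lborel (\<lambda>u. M * norm (a' u))" using a' by auto
    show "(\<lambda>u. a' u * c u) \<in> borel_measurable lborel" using a' c by measurable
    have "norm (a' u) * norm (c u) \<le> norm (a' u) * \<bar>M\<bar>" for u
      by (intro mult_left_mono order.trans[OF c(2)]) auto
    then show "AE u in lborel. norm (a' u * c u) \<le> norm (M * norm (a' u))"
      by (simp add: norm_mult abs_mult mult.commute)
  qed
  have "integrable lebesgue (\<lambda>u. indicator {p..q} u *\<^sub>R (a' u * c u))"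
    using int a'(2) by (subst integrable_completion)
      (auto intro!: Bochner_Integration.integrable_cong[THEN iffD1, OF refl _ int] simp: indicator_def)
  then have ai: "(\<lambda>u. a' u * c u) absolutely_integrable_on {p..q}"
    by (simp add: set_integrable_def)
  show "(\<lambda>u. a u * c u) absolutely_integrable_on {p..q}"
    by (rule absolutely_integrable_spike[OF ai N(1)]) (use N in auto)
  have "integral {p..q} (\<lambda>u. a u * c u) = integral {p..q} (\<lambda>u. a' u * c u)"
    by (rule integral_spike[OF N(1)]) (use N in auto)
  also have "\<dots> = integral UNIV (\<lambda>u. a' u * c u)"
    by (rule integral_spike_set) (auto simp: a'(2) intro!: negligible_subset[of "{}"])
  also have "\<dots> = (LINT u|lborel. a' u * c u)"
    using integral_lborel[OF int] by simp
  finally show "integral {p..q} (\<lambda>u. a u * c u) = (LINT u|lborel. a' u * c u)" .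
qed

text \<open>Tonelli's bound is |M| times the two L1 norms. Since \<open>c\<close> need only be
  measurable and bounded, it may contain an indicator, and integration over triangles is
  covered.\<close>

lemma fubini_kernel:
  fixes a b :: "real \<Rightarrow> complex" and c :: "real \<Rightarrow> real \<Rightarrow> complex"
  assumes a: "a absolutely_integrable_on {p..q}" and b: "b absolutely_integrable_on {r..s}"
    and c: "(\<lambda>(u, v). c u v) \<in> borel_measurable (borel \<Otimes>\<^sub>M borel)"
    and M: "\<And>u v. u \<in> {p..q} \<Longrightarrow> v \<in> {r..s} \<Longrightarrow> norm (c u v) \<le> M"
  shows "(\<lambda>u. a u * integral {r..s} (\<lambda>v. b v * c u v)) absolutely_integrable_on {p..q}"
    and "integral {p..q} (\<lambda>u. a u * integral {r..s} (\<lambda>v. b v * c u v)) =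
         integral {r..s} (\<lambda>v. b v * integral {p..q} (\<lambda>u. a u * c u v))"
proof -
  obtain a' N where a': "integrable lborel a'" "\<And>u. u \<notin> {p..q} \<Longrightarrow> a' u = 0"
    "negligible N" "\<And>u. u \<in> {p..q} - N \<Longrightarrow> a u = a' u"
    by (rule borel_representative[OF a]) blast
  obtain b' N' where b': "integrable lborel b'" "\<And>u. u \<notin> {r..s} \<Longrightarrow> b' u = 0"
    "negligible N'" "\<And>u. u \<in> {r..s} - N' \<Longrightarrow> b u = b' u"
    by (rule borel_representative[OF b]) blast
  \<comment> \<open>The bound on \<open>c\<close> is known only on the rectangle; cutting off makes
    it global.\<close>
  define d where "d u v = (if u \<in> {p..q} \<and> v \<in> {r..s} then c u v else 0)" for u v
  have [measurable]: "(\<lambda>(u, v). d u v) \<in> borel_measurable (borel \<Otimes>\<^sub>M borel)"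
    using c unfolding d_def by measurable
  have [measurable]: "a' \<in> borel_measurable borel" "b' \<in> borel_measurable borel"
    using a'(1) b'(1) borel_measurable_integrable by force+
  have M0: "norm (d u v) \<le> \<bar>M\<bar>" for u v
    using M[of u v] by (auto simp: d_def)
  have du: "(\<lambda>v. d u v) \<in> borel_measurable borel" for u
    by measurable
  have dv: "(\<lambda>u. d u v) \<in> borel_measurable borel" for v
    by measurable
  have bi: "integrable lborel (\<lambda>v. b' v * norm (d u v))" for u
  proof (rule Bochner_Integration.integrable_bound)
    show "integrable lborel (\<lambda>v. \<bar>M\<bar> * norm (b' v))" using b' by auto
    show "AE v in lborel. norm (b' v * (norm (d u v))) \<le> norm (\<bar>M\<bar> * norm (b' v))"
      using mult_left_mono[OF M0, of "norm (b' v)" u v for v] by (simp add: norm_mult mult.commute)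
  qed measurable
  have bi': "integrable lborel (\<lambda>v. norm (b' v) * norm (d u v))" for u
    using integrable_norm[OF bi[of u]] by (simp add: norm_mult)
  have prod: "integrable (lborel \<Otimes>\<^sub>M lborel) (\<lambda>(u, v). a' u * b' v * d u v)"
  proof (rule lborel_pair.Fubini_integrable)
    show "(\<lambda>(u, v). a' u * b' v * d u v) \<in> borel_measurable (lborel \<Otimes>\<^sub>M lborel)"
      by measurable
    show "AE u in lborel. integrable lborel (\<lambda>v. case (u, v) of (u, v) \<Rightarrow> a' u * b' v * d u v)"
    proof (rule AE_I2)
      fix u
      have "integrable lborel (\<lambda>v. a' u * (b' v * d u v))"
        by (intro integrable_mult_right Bochner_Integration.integrable_bound[OF bi[of u]])
          (auto simp: norm_mult)
      then show "integrable lborel (\<lambda>v. case (u, v) of (u, v) \<Rightarrow> a' u * b' v * d u v)"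
        by (simp add: mult.assoc)
    qed
    show "integrable lborel (\<lambda>u. LINT v|lborel. norm (case (u, v) of (u, v) \<Rightarrow> a' u * b' v * d u v))"
    proof (rule Bochner_Integration.integrable_bound)
      show "integrable lborel (\<lambda>u. norm (a' u) * (\<bar>M\<bar> * (LINT v|lborel. norm (b' v))))"
        using a' by auto
      show "(\<lambda>u. LINT v|lborel. norm (case (u, v) of (u, v) \<Rightarrow> a' u * b' v * d u v)) \<in> borel_measurable lborel"
        by measurable
      have "(LINT v|lborel. norm (b' v) * norm (d u v)) \<le> (LINT v|lborel. \<bar>M\<bar> * norm (b' v))" for u
        using b' mult_left_mono[OF M0, of "norm (b' v)" u v for v]
        by (intro integral_mono bi') (auto simp: mult.commute)
      then have "norm (a' u) * (LINT v|lborel. norm (b' v) * norm (d u v))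
          \<le> norm (a' u) * (\<bar>M\<bar> * (LINT v|lborel. norm (b' v)))" for u
        by (intro mult_left_mono) auto
      then show "AE u in lborel. norm (LINT v|lborel. norm (case (u, v) of (u, v) \<Rightarrow> a' u * b' v * d u v))
          \<le> norm (norm (a' u) * (\<bar>M\<bar> * (LINT v|lborel. norm (b' v))))"
        by (simp add: norm_mult abs_mult mult.assoc)
    qed
  qed
  have inner_b: "integral {r..s} (\<lambda>v. b v * c u v) = (LINT v|lborel. b' v * d u v)" if "u \<in> {p..q}" for u
  proof -
    have "integral {r..s} (\<lambda>v. b v * c u v) = integral {r..s} (\<lambda>v. b v * d u v)"
      using that by (intro integral_cong) (auto simp: d_def)
    then show ?thesis using integral_representative(1)[OF b' du[of u] M0] by simp
  qed
  have inner_a: "integral {p..q} (\<lambda>u. a u * c u v) = (LINT u|lborel. a' u * d u v)" if "v \<in> {r..s}" for v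
  proof -
    have "integral {p..q} (\<lambda>u. a u * c u v) = integral {p..q} (\<lambda>u. a u * d u v)"
      using that by (intro integral_cong) (auto simp: d_def)
    then show ?thesis using integral_representative(1)[OF a' dv[of v] M0] by simp
  qed
  define B where "B u = (LINT v|lborel. b' v * d u v)" for u
  define A where "A v = (LINT u|lborel. a' u * d u v)" for v
  have [measurable]: "B \<in> borel_measurable borel" "A \<in> borel_measurable borel"
    unfolding B_def A_def by measurable
  have bd: "norm (LINT v|lborel. b v * d v) \<le> \<bar>M\<bar> * (LINT v|lborel. norm (b v))"
    if b: "integrable lborel b" and d: "d \<in> borel_measurable borel" "\<And>v. norm (d v) \<le> \<bar>M\<bar>"
    for b d :: "real \<Rightarrow> complex"
  proof -
    have [measurable]: "b \<in> borel_measurable borel" using b by auto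
    note [measurable] = d(1)
    have le: "norm (b v * d v) \<le> \<bar>M\<bar> * norm (b v)" for v
      using mult_left_mono[OF d(2)[of v], of "norm (b v)"] by (simp add: norm_mult mult.commute)
    have "integrable lborel (\<lambda>v. b v * d v)"
      by (rule Bochner_Integration.integrable_bound[of _ "\<lambda>v. \<bar>M\<bar> * norm (b v)"]) (use b le in auto)
    then have "norm (LINT v|lborel. b v * d v) \<le> (LINT v|lborel. norm (b v * d v))"
      by (intro integral_norm_bound)
    also have "\<dots> \<le> (LINT v|lborel. \<bar>M\<bar> * norm (b v))"
      using le b \<open>integrable lborel (\<lambda>v. b v * d v)\<close> by (intro integral_mono) auto
    finally show ?thesis by simp
  qed
  have nB: "norm (B u) \<le> \<bar>M\<bar> * (LINT v|lborel. norm (b' v))" for u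
    unfolding B_def by (rule bd[OF b'(1) du M0])
  have nA: "norm (A u) \<le> \<bar>M\<bar> * (LINT v|lborel. norm (a' v))" for u
    unfolding A_def by (rule bd[OF a'(1) dv M0])
  note repB = integral_representative[OF a' _ nB, simplified]
  note repA = integral_representative[OF b' _ nA, simplified]
  show "(\<lambda>u. a u * integral {r..s} (\<lambda>v. b v * c u v)) absolutely_integrable_on {p..q}"
    by (rule absolutely_integrable_spike[OF repB(2) negligible_empty]) (auto simp: inner_b B_def)
  have "integral {p..q} (\<lambda>u. a u * integral {r..s} (\<lambda>v. b v * c u v)) = integral {p..q} (\<lambda>u. a u * B u)"
    by (intro integral_cong) (auto simp: inner_b B_def)
  also have "\<dots> = (LINT u|lborel. (LINT v|lborel. a' u * b' v * d u v))"
    using repB(1) by (simp add: B_def mult.assoc)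
  also have "\<dots> = (LINT v|lborel. (LINT u|lborel. a' u * b' v * d u v))"
    by (rule lborel_pair.Fubini_integral[symmetric]) (use prod in simp)
  also have "\<dots> = (LINT v|lborel. b' v * A v)"
  proof -
    have "(\<lambda>u. a' u * b' v * d u v) = (\<lambda>u. b' v * (a' u * d u v))" for v by (simp add: fun_eq_iff)
    then show ?thesis by (simp add: A_def)
  qed
  also have "\<dots> = integral {r..s} (\<lambda>v. b v * A v)" by (simp add: repA)
  also have "\<dots> = integral {r..s} (\<lambda>v. b v * integral {p..q} (\<lambda>u. a u * c u v))"
    by (intro integral_cong) (auto simp: inner_a A_def)
  finally show "integral {p..q} (\<lambda>u. a u * integral {r..s} (\<lambda>v. b v * c u v)) =
         integral {r..s} (\<lambda>v. b v * integral {p..q} (\<lambda>u. a u * c u v))" .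
qed

lemma absolutely_integrable_mult_bounded:
  fixes a c :: "real \<Rightarrow> complex"
  assumes a: "a absolutely_integrable_on {p..q}" and c: "c \<in> borel_measurable borel"
    and M: "\<And>u. u \<in> {p..q} \<Longrightarrow> norm (c u) \<le> M"
  shows "(\<lambda>u. a u * c u) absolutely_integrable_on {p..q}"
proof -
  define d where "d u = (if u \<in> {p..q} then c u else 0)" for u
  have d: "d \<in> borel_measurable borel"
    using c unfolding d_def by measurable
  have dM: "norm (d u) \<le> \<bar>M\<bar>" for u
    using M[of u] by (auto simp: d_def)
  obtain a' N where "integrable lborel a'" "\<And>u. u \<notin> {p..q} \<Longrightarrow> a' u = 0"
    "negligible N" "\<And>u. u \<in> {p..q} - N \<Longrightarrow> a u = a' u"
    by (rule borel_representative[OF a]) blast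
  from integral_representative(2)[OF this d dM]
  show ?thesis
    by (rule absolutely_integrable_spike[OF _ negligible_empty]) (auto simp: d_def)
qed

text \<open>Integrability is not assumed: both sides have the same \<open>has_integral\<close>
  values, and both are 0 when there is none.\<close>

lemma integral_if_subset:
  fixes f :: "real \<Rightarrow> 'a::banach"
  shows "S \<subseteq> T \<Longrightarrow> integral T (\<lambda>x. if x \<in> S then f x else 0) = integral S f"
  by (simp add: integral_def integrable_on_def)

text \<open>Turns a variable limit of integration into a bounded kernel, the form that
  \<open>fubini_kernel\<close> accepts.\<close>

lemma integral_upto:
  fixes a :: "real \<Rightarrow> complex"
  assumes "v \<le> T"
  shows "integral {0..T} (\<lambda>u. a u * (if u \<le> v then 1 else 0)) = integral {0..v} a"
proof -
  have "integral {0..T} (\<lambda>u. a u * (if u \<le> v then 1 else 0)) = integral {0..T} (\<lambda>u. if u \<in> {0..v} then a u else 0)"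
    by (intro integral_cong) auto
  also have "\<dots> = integral {0..v} a" by (rule integral_if_subset) (use assms in auto)
  finally show ?thesis .
qed

lemma integral_from:
  fixes a :: "real \<Rightarrow> complex"
  assumes "0 \<le> u"
  shows "integral {0..T} (\<lambda>v. a v * (if u \<le> v then 1 else 0)) = integral {u..T} a"
proof -
  have "integral {0..T} (\<lambda>v. a v * (if u \<le> v then 1 else 0)) = integral {0..T} (\<lambda>v. if v \<in> {u..T} then a v else 0)"
    by (intro integral_cong) auto
  also have "\<dots> = integral {u..T} a" by (rule integral_if_subset) (use assms in auto)
  finally show ?thesis .
qed

lemma integral_norm_le:
  fixes f :: "real \<Rightarrow> 'a::real_normed_vector"
  assumes "p \<le> q" "0 \<le> B" "\<And>x. x \<in> {p..q} \<Longrightarrow> norm (f x) \<le> B"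
  shows "norm (integral {p..q} f) \<le> B * (q - p)"
proof (cases "f integrable_on {p..q}")
  case True
  then show ?thesis
    using has_integral_bound[of B f "integral {p..q} f" p q] assms integrable_integral
    by (fastforce simp: mult.commute)
next
  case False
  \<comment> \<open>The integral of a non-integrable function is 0 by convention.\<close>
  then show ?thesis using assms by (simp add: not_integrable_integral)
qed

lemma integral_reflect_shift:
  fixes f :: "real \<Rightarrow> 'a::real_normed_vector"
  shows "integral {p..q} (\<lambda>s. f (t - s)) = integral {t - q..t - p} f"
proof -
  have "integral {p..q} (\<lambda>s. f (t - s)) = integral {-q..-p} (\<lambda>s. f (t + s))"
    using Henstock_Kurzweil_Integration.integral_reflect_real[of q p "\<lambda>s. f (t - s)"] by simp
  also have "\<dots> = integral {t - q..t - p} f"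
    using integral_shift_real_ivl[where a = "t - q" and b = "t - p" and c = t and f = f] by (simp add: algebra_simps)
  finally show ?thesis .
qed

lemma conv_commute: "conv f g t = conv g f t"
  using integral_reflect_shift[of 0 t "\<lambda>s. f s * g (t - s)" t] by (simp add: conv_def mult.commute)

text \<open>The product \<open>b' s * a' (t - s) * d t\<close> is integrable in the plane because
  translation preserves the L1 norm of \<open>a'\<close>; Fubini and the substitution t = u + v do
  the rest. As \<open>conv a b\<close> is controlled only almost everywhere, it is handled through
  its integrals against bounded functions \<open>c\<close>.\<close>

lemma conv_kernel:
  fixes a b c :: "real \<Rightarrow> complex"
  assumes a: "a absolutely_integrable_on {0..T}" and b: "b absolutely_integrable_on {0..T}"
  shows conv_absolutely_integrable: "conv a b absolutely_integrable_on {0..T}"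
    and "c \<in> borel_measurable borel \<Longrightarrow> (\<And>t. t \<in> {0..T} \<Longrightarrow> norm (c t) \<le> M) \<Longrightarrow>
      integral {0..T} (\<lambda>t. conv a b t * c t) =
      integral {0..T} (\<lambda>u. b u * integral {0..T} (\<lambda>v. a v * (if u + v \<le> T then c (u + v) else 0)))"
proof -
  obtain a' N where a': "integrable lborel a'" "\<And>u. u \<notin> {0..T} \<Longrightarrow> a' u = 0"
    "negligible N" "\<And>u. u \<in> {0..T} - N \<Longrightarrow> a u = a' u"
    by (rule borel_representative[OF a]) blast
  obtain b' N' where b': "integrable lborel b'" "\<And>u. u \<notin> {0..T} \<Longrightarrow> b' u = 0"
    "negligible N'" "\<And>u. u \<in> {0..T} - N' \<Longrightarrow> b u = b' u"
    by (rule borel_representative[OF b]) blast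
  have [measurable]: "a' \<in> borel_measurable borel" "b' \<in> borel_measurable borel"
    using a'(1) b'(1) borel_measurable_integrable by force+
  have shift: "integrable lborel (\<lambda>t. a' (t - s))" for s
    using lborel_integrable_real_affine[OF a'(1), of 1 "-s"] by simp
  have shift': "(LINT t|lborel. norm (a' (t - s))) = (LINT t|lborel. norm (a' t))" for s
    using lborel_integral_real_affine[of 1 "\<lambda>t. norm (a' t)" "-s"] by simp
  have prod: "integrable (lborel \<Otimes>\<^sub>M lborel) (\<lambda>(s, t). b' s * a' (t - s) * d t)"
    if [measurable]: "d \<in> borel_measurable borel" and M: "\<And>t. norm (d t) \<le> M" for d :: "real \<Rightarrow> complex" and M
  proof (rule lborel_pair.Fubini_integrable)
    have le: "norm (a' (t - s) * d t) \<le> M * norm (a' (t - s))" for s t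
      using mult_left_mono[OF M, of "norm (a' (t - s))" t] by (simp add: norm_mult mult.commute)
    have M0: "M \<ge> 0" using M[of 0] norm_ge_zero order_trans by blast
    have i: "integrable lborel (\<lambda>t. a' (t - s) * d t)" for s
      by (rule Bochner_Integration.integrable_bound[of _ "\<lambda>t. M * norm (a' (t - s))"])
        (use shift[of s] le M0 in \<open>auto simp: abs_mult\<close>)
    show "(\<lambda>(s, t). b' s * a' (t - s) * d t) \<in> borel_measurable (lborel \<Otimes>\<^sub>M lborel)"
      by measurable
    show "AE s in lborel. integrable lborel (\<lambda>t. case (s, t) of (s, t) \<Rightarrow> b' s * a' (t - s) * d t)"
      using i by (auto simp: mult.assoc)
    show "integrable lborel (\<lambda>s. LINT t|lborel. norm (case (s, t) of (s, t) \<Rightarrow> b' s * a' (t - s) * d t))"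
    proof (rule Bochner_Integration.integrable_bound)
      show "integrable lborel (\<lambda>s. norm (b' s) * (M * (LINT t|lborel. norm (a' t))))"
        using b' by auto
      show "(\<lambda>s. LINT t|lborel. norm (case (s, t) of (s, t) \<Rightarrow> b' s * a' (t - s) * d t)) \<in> borel_measurable lborel"
        by measurable
      have "(LINT t|lborel. norm (a' (t - s) * d t)) \<le> (LINT t|lborel. M * norm (a' (t - s)))" for s
        using le i[of s] shift[of s] by (intro integral_mono) auto
      then have "(LINT t|lborel. norm (a' (t - s) * d t)) \<le> M * (LINT t|lborel. norm (a' t))" for s
        by (simp add: shift')
      then show "AE s in lborel. norm (LINT t|lborel. norm (case (s, t) of (s, t) \<Rightarrow> b' s * a' (t - s) * d t))
          \<le> norm (norm (b' s) * (M * (LINT t|lborel. norm (a' t))))"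
        using M0 by (auto simp: norm_mult abs_mult mult.assoc intro!: mult_left_mono)
    qed
  qed
  define C where "C t = (LINT s|lborel. b' s * a' (t - s))" for t
  have [measurable]: "C \<in> borel_measurable borel" unfolding C_def by measurable
  \<comment> \<open>At almost every \<open>t\<close> the section is integrable. There the
    exceptional sets \<open>N'\<close> and \<open>t - N\<close> are both null, so \<open>a\<close>
    and \<open>b\<close> may be exchanged for their representatives.\<close>
  have ae: "AE t in lborel. t \<in> {0..T} \<longrightarrow> conv a b t = C t"
  proof -
    have "AE t in lborel. integrable lborel (\<lambda>s. b' s * a' (t - s))"
      using lborel_pair.AE_integrable_snd[OF prod[of "\<lambda>_. 1" 1]] by simp
    then show ?thesis
    proof eventually_elim
      case (elim t)
      show ?case
      proof
        assume t: "t \<in> {0..T}"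
        have neg: "negligible ((\<lambda>x. t - x) ` N)"
          by (rule negligible_differentiable_image_negligible[OF _ a'(3)])
            (auto simp: differentiable_on_def)
        have "conv a b t = integral {0..t} (\<lambda>s. b' s * a' (t - s))"
          unfolding conv_def
        proof (rule integral_spike[OF negligible_Un[OF b'(3) neg]])
          fix s assume s: "s \<in> {0..t} - (N' \<union> (\<lambda>x. t - x) ` N)"
          then have "t - s \<notin> N" by (auto simp: image_iff dest: bspec[of _ _ "t - s"])
          with s t a'(4)[of "t - s"] b'(4)[of s] show "b' s * a' (t - s) = a (t - s) * b s"
            by (simp add: mult.commute)
        qed
        also have "\<dots> = integral UNIV (\<lambda>s. b' s * a' (t - s))"
          by (rule integral_spike_set)
            (auto intro!: negligible_subset[OF negligible_empty] simp: a'(2) b'(2))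
        also have "\<dots> = C t" unfolding C_def using integral_lborel[OF elim] by simp
        finally show "conv a b t = C t" .
      qed
    qed
  qed
  have intC: "integrable lborel C"
    using lborel_pair.integrable_snd[OF prod[of "\<lambda>_. 1" 1]] by (simp add: C_def[abs_def])
  obtain Z where Z: "negligible Z" "\<And>t. t \<in> {0..T} - Z \<Longrightarrow> conv a b t = C t"
  proof -
    from AE_completion[OF ae] have "negligible {t. \<not> (t \<in> {0..T} \<longrightarrow> conv a b t = C t)}"
      by (simp add: eventually_ae_filter_negligible) (meson negligible_subset)
    then show ?thesis using that by blast
  qed
  have aiC: "C absolutely_integrable_on {0..T}"
  proof -
    have "integrable lborel (\<lambda>t. indicator {0..T} t *\<^sub>R C t)"
      by (rule integrable_mult_indicator) (use intC in auto)
    then show ?thesis by (simp add: set_integrable_def integrable_completion)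
  qed
  show "conv a b absolutely_integrable_on {0..T}"
    by (rule absolutely_integrable_spike[OF aiC Z(1)]) (use Z in auto)
  assume c[measurable]: "c \<in> borel_measurable borel" and M: "\<And>t. t \<in> {0..T} \<Longrightarrow> norm (c t) \<le> M"
  define d where "d t = (if t \<in> {0..T} then c t else 0)" for t
  have d[measurable]: "d \<in> borel_measurable borel" unfolding d_def by measurable
  have Md: "norm (d t) \<le> \<bar>M\<bar>" for t using M[of t] by (auto simp: d_def)
  define C' where "C' t = (if t \<in> {0..T} then C t else 0)" for t
  have C': "integrable lborel C'"
  proof -
    have "integrable lborel (\<lambda>t. indicator {0..T} t *\<^sub>R C t)"
      by (rule integrable_mult_indicator) (use intC in auto)
    moreover have "C' = (\<lambda>t. indicator {0..T} t *\<^sub>R C t)" by (auto simp: C'_def)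
    ultimately show ?thesis by simp
  qed
  have inner: "integral {0..T} (\<lambda>v. a v * (if u + v \<le> T then c (u + v) else 0)) =
     (LINT t|lborel. a' (t - u) * d t)" if u: "u \<in> {0..T}" for u
  proof -
    have "integral {0..T} (\<lambda>v. a v * (if u + v \<le> T then c (u + v) else 0)) = integral {0..T} (\<lambda>v. a v * d (u + v))"
      using u by (intro integral_cong) (auto simp: d_def)
    also have "\<dots> = (LINT v|lborel. a' v * d (u + v))"
      by (rule integral_representative(1)[OF a' _ Md]) measurable
    also have "\<dots> = (LINT t|lborel. a' (t - u) * d t)"
      using lborel_integral_real_affine[of 1 "\<lambda>v. a' v * d (u + v)" "-u"] by simp
    finally show ?thesis .
  qed
  have bd: "norm (LINT t|lborel. a' (t - u) * d t) \<le> \<bar>M\<bar> * (LINT t|lborel. norm (a' t))" for u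
  proof -
    have le: "norm (a' (t - s) * d t) \<le> \<bar>M\<bar> * norm (a' (t - s))" for s t
      using mult_left_mono[OF Md, of "norm (a' (t - s))" t] by (simp add: norm_mult mult.commute)
    have i: "integrable lborel (\<lambda>t. a' (t - s) * d t)" for s
      by (rule Bochner_Integration.integrable_bound[of _ "\<lambda>t. \<bar>M\<bar> * norm (a' (t - s))"])
        (use shift[of s] le in \<open>auto simp: abs_mult\<close>)
    have "norm (LINT t|lborel. a' (t - u) * d t) \<le> (LINT t|lborel. norm (a' (t - u) * d t))"
      by (rule integral_norm_bound)
    also have "\<dots> \<le> (LINT t|lborel. \<bar>M\<bar> * norm (a' (t - u)))"
      using le i[of u] shift[of u] by (intro integral_mono) auto
    finally show ?thesis by (simp add: shift')
  qed
  have "integral {0..T} (\<lambda>t. conv a b t * c t) = integral {0..T} (\<lambda>t. conv a b t * d t)"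
    by (intro integral_cong) (auto simp: d_def)
  also have "\<dots> = (LINT t|lborel. C' t * d t)"
    by (rule integral_representative(1)[OF C' _ Z(1) _ d Md]) (use Z in \<open>auto simp: C'_def\<close>)
  also have "\<dots> = (LINT t|lborel. (LINT s|lborel. b' s * a' (t - s) * d t))"
    by (intro Bochner_Integration.integral_cong) (auto simp: C'_def C_def d_def)
  also have "\<dots> = (LINT s|lborel. (LINT t|lborel. b' s * a' (t - s) * d t))"
    by (rule lborel_pair.Fubini_integral) (use prod[OF d Md] in simp)
  also have "\<dots> = (LINT s|lborel. b' s * (LINT t|lborel. a' (t - s) * d t))"
    by (simp add: mult.assoc)
  also have "\<dots> = integral {0..T} (\<lambda>s. b s * (LINT t|lborel. a' (t - s) * d t))"
    by (rule integral_representative(1)[OF b' _ bd, symmetric]) measurable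
  also have "\<dots> = integral {0..T} (\<lambda>u. b u * integral {0..T} (\<lambda>v. a v * (if u + v \<le> T then c (u + v) else 0)))"
    by (intro integral_cong) (simp add: inner)
  finally show "integral {0..T} (\<lambda>t. conv a b t * c t) =
      integral {0..T} (\<lambda>u. b u * integral {0..T} (\<lambda>v. a v * (if u + v \<le> T then c (u + v) else 0)))" .
qed

section \<open>Titchmarsh's convolution theorem\<close>

lemma continuous_on_Icc_bound:
  fixes f :: "real \<Rightarrow> 'a::real_normed_vector"
  assumes "continuous_on {a..b} f"
  obtains B where "0 \<le> B" "\<And>x. x \<in> {a..b} \<Longrightarrow> norm (f x) \<le> B"
proof -
  obtain B where "0 < B" "\<forall>x\<in>f ` {a..b}. norm x \<le> B"
    using compact_imp_bounded[OF compact_continuous_image[OF assms]] by (auto simp: bounded_pos)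
  then show ?thesis by (intro that[of B]) auto
qed

lemma sums_integral:
  fixes f :: "nat \<Rightarrow> real \<Rightarrow> complex"
  assumes cont: "\<And>k. continuous_on {a..b} (f k)"
    and m: "\<And>k x. x \<in> {a..b} \<Longrightarrow> norm (f k x) \<le> m k" "summable m"
    and g: "\<And>x. x \<in> {a..b} \<Longrightarrow> (\<lambda>k. f k x) sums g x"
  shows "(\<lambda>k. integral {a..b} (f k)) sums integral {a..b} g"
proof -
  have "uniform_limit {a..b} (\<lambda>n x. \<Sum>k<n. f k x) (\<lambda>x. \<Sum>k. f k x) sequentially"
    by (rule Weierstrass_m_test[OF m])
  moreover have "(\<lambda>x. \<Sum>k. f k x) x = g x" if "x \<in> {a..b}" for x
    using g[OF that] by (simp add: sums_iff)
  ultimately have ul: "uniform_limit {a..b} (\<lambda>n x. \<Sum>k<n. f k x) g sequentially"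
    by (subst uniform_limit_cong'[where g = "\<lambda>n x. \<Sum>k<n. f k x" and i = "\<lambda>x. \<Sum>k. f k x"]) auto
  obtain I J where I: "\<And>n. ((\<lambda>x. \<Sum>k<n. f k x) has_integral I n) {a..b}"
    and J: "(g has_integral J) {a..b}" "I \<longlonglongrightarrow> J"
    by (rule uniform_limit_integral[OF ul])
      (auto intro!: continuous_intros cont)
  have "I n = (\<Sum>k<n. integral {a..b} (f k))" for n
    using I[of n] cont by (subst (asm) has_integral_integrable_integral)
      (auto simp: integral_sum integrable_continuous_real)
  then have "I = (\<lambda>n. \<Sum>k<n. integral {a..b} (f k))" by auto
  with J show ?thesis by (simp add: sums_def integral_unique)
qed

text \<open>For \<open>y = exp (n (x - t))\<close> the functions \<open>1 - exp (- y)\<close> tend to the indicator function of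
  \<open>x > t\<close>, and their power series in \<open>y\<close> integrates against \<open>u\<close> to a combination of the moments.\<close>

lemma exp_moments_bounded_imp_zero:
  fixes u :: "real \<Rightarrow> complex"
  assumes cont: "continuous_on {0..c} u"
    and M: "\<And>n::nat. norm (integral {0..c} (\<lambda>x. of_real (exp (real n * x)) * u x)) \<le> M"
    and x: "x \<in> {0..c}" and c: "0 < c"
  shows "u x = 0"
proof -
  obtain B where B0: "0 \<le> B" and B: "\<And>x. x \<in> {0..c} \<Longrightarrow> norm (u x) \<le> B"
    by (rule continuous_on_Icc_bound[OF cont]) blast
  have M0: "0 \<le> M" using M[of 0] norm_ge_zero order_trans by blast
  have zero: "integral {t..c} u = 0" if t: "0 < t" "t < c" for t
  proof -
    define q where "q n x = of_real (1 - exp (- exp (real n * (x - t)))) * u x" for n :: nat and x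
    \<comment> \<open>Pointwise limit of \<open>q n\<close>. The value at \<open>x = t\<close> comes
      from exp 0 = 1 and is later discarded as a null set.\<close>
    define g where "g x = (if x > t then u x else if x = t then of_real (1 - exp (-1)) * u x else 0)" for x
    have bound: "norm (integral {0..c} (q n)) \<le> M * (exp (exp (- real n * t)) - 1)" for n
    proof -
      define Y where "Y = exp (real n * (c - t))"
      \<comment> \<open>Terms of the series of 1 - exp (- y), which has no constant term. Each is a
        multiple, with factor exp (- n t) to the power \<open>Suc k\<close>, of the moment of index
        \<open>n * Suc k\<close>.\<close>
      define f where "f k x = of_real (- ((- exp (real n * (x - t))) ^ Suc k / fact (Suc k))) * u x" for k x
      have exps: "(\<lambda>k. y ^ Suc k / fact (Suc k)) sums (exp y - 1)" for y :: real
        using exp_converges[of y] by (subst sums_Suc_iff) (simp add: field_simps)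
      have sm: "(\<lambda>k. integral {0..c} (f k)) sums integral {0..c} (q n)"
      proof (rule sums_integral)
        show "continuous_on {0..c} (f k)" for k
          unfolding f_def by (intro continuous_intros cont) auto
        show "summable (\<lambda>k. Y ^ Suc k / fact (Suc k) * B)"
          using exps[of Y] by (intro summable_mult2) (auto simp: sums_iff)
        show "norm (f k x) \<le> Y ^ Suc k / fact (Suc k) * B" if "x \<in> {0..c}" for k x
        proof -
          have "exp (real n * (x - t)) \<le> Y" unfolding Y_def using that by (auto intro!: mult_left_mono)
          then have "exp (real n * (x - t)) ^ Suc k / fact (Suc k) \<le> Y ^ Suc k / fact (Suc k)"
            by (intro divide_right_mono power_mono) auto
          moreover have "norm (f k x) = exp (real n * (x - t)) ^ Suc k / fact (Suc k) * norm (u x)"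
            unfolding f_def norm_mult norm_of_real by (simp add: abs_mult power_abs del: fact_Suc)
          ultimately show ?thesis
            using mult_mono[OF _ B[OF that], of "exp (real n * (x - t)) ^ Suc k / fact (Suc k)" "Y ^ Suc k / fact (Suc k)"]
            by (simp add: Y_def del: fact_Suc power_Suc)
        qed
        show "(\<lambda>k. f k x) sums q n x" for x
          using sums_mult2[OF sums_of_real[OF sums_minus[OF exps[of "- exp (real n * (x - t))"]]], of "u x"]
          by (simp add: f_def q_def)
      qed
      have nf: "norm (integral {0..c} (f k)) \<le> M * (exp (- real n * t) ^ Suc k / fact (Suc k))" for k
      proof -
        have "f k = (\<lambda>x. of_real (- ((- 1) ^ Suc k * exp (- real n * t) ^ Suc k / fact (Suc k))) *
            (of_real (exp (real (n * Suc k) * x)) * u x))"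
        proof
          fix x
          have "exp (real n * (x - t)) ^ Suc k = exp (- real n * t) ^ Suc k * exp (real (n * Suc k) * x)"
            by (simp only: exp_of_nat_mult[symmetric] exp_add[symmetric])
              (simp add: algebra_simps)
          moreover have "(- exp (real n * (x - t))) ^ Suc k = (-1) ^ Suc k * exp (real n * (x - t)) ^ Suc k"
            by (rule power_minus)
          ultimately have "(- exp (real n * (x - t))) ^ Suc k =
            (-1) ^ Suc k * (exp (- real n * t) ^ Suc k * exp (real (n * Suc k) * x))" by simp
          then show "f k x = of_real (- ((- 1) ^ Suc k * exp (- real n * t) ^ Suc k / fact (Suc k))) *
            (of_real (exp (real (n * Suc k) * x)) * u x)"
            unfolding f_def by (simp only: of_real_mult[symmetric] mult.assoc[symmetric]) simp
        qed
        then have "integral {0..c} (f k) = of_real (- ((- 1) ^ Suc k * exp (- real n * t) ^ Suc k / fact (Suc k))) *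
            integral {0..c} (\<lambda>x. of_real (exp (real (n * Suc k) * x)) * u x)" by simp
        then have "norm (integral {0..c} (f k)) = (exp (- real n * t) ^ Suc k / fact (Suc k)) *
            norm (integral {0..c} (\<lambda>x. of_real (exp (real (n * Suc k) * x)) * u x))"
          by (simp only: norm_mult norm_of_real)
             (simp add: abs_mult power_abs)
        also have "\<dots> \<le> (exp (- real n * t) ^ Suc k / fact (Suc k)) * M"
          by (intro mult_left_mono M) auto
        finally show ?thesis by (simp add: mult.commute)
      qed
      have s2: "(\<lambda>k. M * (exp (- real n * t) ^ Suc k / fact (Suc k))) sums (M * (exp (exp (- real n * t)) - 1))"
        by (intro sums_mult exps)
      have "norm (\<Sum>k. integral {0..c} (f k)) \<le> (\<Sum>k. M * (exp (- real n * t) ^ Suc k / fact (Suc k)))"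
        by (rule norm_suminf_le[OF nf]) (use s2 in \<open>auto simp: sums_iff\<close>)
      then show ?thesis using sm s2 by (simp add: sums_iff)
    qed
    \<comment> \<open>Here 0 < t enters: exp (- n t) tends to 0 and takes the bound with it.\<close>
    have "(\<lambda>n. M * (exp (exp (- real n * t)) - 1)) \<longlonglongrightarrow> M * (exp 0 - 1)"
    proof -
      have "(\<lambda>n. exp (- t) ^ n) \<longlonglongrightarrow> 0" by (rule LIMSEQ_realpow_zero) (use t in auto)
      then have "(\<lambda>n. exp (- real n * t)) \<longlonglongrightarrow> 0"
        by (simp add: exp_of_nat_mult[symmetric])
      then show ?thesis by (intro tendsto_intros)
    qed
    then have "(\<lambda>n. M * (exp (exp (- real n * t)) - 1)) \<longlonglongrightarrow> 0" by simp
    then have q0: "(\<lambda>n. integral {0..c} (q n)) \<longlonglongrightarrow> 0"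
      by (rule Lim_null_comparison[OF always_eventually, rotated]) (rule allI, rule bound)
    have "(\<lambda>n. integral {0..c} (q n)) \<longlonglongrightarrow> integral {0..c} g"
    proof (rule dominated_convergence)
      show "q n integrable_on {0..c}" for n
        unfolding q_def by (intro integrable_continuous_real continuous_intros cont)
      show "(\<lambda>x. B) integrable_on {0..c}" by (rule integrable_on_const) auto
      show "norm (q n x) \<le> B" if "x \<in> {0..c}" for n x
      proof -
        have "norm (q n x) = \<bar>1 - exp (- exp (real n * (x - t)))\<bar> * norm (u x)"
          unfolding q_def norm_mult norm_of_real ..
        also have "\<dots> \<le> 1 * B" using B[OF that] by (intro mult_mono) auto
        finally show ?thesis by simp
      qed
      fix x assume "x \<in> {0..c}"
      have pw: "(\<lambda>n. exp (real n * y)) \<longlonglongrightarrow> 0" if "y < 0" for y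
        using LIMSEQ_realpow_zero[of "exp y"] that by (simp add: exp_of_nat_mult[symmetric])
      consider "x < t" | "x = t" | "x > t" by linarith
      then show "(\<lambda>n. q n x) \<longlonglongrightarrow> g x"
      proof cases
        case 1
        have "(\<lambda>n. q n x) \<longlonglongrightarrow> of_real (1 - exp (- 0)) * u x"
          unfolding q_def by (intro tendsto_intros pw) (use 1 in simp)
        then show ?thesis using 1 by (simp add: g_def)
      next
        case 2 then show ?thesis by (simp add: q_def g_def)
      next
        case 3
        have "(\<lambda>n. exp (- exp (real n * (x - t)))) \<longlonglongrightarrow> 0"
        proof (rule tendsto_sandwich[OF _ _ tendsto_const pw])
          have "- exp (real n * (x - t)) \<le> real n * - (x - t)" for n
            using exp_ge_add_one_self[of "real n * (x - t)"] unfolding mult_minus_right by linarith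
          then show "\<forall>\<^sub>F n in sequentially. exp (- exp (real n * (x - t))) \<le> exp (real n * - (x - t))" by simp
        qed (use 3 in auto)
        then have "(\<lambda>n. q n x) \<longlonglongrightarrow> of_real (1 - 0) * u x"
          unfolding q_def by (intro tendsto_intros)
        then show ?thesis using 3 by (simp add: g_def)
      qed
    qed
    then have "integral {0..c} g = 0" using q0 LIMSEQ_unique by blast
    also have "integral {0..c} g = integral {0..c} (\<lambda>x. if x \<in> {t..c} then u x else 0)"
      by (rule integral_spike[of "{t}"]) (auto simp: g_def)
    also have "\<dots> = integral {t..c} u"
      using t by (subst integral_if_subset) auto
    finally show ?thesis .
  qed
  have ui: "u integrable_on {0..c}" by (rule integrable_continuous_real[OF cont])
  have u0: "u t = 0" if t: "t \<in> {0<..<c}" for t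
  proof -
    \<comment> \<open>As all tail integrals vanish, the primitive of \<open>u\<close> is constant on
      the open interval.\<close>
    have "((\<lambda>s. integral {0..s} u) has_vector_derivative u t) (at t within {0..c})"
      by (rule integral_has_vector_derivative[OF cont]) (use t in auto)
    then have d1: "((\<lambda>s. integral {0..s} u) has_vector_derivative u t) (at t)"
      using t by (simp add: at_within_Icc_at)
    have "((\<lambda>s. integral {0..c} u) has_vector_derivative 0) (at t)" by simp
    then have "((\<lambda>s. integral {0..s} u) has_vector_derivative 0) (at t)"
    proof (rule has_vector_derivative_transform_within_open)
      show "integral {0..c} u = integral {0..s} u" if "s \<in> {0<..<c}" for s
        using Henstock_Kurzweil_Integration.integral_combine[OF _ _ ui, of s] zero[of s] that by auto
    qed (use t in auto)
    then show ?thesis using d1 vector_derivative_unique_at by blast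
  qed
  have "closure {0<..<c} = {0..c}" using c by simp
  then show ?thesis
    using continuous_constant_on_closure[of "{0<..<c}" u 0 x] cont u0 x by simp
qed

text \<open>Termwise integration of the exponential series shows that all exponential moments vanish
  as well, so the previous criterion applies with bound 0.\<close>

lemma power_moments_zero_imp_zero:
  fixes u :: "real \<Rightarrow> complex"
  assumes cont: "continuous_on {0..c} u"
    and M: "\<And>n::nat. integral {0..c} (\<lambda>x. of_real (x ^ n) * u x) = 0"
    and x: "x \<in> {0..c}" and c: "0 < c"
  shows "u x = 0"
proof (rule exp_moments_bounded_imp_zero[OF cont _ x c])
  obtain B where B: "\<And>x. x \<in> {0..c} \<Longrightarrow> norm (u x) \<le> B"
    by (rule continuous_on_Icc_bound[OF cont]) blast
  fix n :: nat
  define f where "f k x = of_real ((real n * x) ^ k / fact k) * u x" for k x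
  have exps: "(\<lambda>k. y ^ k / fact k) sums exp y" for y :: real
    using exp_converges[of y] by (simp add: field_simps)
  have "(\<lambda>k. integral {0..c} (f k)) sums integral {0..c} (\<lambda>x. of_real (exp (real n * x)) * u x)"
  proof (rule sums_integral)
    show "continuous_on {0..c} (f k)" for k
      unfolding f_def by (intro continuous_intros cont) auto
    show "summable (\<lambda>k. (real n * c) ^ k / fact k * B)"
      using exps[of "real n * c"] by (intro summable_mult2) (auto simp: sums_iff)
    show "norm (f k x) \<le> (real n * c) ^ k / fact k * B" if "x \<in> {0..c}" for k x
    proof -
      have "(real n * x) ^ k / fact k \<le> (real n * c) ^ k / fact k"
        using that by (intro divide_right_mono power_mono mult_left_mono) auto
      moreover have "norm (f k x) = (real n * x) ^ k / fact k * norm (u x)"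
        using that by (simp add: f_def norm_mult norm_divide norm_power)
      moreover have "0 \<le> (real n * c) ^ k / fact k" using c by simp
      ultimately show ?thesis
        using mult_mono[OF _ B[OF that], of "(real n * x) ^ k / fact k" "(real n * c) ^ k / fact k"]
        by simp
    qed
    show "(\<lambda>k. f k x) sums (of_real (exp (real n * x)) * u x)" for x
      unfolding f_def by (intro sums_mult2 sums_of_real exps)
  qed
  moreover have "integral {0..c} (f k) = 0" for k
  proof -
    have "f k = (\<lambda>x. of_real (real n ^ k / fact k) * (of_real (x ^ k) * u x))"
      by (auto simp: f_def power_mult_distrib)
    then show ?thesis using M[of k] by simp
  qed
  ultimately have "integral {0..c} (\<lambda>x. of_real (exp (real n * x)) * u x) = 0"
    by (simp add: sums_iff)
  then show "norm (integral {0..c} (\<lambda>x. of_real (exp (real n * x)) * u x)) \<le> 0" by simp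
qed

section \<open>Continuity and algebra of scalar convolution\<close>

lemma continuous_absolutely_integrable:
  fixes f :: "real \<Rightarrow> complex"
  assumes "continuous_on UNIV f"
  shows "f absolutely_integrable_on {a..b}"
  by (rule absolutely_integrable_continuous_real) (rule continuous_on_subset[OF assms], simp)

lemma conv_commute_ext: "conv f g = conv g f"
  by (rule ext) (rule conv_commute)

lemma conv_eq_0_nonpos: "t \<le> 0 \<Longrightarrow> conv f g t = 0"
  by (cases "t = 0") (auto simp: conv_def)

lemma continuous_on_conv:
  fixes f g :: "real \<Rightarrow> complex"
  assumes f: "continuous_on UNIV f" and g: "continuous_on UNIV g"
  shows "continuous_on UNIV (conv f g)"
proof -
  \<comment> \<open>Rescaling to the fixed interval [0, 1] makes \<open>t\<close> a mere parameter.
    The \<open>max\<close> matches the value 0 of \<open>conv\<close> at negative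
    \<open>t\<close>.\<close>
  have eq: "conv f g t = of_real (max 0 t) * integral {0..1} (\<lambda>s. f (max 0 t - s * max 0 t) * g (s * max 0 t))" for t
  proof (cases "t > 0")
    case True
    have "((\<lambda>s. f (t - s) * g s) has_integral conv f g t) {0..t}"
      unfolding conv_def
      by (intro integrable_integral integrable_continuous_real continuous_intros
          continuous_on_compose2[OF f] continuous_on_compose2[OF g]) auto
    from has_integral_affinity[OF this[unfolded interval_cbox], of t 0] True
    have "((\<lambda>s. f (t - t * s) * g (t * s)) has_integral (1 / t) *\<^sub>R conv f g t) ((\<lambda>s. s / t) ` {0..t})"
      by (simp add: interval_cbox[symmetric] del: image_divide_atLeastAtMost)
    then have "((\<lambda>s. f (t - s * t) * g (s * t)) has_integral (1 / t) *\<^sub>R conv f g t) {0..1}"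
      using True by (simp add: mult.commute)
    then have "integral {0..1} (\<lambda>s. f (t - s * t) * g (s * t)) = (1 / t) *\<^sub>R conv f g t"
      by (rule integral_unique)
    then show ?thesis using True by (simp add: scaleR_conv_of_real)
  qed (simp add: conv_eq_0_nonpos)
  have "continuous_on (UNIV \<times> cbox 0 1) (\<lambda>(t, s). f (max 0 t - s * max 0 t) * g (s * max 0 t))"
    unfolding case_prod_beta
    by (intro continuous_intros continuous_on_compose2[OF f] continuous_on_compose2[OF g]) auto
  then have "continuous_on UNIV (\<lambda>t. integral (cbox 0 1) (\<lambda>s. f (max 0 t - s * max 0 t) * g (s * max 0 t)))"
    by (rule integral_continuous_on_param)
  then have "continuous_on UNIV (\<lambda>t. of_real (max 0 t) *
      integral {0..1} (\<lambda>s. f (max 0 t - s * max 0 t) * g (s * max 0 t)))"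
    by (intro continuous_on_mult continuous_intros) simp
  moreover have "conv f g = (\<lambda>t. of_real (max 0 t) *
      integral {0..1} (\<lambda>s. f (max 0 t - s * max 0 t) * g (s * max 0 t)))"
    using eq by blast
  ultimately show ?thesis by simp
qed

text \<open>Associativity at every single \<open>t\<close>: the continuous factor, reflected at
  \<open>t\<close>, serves as the bounded function against which \<open>conv f g\<close> is
  integrated.\<close>

lemma conv_left_commute_continuous:
  fixes f g h :: "real \<Rightarrow> complex"
  assumes f: "f absolutely_integrable_on {0..t}" and g: "g absolutely_integrable_on {0..t}"
    and h: "continuous_on UNIV h"
  shows "conv h (conv f g) t = conv (conv h f) g t"
proof -
  have hb: "h \<in> borel_measurable borel" using h by (rule borel_measurable_continuous_onI)
  obtain B where B: "\<And>s. s \<in> {0..t} \<Longrightarrow> norm (h s) \<le> B"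
    by (rule continuous_on_Icc_bound[OF continuous_on_subset[OF h]]) auto
  have "conv h (conv f g) t = integral {0..t} (\<lambda>s. conv f g s * h (t - s))"
    by (simp add: conv_def mult.commute)
  also have "\<dots> = integral {0..t} (\<lambda>u. g u * integral {0..t} (\<lambda>v. f v * (if u + v \<le> t then h (t - (u + v)) else 0)))"
    by (rule conv_kernel(2)[OF f g, where M = B]) (use hb B in auto)
  also have "\<dots> = integral {0..t} (\<lambda>u. conv h f (t - u) * g u)"
  proof (rule integral_cong)
    fix u assume u: "u \<in> {0..t}"
    have "integral {0..t} (\<lambda>v. f v * (if u + v \<le> t then h (t - (u + v)) else 0)) =
        integral {0..t} (\<lambda>v. if v \<in> {0..t-u} then f v * h (t - u - v) else 0)"
      by (intro integral_cong) (auto simp: algebra_simps)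
    also have "\<dots> = conv h f (t - u)"
      using u by (subst integral_if_subset) (auto simp: conv_def mult.commute)
    finally show "g u * integral {0..t} (\<lambda>v. f v * (if u + v \<le> t then h (t - (u + v)) else 0)) =
      conv h f (t - u) * g u" by simp
  qed
  also have "\<dots> = conv (conv h f) g t" by (simp add: conv_def)
  finally show ?thesis .
qed

lemma conv_assoc:
  fixes f g h :: "real \<Rightarrow> complex"
  assumes "continuous_on UNIV f" "continuous_on UNIV g" "continuous_on UNIV h"
  shows "conv (conv h f) g = conv h (conv f g)"
  using conv_left_commute_continuous[OF continuous_absolutely_integrable continuous_absolutely_integrable]
    assms by (intro ext) simp

lemma conv_integrable:
  fixes f g :: "real \<Rightarrow> complex"
  assumes "continuous_on UNIV f" "continuous_on UNIV g"
  shows "(\<lambda>s. f (t - s) * g s) integrable_on {0..t}"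
  by (intro integrable_continuous_real continuous_intros
          continuous_on_compose2[OF assms(1)] continuous_on_compose2[OF assms(2)]) auto

lemma conv_add_right:
  fixes f g :: "real \<Rightarrow> complex"
  assumes "continuous_on UNIV f" "continuous_on UNIV g" "continuous_on UNIV h"
  shows "conv f (\<lambda>t. g t + h t) t = conv f g t + conv f h t"
  using conv_integrable[OF assms(1,2)] conv_integrable[OF assms(1,3)]
  by (simp add: conv_def distrib_left Henstock_Kurzweil_Integration.integral_add)

text \<open>Writing t = (t - s) + s under the integral shows that multiplication by t is a
  derivation for convolution.\<close>

lemma mult_conv:
  fixes f g :: "real \<Rightarrow> complex"
  assumes f: "continuous_on UNIV f" and g: "continuous_on UNIV g"
  shows "of_real t * conv f g t = conv (\<lambda>s. of_real s * f s) g t + conv f (\<lambda>s. of_real s * g s) t"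
proof -
  have "continuous_on UNIV (\<lambda>s. of_real s * f s)" "continuous_on UNIV (\<lambda>s. of_real s * g s)"
    using f g by (auto intro!: continuous_intros)
  from conv_integrable[OF this(1) g] conv_integrable[OF f this(2)]
  have "conv (\<lambda>s. of_real s * f s) g t + conv f (\<lambda>s. of_real s * g s) t =
    integral {0..t} (\<lambda>s. of_real (t - s) * f (t - s) * g s + f (t - s) * (of_real s * g s))"
    unfolding conv_def by (rule Henstock_Kurzweil_Integration.integral_add[symmetric])
  also have "\<dots> = integral {0..t} (\<lambda>s. of_real t * (f (t - s) * g s))"
    by (intro integral_cong) (simp add: algebra_simps)
  finally show ?thesis by (simp add: conv_def)
qed

text \<open>The square of the truncated Laplace integral \<open>L n\<close> sees only the region u +
  v \<ge> 2c, hence \<open>L n\<close> is of order exp (- n c). Multiplied by exp (n c), this bounds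
  the exponential moments of the reflected function h (c - x).\<close>

lemma conv_square_zero_imp_zero:
  fixes h :: "real \<Rightarrow> complex"
  assumes h: "continuous_on UNIV h" and c: "0 < c"
    and z: "\<And>s. 0 \<le> s \<Longrightarrow> s < 2 * c \<Longrightarrow> conv h h s = 0" and t: "t \<in> {0..c}"
  shows "h t = 0"
proof -
  let ?T = "2 * c"
  obtain B where B: "0 \<le> B" "\<And>s. s \<in> {0..?T} \<Longrightarrow> norm (h s) \<le> B"
    by (rule continuous_on_Icc_bound[OF continuous_on_subset[OF h, of "{0..?T}"]]) auto
  have hi: "h absolutely_integrable_on {p..q}" for p q by (rule continuous_absolutely_integrable[OF h])
  define e :: "nat \<Rightarrow> real \<Rightarrow> complex" where "e n w = of_real (exp (- (real n * w)))" for n w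
  have e_add: "e n (u + v) = e n u * e n v" for n u v
    by (simp add: e_def exp_add[symmetric] algebra_simps flip: of_real_mult)
  have e_cont: "continuous_on A (e n)" for n A unfolding e_def by (intro continuous_intros)
  have e_le: "norm (e n w) \<le> exp (- (real n * d))" if "d \<le> w" for n w d
    using that by (simp add: e_def mult_left_mono)
  define L where "L n = integral {0..?T} (\<lambda>u. h u * e n u)" for n
  have L_bound: "norm (L n) \<le> ?T * B * exp (- (real n * c))" for n
  proof -
    \<comment> \<open>The exponential is cut at u + v = 2c: \<open>c1\<close> is integrated against
      \<open>conv h h\<close>, which is 0 there, and \<open>c2\<close> is at most exp (- 2 n
      c).\<close>
    define c1 where "c1 w = (if w < ?T then e n w else 0)" for w
    define c2 where "c2 w = (if w < ?T then 0 else e n w)" for w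
    have c_meas[measurable]: "c1 \<in> borel_measurable borel" "c2 \<in> borel_measurable borel"
      using borel_measurable_continuous_onI[OF e_cont[of UNIV n]] unfolding c1_def c2_def by measurable
    have cb: "norm (c1 w) \<le> 1" "norm (c2 w) \<le> 1" if "w \<ge> 0" for w
      using e_le[of 0 w n] that by (auto simp: c1_def c2_def)
    have "0 = integral {0..?T} (\<lambda>t. conv h h t * c1 t)"
      using z by (subst integral_cong[of _ _ "\<lambda>_. 0"]) (auto simp: c1_def)
    also have "\<dots> = integral {0..?T} (\<lambda>u. h u * integral {0..?T} (\<lambda>v. h v * (if u + v \<le> ?T then c1 (u + v) else 0)))"
      by (rule conv_kernel(2)[OF hi hi, where M = 1]) (use cb in auto)
    \<comment> \<open>\<open>c1\<close> already vanishes from 2c on, so the cutoff is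
      redundant.\<close>
    also have "\<dots> = integral {0..?T} (\<lambda>u. h u * integral {0..?T} (\<lambda>v. h v * c1 (u + v)))"
      by (intro integral_cong arg_cong2[where f = "(*)"]) (auto simp: c1_def)
    finally have z1: "integral {0..?T} (\<lambda>u. h u * integral {0..?T} (\<lambda>v. h v * c1 (u + v))) = 0" by simp
    have "L n * L n = integral {0..?T} (\<lambda>u. h u * integral {0..?T} (\<lambda>v. h v * e n (u + v)))"
    proof -
      have "h u * integral {0..?T} (\<lambda>v. h v * e n (u + v)) = h u * e n u * L n" for u
      proof -
        have "integral {0..?T} (\<lambda>v. h v * e n (u + v)) = integral {0..?T} (\<lambda>v. e n u * (h v * e n v))"
          by (intro integral_cong) (simp add: e_add)
        then show ?thesis by (simp add: L_def)
      qed
      then have "integral {0..?T} (\<lambda>u. h u * integral {0..?T} (\<lambda>v. h v * e n (u + v))) =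
        integral {0..?T} (\<lambda>u. h u * e n u * L n)" by (intro integral_cong)
      then show ?thesis by (simp add: L_def)
    qed
    also have "\<dots> = integral {0..?T} (\<lambda>u. h u * integral {0..?T} (\<lambda>v. h v * c1 (u + v)) +
        h u * integral {0..?T} (\<lambda>v. h v * c2 (u + v)))"
    proof (intro integral_cong)
      fix u assume u: "u \<in> {0..?T}"
      have "(\<lambda>v. h v * c1 (u + v)) absolutely_integrable_on {0..?T}"
        "(\<lambda>v. h v * c2 (u + v)) absolutely_integrable_on {0..?T}"
        using u cb by (auto intro!: absolutely_integrable_mult_bounded[OF hi, where M = 1])
      then have "integral {0..?T} (\<lambda>v. h v * c1 (u + v)) + integral {0..?T} (\<lambda>v. h v * c2 (u + v)) =
        integral {0..?T} (\<lambda>v. h v * c1 (u + v) + h v * c2 (u + v))"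
        by (intro Henstock_Kurzweil_Integration.integral_add[symmetric])
          (auto intro: set_lebesgue_integral_eq_integral(1))
      also have "\<dots> = integral {0..?T} (\<lambda>v. h v * e n (u + v))"
        by (intro integral_cong) (auto simp: c1_def c2_def)
      finally show "h u * integral {0..?T} (\<lambda>v. h v * e n (u + v)) =
        h u * integral {0..?T} (\<lambda>v. h v * c1 (u + v)) + h u * integral {0..?T} (\<lambda>v. h v * c2 (u + v))"
        by (simp add: distrib_left flip: distrib_left)
    qed
    also have "\<dots> = integral {0..?T} (\<lambda>u. h u * integral {0..?T} (\<lambda>v. h v * c1 (u + v))) +
        integral {0..?T} (\<lambda>u. h u * integral {0..?T} (\<lambda>v. h v * c2 (u + v)))"
      by (intro Henstock_Kurzweil_Integration.integral_add set_lebesgue_integral_eq_integral(1)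
            fubini_kernel(1)[OF hi hi, where M = 1]) (use cb in auto)
    finally have LL: "L n * L n = integral {0..?T} (\<lambda>u. h u * integral {0..?T} (\<lambda>v. h v * c2 (u + v)))"
      using z1 by simp
    have "norm (L n * L n) \<le> (B * (B * exp (- (real n * ?T)) * (?T - 0))) * (?T - 0)"
      unfolding LL
    proof (rule integral_norm_le)
      fix u assume u: "u \<in> {0..?T}"
      have "norm (integral {0..?T} (\<lambda>v. h v * c2 (u + v))) \<le> B * exp (- (real n * ?T)) * (?T - 0)"
      proof (rule integral_norm_le)
        fix v assume v: "v \<in> {0..?T}"
        have "norm (c2 (u + v)) \<le> exp (- (real n * ?T))"
          using e_le[of ?T "u + v" n] by (auto simp: c2_def)
        then show "norm (h v * c2 (u + v)) \<le> B * exp (- (real n * ?T))"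
          unfolding norm_mult using B v by (intro mult_mono) auto
      qed (use B c in auto)
      then show "norm (h u * integral {0..?T} (\<lambda>v. h v * c2 (u + v))) \<le> B * (B * exp (- (real n * ?T)) * (?T - 0))"
        unfolding norm_mult using B u by (intro mult_mono) auto
    qed (use B c in auto)
    also have "\<dots> = (?T * B * exp (- (real n * c))) ^ 2"
      by (simp add: power2_eq_square algebra_simps exp_add[symmetric])
    finally have "norm (L n) ^ 2 \<le> (?T * B * exp (- (real n * c))) ^ 2"
      by (simp add: norm_mult power2_eq_square)
    then show ?thesis by (rule power2_le_imp_le) (use B c in auto)
  qed
  \<comment> \<open>In the bound, \<open>?T * B\<close> is the contribution of \<open>L n\<close>
    and \<open>B * c\<close> that of the piece over [c, 2c], both after multiplication by exp (n
    c).\<close>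
  have "h (c - (c - t)) = 0"
  proof (rule exp_moments_bounded_imp_zero[of c "\<lambda>x. h (c - x)" "?T * B + B * c"])
    show "continuous_on {0..c} (\<lambda>x. h (c - x))"
      by (intro continuous_on_compose2[OF h] continuous_intros) auto
    fix n :: nat
    have "integral {0..c} (\<lambda>x. of_real (exp (real n * x)) * h (c - x)) =
      integral {0..c} (\<lambda>u. of_real (exp (real n * (c - u))) * h u)"
      using integral_reflect_shift[of 0 c "\<lambda>u. of_real (exp (real n * (c - u))) * h u" c] by simp
    also have "\<dots> = of_real (exp (real n * c)) * integral {0..c} (\<lambda>u. h u * e n u)"
      by (subst integral_mult_right[symmetric], intro integral_cong)
        (simp add: e_def exp_add[symmetric] algebra_simps flip: of_real_mult)
    also have "integral {0..c} (\<lambda>u. h u * e n u) = L n - integral {c..?T} (\<lambda>u. h u * e n u)"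
    proof -
      have "(\<lambda>u. h u * e n u) integrable_on {0..?T}"
        by (intro integrable_continuous_real continuous_intros e_cont continuous_on_subset[OF h]) auto
      from Henstock_Kurzweil_Integration.integral_combine[OF _ _ this, of c] c
      show ?thesis by (simp add: L_def algebra_simps)
    qed
    finally have "norm (integral {0..c} (\<lambda>x. of_real (exp (real n * x)) * h (c - x))) =
      exp (real n * c) * norm (L n - integral {c..?T} (\<lambda>u. h u * e n u))" by (simp add: norm_mult)
    also have "\<dots> \<le> exp (real n * c) * (?T * B * exp (- (real n * c)) + B * exp (- (real n * c)) * (?T - c))"
    proof (intro mult_left_mono order.trans[OF norm_triangle_ineq4] add_mono L_bound integral_norm_le)
      fix u assume u: "u \<in> {c..?T}"
      show "norm (h u * e n u) \<le> B * exp (- (real n * c))"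
        unfolding norm_mult using u B c by (intro mult_mono e_le) auto
    qed (use B c in auto)
    also have "\<dots> = ?T * B + B * c"
      by (simp add: algebra_simps exp_add[symmetric])
    finally show "norm (integral {0..c} (\<lambda>x. of_real (exp (real n * x)) * h (c - x))) \<le> ?T * B + B * c" .
  qed (use t c in auto)
  then show ?thesis by simp
qed

text \<open>Negative arguments are left out because \<open>conv\<close> never reads them. The strict
  upper bound makes the supremum of all possible \<open>c\<close> again possible, so that a first
  support point is attained.\<close>

definition vanishes_before :: "(real \<Rightarrow> complex) \<Rightarrow> real \<Rightarrow> bool" where
  "vanishes_before h c \<longleftrightarrow> (\<forall>s. 0 \<le> s \<longrightarrow> s < c \<longrightarrow> h s = 0)"

lemma vanishes_before_mono: "vanishes_before h c \<Longrightarrow> d \<le> c \<Longrightarrow> vanishes_before h d"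
  by (auto simp: vanishes_before_def)

text \<open>The elementary inequality for first support points, of which Titchmarsh's theorem is the
  converse: s < b or t - s < a for every s.\<close>

lemma vanishes_before_conv:
  assumes "vanishes_before f a" "vanishes_before g b"
  shows "vanishes_before (conv f g) (a + b)"
  unfolding vanishes_before_def
proof (intro allI impI)
  fix t :: real assume t: "0 \<le> t" "t < a + b"
  have "f (t - s) * g s = 0" if "s \<in> {0..t}" for s
    using assms t that by (cases "s < b") (auto simp: vanishes_before_def)
  then show "conv f g t = 0"
    unfolding conv_def by (subst integral_cong[of _ _ "\<lambda>_. 0"]) auto
qed

lemma vanishes_before_sharp:
  assumes "\<not> vanishes_before h d"
  obtains b where "0 \<le> b" "b < d" "vanishes_before h b" "\<And>e. e > b \<Longrightarrow> \<not> vanishes_before h e"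
proof -
  define B where "B = {c. 0 \<le> c \<and> vanishes_before h c}"
  have sub: "c < d" if "c \<in> B" for c
    using assms that vanishes_before_mono[of h c d] by (force simp: B_def)
  have ne: "0 \<in> B" by (auto simp: B_def vanishes_before_def)
  have bdd: "bdd_above B" using sub by (meson bdd_above.I less_imp_le)
  have v: "vanishes_before h (Sup B)"
    unfolding vanishes_before_def
  proof (intro allI impI)
    fix s assume "0 \<le> s" "s < Sup B"
    then obtain c where "c \<in> B" "s < c" using less_cSup_iff[OF _ bdd, of s] ne by auto
    then show "h s = 0" using \<open>0 \<le> s\<close> by (auto simp: B_def vanishes_before_def)
  qed
  have "0 \<le> Sup B" using cSup_upper[OF ne bdd] .
  with v have "Sup B \<in> B" by (simp add: B_def)
  show ?thesis
  proof (rule that[OF \<open>0 \<le> Sup B\<close> sub[OF \<open>Sup B \<in> B\<close>] v])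
    fix e assume "e > Sup B"
    then show "\<not> vanishes_before h e"
      using cSup_upper[of e B] bdd \<open>0 \<le> Sup B\<close> by (auto simp: B_def)
  qed
qed

text \<open>If the conclusion fails, the first support point \<open>\<zeta>\<^sub>n\<close> of \<open>t\<^sup>i f * t\<^sup>j g\<close> depends only on
  \<open>n = i + j\<close> and decreases at least linearly in \<open>n\<close>: the square of \<open>t\<^sup>i f * t\<^sup>j\<^sup>+\<^sup>1 g\<close> is a
  combination of \<open>(t\<^sup>i f * t\<^sup>j\<^sup>+\<^sup>1 g) * t(t\<^sup>i f * t\<^sup>j g)\<close> and \<open>(t\<^sup>i f * t\<^sup>j g) * (t\<^sup>i\<^sup>+\<^sup>1 f * t\<^sup>j\<^sup>+\<^sup>1 g)\<close>,
  and its first support point is \<open>2 \<zeta>\<^sub>n\<^sub>+\<^sub>1\<close> by the case of equal factors.\<close>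

lemma conv_zero_imp_conv_mult_zero:
  fixes f g :: "real \<Rightarrow> complex"
  assumes f: "continuous_on UNIV f" and g: "continuous_on UNIV g"
    and z: "vanishes_before (conv f g) T"
  shows "vanishes_before (conv f (\<lambda>t. of_real t * g t)) T"
proof (rule ccontr)
  define F where "F i = (\<lambda>t. of_real t ^ i * f t)" for i :: nat
  define H where "H i = (\<lambda>t. of_real t ^ i * g t)" for i :: nat
  have cF: "continuous_on UNIV (F i)" and cH: "continuous_on UNIV (H i)" for i
    unfolding F_def H_def using f g by (auto intro!: continuous_intros)
  define C where "C i j = conv (F i) (H j)" for i j
  have cC: "continuous_on UNIV (C i j)" for i j
    unfolding C_def by (rule continuous_on_conv[OF cF cH])
  have FS: "F (Suc i) = (\<lambda>s. of_real s * F i s)" and HS: "H (Suc i) = (\<lambda>s. of_real s * H i s)" for i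
    by (auto simp: F_def H_def fun_eq_iff)
  have tC: "of_real t * C i j t = C (Suc i) j t + C i (Suc j) t" for i j t
    unfolding C_def FS HS by (rule mult_conv[OF cF cH])
  have vsum: "vanishes_before (\<lambda>t. C (Suc i) j t + C i (Suc j) t) c" if "vanishes_before (C i j) c" for i j c
    using that by (simp add: vanishes_before_def flip: tC)
  assume "\<not> vanishes_before (conv f (\<lambda>t. of_real t * g t)) T"
  then have "\<not> vanishes_before (C 0 1) T" by (simp add: C_def F_def H_def)
  then obtain b where b: "0 \<le> b" "b < T" "vanishes_before (C 0 1) b"
    "\<And>e. e > b \<Longrightarrow> \<not> vanishes_before (C 0 1) e"
    by (rule vanishes_before_sharp) blast
  define \<delta> where "\<delta> = T - b"
  have d: "\<delta> > 0" using b by (simp add: \<delta>_def)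
  \<comment> \<open>Where \<open>C i j\<close> vanishes, \<open>tC\<close> makes its two neighbours
    negatives of each other. This is why a whole level shares one first support point.\<close>
  have flip: "vanishes_before (C (Suc i) j) e \<longleftrightarrow> vanishes_before (C i (Suc j)) e"
    if "vanishes_before (C i j) c'" "e \<le> c'" for i j c' e
    using vanishes_before_mono[OF vsum[OF that(1)] that(2)]
    by (auto simp: vanishes_before_def add_eq_0_iff)
  have spread: "vanishes_before (C i j) e \<longleftrightarrow> vanishes_before (C 0 (Suc n)) e"
    if "\<And>i j. i + j = n \<Longrightarrow> vanishes_before (C i j) c'" "e \<le> c'" "i + j = Suc n" for i j n c' e
    using that(3)
  proof (induction i arbitrary: j)
    case (Suc i)
    then show ?case using flip[OF that(1), of i j e] that(2) by auto
  qed simp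
  \<comment> \<open>Here \<open>c\<close> is the exact first support point of level n + 1 and
    \<open>c'\<close> a lower bound for level n. The gap \<delta> is passed on from level to
    level.\<close>
  have Q: "\<exists>c c'. c + \<delta> \<le> c' \<and> c \<le> T - (real n + 1) * \<delta> \<and> 0 \<le> c \<and>
      (\<forall>i j. i + j = n \<longrightarrow> vanishes_before (C i j) c') \<and>
      (\<forall>i j. i + j = Suc n \<longrightarrow> vanishes_before (C i j) c \<and> (\<forall>e>c. \<not> vanishes_before (C i j) e))" for n
  proof (induction n)
    case 0
    have z0: "vanishes_before (C i j) T" if "i + j = 0" for i j
      using that z by (simp add: C_def F_def H_def)
    have "vanishes_before (C i j) b \<and> (\<forall>e>b. \<not> vanishes_before (C i j) e)" if ij: "i + j = Suc 0" for i j
    proof (intro conjI allI impI)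
      have s: "vanishes_before (C i j) e \<longleftrightarrow> vanishes_before (C 0 (Suc 0)) e" if "e \<le> T" for e
        by (rule spread[of 0 T]) (use z0 ij that in auto)
      show "vanishes_before (C i j) b" using s[of b] b by simp
      fix e assume "e > b"
      \<comment> \<open>The comparison of different \<open>i\<close>, \<open>j\<close> is valid only
        up to \<open>T\<close>, hence the minimum.\<close>
      then have "\<not> vanishes_before (C i j) (min e T)" using s[of "min e T"] b(2) b(4)[of "min e T"] by simp
      then show "\<not> vanishes_before (C i j) e" using vanishes_before_mono[of _ e "min e T"] by auto
    qed
    then show ?case using z0 b by (intro exI[of _ b] exI[of _ T]) (auto simp: \<delta>_def)
  next
    case (Suc n)
    then obtain c c' where c: "c + \<delta> \<le> c'" "c \<le> T - (real n + 1) * \<delta>" "0 \<le> c"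
      and c'v: "\<And>i j. i + j = n \<Longrightarrow> vanishes_before (C i j) c'"
      and cv: "\<And>i j. i + j = Suc n \<Longrightarrow> vanishes_before (C i j) c"
      and cs: "\<And>i j e. i + j = Suc n \<Longrightarrow> e > c \<Longrightarrow> \<not> vanishes_before (C i j) e" by blast
    let ?p = "C 0 n" and ?q = "C 0 (Suc n)" and ?r = "C 1 (Suc n)"
    have nv: "\<not> vanishes_before ?r e" if e: "e > c - \<delta>" for e
    proof
      assume rv: "vanishes_before ?r e"
      define m where "m = min (c + c') (c' + e)"
      have "conv ?q (\<lambda>t. of_real t * ?p t) s = conv ?q (C 1 n) s + conv ?q ?q s" for s
        unfolding tC using conv_add_right[OF cC cC cC] by simp
      moreover have "conv ?q (C 1 n) = conv ?p ?r"
      proof -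
        have "conv ?q (C 1 n) = conv (conv (H (Suc n)) (F 0)) (conv (F 1) (H n))"
          by (metis C_def conv_commute ext)
        also have "\<dots> = conv (H (Suc n)) (conv (F 0) (conv (H n) (F 1)))"
          by (simp add: conv_assoc cF cH continuous_on_conv conv_commute_ext[of "F (Suc 0)" "H n"])
        also have "\<dots> = conv (H (Suc n)) (conv ?p (F 1))"
          by (simp add: conv_assoc cF cH C_def)
        also have "\<dots> = conv (conv ?p (F 1)) (H (Suc n))" by (rule ext) (rule conv_commute)
        also have "\<dots> = conv ?p ?r" by (simp add: conv_assoc cF cH cC C_def[of "Suc 0"])
        finally show ?thesis .
      qed
      ultimately have qq: "conv ?q ?q s = conv ?q (\<lambda>t. of_real t * ?p t) s - conv ?p ?r s" for s
        by (simp add: algebra_simps)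
      have v0: "vanishes_before ?q c" "vanishes_before ?p c'" using cv c'v by auto
      then have "vanishes_before (\<lambda>t. of_real t * ?p t) c'" by (auto simp: vanishes_before_def)
      then have v1: "vanishes_before (conv ?q (\<lambda>t. of_real t * ?p t)) m"
        using vanishes_before_conv[OF v0(1)] vanishes_before_mono m_def by (metis min.cobounded1)
      have v2: "vanishes_before (conv ?p ?r) m"
        using vanishes_before_conv[OF v0(2) rv] vanishes_before_mono m_def by (metis min.cobounded2)
      have vq: "vanishes_before (conv ?q ?q) m"
        using v1 v2 by (simp add: vanishes_before_def qq)
      \<comment> \<open>From c' \<ge> c + \<delta> and e > c - \<delta> follow c + c' > 2c and c' +
        e > 2c. The case of equal factors then contradicts the sharpness of
        \<open>c\<close>.\<close>
      have "m > 2 * c" using c e d by (auto simp: m_def)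
      have "vanishes_before ?q (m / 2)"
        unfolding vanishes_before_def
      proof (intro allI impI)
        fix s assume "0 \<le> s" "s < m / 2"
        then show "?q s = 0"
          using conv_square_zero_imp_zero[OF cC, of "m/2" 0 "Suc n" s] vq c(3) \<open>m > 2 * c\<close>
          by (auto simp: vanishes_before_def)
      qed
      then show False using cs[of 0 "Suc n" "m/2"] \<open>m > 2 * c\<close> by simp
    qed
    have "\<not> vanishes_before ?r c" using nv[of c] d by simp
    then obtain z where z: "0 \<le> z" "z < c" "vanishes_before ?r z" "\<And>e. e > z \<Longrightarrow> \<not> vanishes_before ?r e"
      by (rule vanishes_before_sharp) blast
    have zc: "z \<le> c - \<delta>" using nv z(3) by (meson not_le)
    have "vanishes_before (C i j) z \<and> (\<forall>e>z. \<not> vanishes_before (C i j) e)" if ij: "i + j = Suc (Suc n)" for i j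
    proof (intro conjI allI impI)
      have s: "vanishes_before (C i j) e \<longleftrightarrow> vanishes_before ?r e" if "e \<le> c" for e
      proof -
        have "vanishes_before ?r e \<longleftrightarrow> vanishes_before (C 0 (Suc (Suc n))) e"
          by (rule spread[OF cv that]) auto
        then show ?thesis using spread[OF cv that ij] by simp
      qed
      show "vanishes_before (C i j) z" using s[of z] z by simp
      fix e assume "e > z"
      then have "\<not> vanishes_before (C i j) (min e c)" using s[of "min e c"] z(2) z(4)[of "min e c"] by simp
      then show "\<not> vanishes_before (C i j) e" using vanishes_before_mono[of _ e "min e c"] by auto
    qed
    moreover have "z \<le> T - (real (Suc n) + 1) * \<delta>" using zc c(2) by (simp add: algebra_simps)
    ultimately show ?case using cv z(1) zc by (intro exI[of _ z] exI[of _ c]) auto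
  qed
  \<comment> \<open>A first support point cannot be negative, yet \<open>Q\<close> pushes it below T
    - (n + 1) \<delta>.\<close>
  obtain n :: nat where "T < real n * \<delta>" using reals_Archimedean3[OF d] by blast
  moreover have "0 \<le> T - (real n + 1) * \<delta>" using Q[of n] by force
  ultimately show False using d by (simp add: algebra_simps)
qed

text \<open>Iterating the previous lemma gives zero for all power moments of r \<mapsto> f (s - r) g
  r on [0, s], so this product vanishes identically. It is evaluated at the point \<open>t\<close>
  where \<open>g\<close> is not zero.\<close>

theorem titchmarsh_continuous:
  fixes f g :: "real \<Rightarrow> complex"
  assumes f: "continuous_on UNIV f" and g: "continuous_on UNIV g"
    and z: "vanishes_before (conv f g) T" and t: "0 \<le> t" "t < T" "g t \<noteq> 0"
  shows "vanishes_before f (T - t)"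
proof -
  have vn: "vanishes_before (conv f (\<lambda>t. of_real t ^ n * g t)) T" for n
  proof (induction n)
    case (Suc n)
    have "continuous_on UNIV (\<lambda>t. of_real t ^ n * g t)" by (intro continuous_intros g)
    from conv_zero_imp_conv_mult_zero[OF f this Suc] show ?case by (simp add: mult.assoc)
  qed (use z in simp)
  have nz: "f (s - t) = 0" if s: "t < s" "s < T" for s
  proof -
    have "f (s - t) * g t = 0"
    proof (rule power_moments_zero_imp_zero[of s "\<lambda>r. f (s - r) * g r"])
      show "continuous_on {0..s} (\<lambda>r. f (s - r) * g r)"
        by (intro continuous_intros continuous_on_compose2[OF f] continuous_on_subset[OF g]) auto
      show "integral {0..s} (\<lambda>x. of_real (x ^ n) * (f (s - x) * g x)) = 0" for n
        using vn[of n] s t by (simp add: vanishes_before_def conv_def algebra_simps)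
    qed (use s t in auto)
    then show ?thesis using t by simp
  qed
  have "f s = 0" if s: "s \<in> {0..<T - t}" for s
  proof (rule continuous_constant_on_closure[of "{0<..<T - t}" f])
    show "continuous_on (closure {0<..<T - t}) f" by (rule continuous_on_subset[OF f]) simp
    show "f x = 0" if "x \<in> {0<..<T - t}" for x using nz[of "x + t"] that by simp
    show "s \<in> closure {0<..<T - t}" using s t by simp
  qed
  then show ?thesis by (auto simp: vanishes_before_def)
qed

section \<open>Complex scalar multiplication as a bounded bilinear map\<close>

lemma bounded_bilinear_scaleC: "bounded_bilinear (scaleC :: complex \<Rightarrow> 'a::complex_banach \<Rightarrow> 'a)"
proof
  fix a b :: complex and x y :: 'a and r :: real
  show "(a + b) *\<^sub>C x = a *\<^sub>C x + b *\<^sub>C x" by (rule scaleC_add_left)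
  show "a *\<^sub>C (x + y) = a *\<^sub>C x + a *\<^sub>C y" by (rule scaleC_add_right)
  show "(r *\<^sub>R a) *\<^sub>C x = r *\<^sub>R (a *\<^sub>C x)"
    by (simp add: scaleC_of_real[symmetric] scaleC_scaleC scaleR_conv_of_real)
  show "a *\<^sub>C (r *\<^sub>R x) = r *\<^sub>R (a *\<^sub>C x)"
    by (simp add: scaleC_of_real[symmetric] scaleC_scaleC mult.commute)
  show "\<exists>K. \<forall>(a::complex) (b::'a). norm (a *\<^sub>C b) \<le> norm a * norm b * K"
    by (rule exI[of _ 1]) (simp add: norm_scaleC)
qed

interpretation scaleC: bounded_bilinear "scaleC :: complex \<Rightarrow> 'a::complex_banach \<Rightarrow> 'a"
  by (rule bounded_bilinear_scaleC)

lemma scaleC_one [simp]: "1 *\<^sub>C x = (x :: 'a::complex_banach)"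
  using scaleC_of_real[of 1 x] by simp

lemmas continuous_on_scaleC = scaleC.continuous_on

section \<open>Separation of points by functionals\<close>

definition sublinear :: "('a::real_normed_vector \<Rightarrow> real) \<Rightarrow> bool" where
  "sublinear p \<longleftrightarrow> (\<forall>x y. p (x + y) \<le> p x + p y) \<and> (\<forall>r>0. \<forall>x. p (r *\<^sub>R x) \<le> r * p x)"

lemma sublinear_zero: "sublinear p \<Longrightarrow> p 0 = 0"
proof -
  assume "sublinear p"
  then have "\<And>r. r > 0 \<Longrightarrow> p (r *\<^sub>R 0) \<le> r * p 0" unfolding sublinear_def by blast
  from this[of 2] this[of "1/2"] show ?thesis by simp
qed

lemma sublinear_scale: assumes "sublinear p" "r \<ge> 0" shows "p (r *\<^sub>R x) = r * p x"
proof (cases "r = 0")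
  case False
  then have r: "r > 0" using assms by simp
  have "p (inverse r *\<^sub>R (r *\<^sub>R x)) \<le> inverse r * p (r *\<^sub>R x)"
    using assms(1) r unfolding sublinear_def by (meson positive_imp_inverse_positive)
  then have "r * p x \<le> p (r *\<^sub>R x)" using r by (simp add: field_simps)
  moreover have "p (r *\<^sub>R x) \<le> r * p x" using assms(1) r unfolding sublinear_def by blast
  ultimately show ?thesis by simp
qed (use sublinear_zero[OF assms(1)] in simp)

lemma sublinear_lower: assumes "sublinear p" shows "- p (- x) \<le> p x"
proof -
  have "p (x + - x) \<le> p x + p (- x)" using assms unfolding sublinear_def by blast
  then show ?thesis using sublinear_zero[OF assms] by simp
qed

text \<open>\<open>q\<close> lies below \<open>p\<close> (t = 0) and satisfies q x \<le> p (x + y) -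
  p y (t = 1). If \<open>q\<close> equals \<open>p\<close>, the latter is superadditivity in the
  direction \<open>y\<close>. The infimum is finite, being bounded below by - p (- x).\<close>

lemma sublinear_directional:
  fixes y :: "'a::real_normed_vector"
  assumes p: "sublinear p"
  defines "q \<equiv> \<lambda>x. INF t\<in>{0..}. p (x + t *\<^sub>R y) - t * p y"
  shows "sublinear q" "\<And>x t. t \<ge> 0 \<Longrightarrow> q x \<le> p (x + t *\<^sub>R y) - t * p y"
proof -
  have low: "- p (- x) \<le> p (x + t *\<^sub>R y) - t * p y" if "t \<ge> 0" for x t
  proof -
    have "p ((x + t *\<^sub>R y) + - x) \<le> p (x + t *\<^sub>R y) + p (- x)" using p unfolding sublinear_def by blast
    then show ?thesis using sublinear_scale[OF p that] by simp
  qed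
  have bdd: "bdd_below ((\<lambda>t. p (x + t *\<^sub>R y) - t * p y) ` {0..})" for x
    using low by (intro bdd_belowI2[of _ "- p (- x)"]) auto
  show le: "q x \<le> p (x + t *\<^sub>R y) - t * p y" if "t \<ge> 0" for x t
    unfolding q_def by (rule cINF_lower[OF bdd]) (use that in auto)
  have ge: "c \<le> q x" if "\<And>t. t \<ge> 0 \<Longrightarrow> c \<le> p (x + t *\<^sub>R y) - t * p y" for c x
    unfolding q_def by (rule cINF_greatest) (use that in auto)
  show "sublinear q"
    unfolding sublinear_def
  proof (intro conjI allI impI)
    fix x1 x2
    have "q (x1 + x2) - (p (x2 + s *\<^sub>R y) - s * p y) \<le> q x1" if s: "s \<ge> 0" for s
    proof (rule ge)
      fix t :: real assume t: "t \<ge> 0"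
      have "q (x1 + x2) \<le> p ((x1 + x2) + (t + s) *\<^sub>R y) - (t + s) * p y" using le s t by simp
      also have "(x1 + x2) + (t + s) *\<^sub>R y = (x1 + t *\<^sub>R y) + (x2 + s *\<^sub>R y)" by (simp add: algebra_simps)
      also have "p \<dots> \<le> p (x1 + t *\<^sub>R y) + p (x2 + s *\<^sub>R y)" using p unfolding sublinear_def by blast
      finally show "q (x1 + x2) - (p (x2 + s *\<^sub>R y) - s * p y) \<le> p (x1 + t *\<^sub>R y) - t * p y"
        by (simp add: algebra_simps)
    qed
    then have "q (x1 + x2) - q x1 \<le> q x2" by (intro ge) (simp add: algebra_simps)
    then show "q (x1 + x2) \<le> q x1 + q x2" by simp
  next
    fix r :: real and x assume r: "r > 0"
    have "q (r *\<^sub>R x) / r \<le> q x"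
    proof (rule ge)
      fix t :: real assume t: "t \<ge> 0"
      have "q (r *\<^sub>R x) \<le> p (r *\<^sub>R x + (r * t) *\<^sub>R y) - (r * t) * p y" using le r t by simp
      also have "r *\<^sub>R x + (r * t) *\<^sub>R y = r *\<^sub>R (x + t *\<^sub>R y)" by (simp add: algebra_simps)
      also have "p \<dots> = r * p (x + t *\<^sub>R y)" using sublinear_scale[OF p] r by simp
      finally show "q (r *\<^sub>R x) / r \<le> p (x + t *\<^sub>R y) - t * p y"
        using r by (simp add: field_simps)
    qed
    then show "q (r *\<^sub>R x) \<le> r * q x" using r by (simp add: field_simps)
  qed
qed

text \<open>A minimal sublinear functional below \<open>q\<close> is linear, because it coincides with all its
  directional modifications.\<close>

lemma linear_below_sublinear:
  fixes q :: "'a::real_normed_vector \<Rightarrow> real"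
  assumes q: "sublinear q"
  obtains F where "linear F" "\<And>x. F x \<le> q x"
proof -
  define S where "S = {p :: 'a \<Rightarrow> real. sublinear p \<and> p \<le> q}"
  \<comment> \<open>Zorn's lemma for the reversed order: a maximal element is a minimal
    functional.\<close>
  have "\<exists>m\<in>S. \<forall>a\<in>S. (\<lambda>a b. b \<le> a) m a \<longrightarrow> a = m"
  proof (rule predicate_Zorn)
    show "partial_order_on S (relation_of (\<lambda>a b. b \<le> a) S)"
      by (rule partial_order_on_relation_ofI) auto
    fix C assume "C \<in> Chains (relation_of (\<lambda>a b. b \<le> a) S)"
    then have CS: "C \<subseteq> S" and ch: "\<And>a b. a \<in> C \<Longrightarrow> b \<in> C \<Longrightarrow> a \<le> b \<or> b \<le> a"
      by (auto simp: Chains_def relation_of_def)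
    show "\<exists>u\<in>S. \<forall>a\<in>C. u \<le> a"
    proof (cases "C = {}")
      case True
      then show ?thesis using q by (intro bexI[of _ q]) (auto simp: S_def)
    next
      case False
      define u where "u x = (INF p\<in>C. p x)" for x
      have low: "- q (- x) \<le> p x" if "p \<in> C" for p x
      proof -
        have "sublinear p" "p (- x) \<le> q (- x)" using that CS by (auto simp: S_def le_fun_def)
        then show ?thesis using sublinear_lower[of p x] by simp
      qed
      have bdd: "bdd_below ((\<lambda>p. p x) ` C)" for x using low by (intro bdd_belowI2[of _ "- q (- x)"]) auto
      have le: "u x \<le> p x" if "p \<in> C" for p x
        unfolding u_def by (rule cINF_lower[OF bdd that])
      have ge: "c \<le> u x" if "\<And>p. p \<in> C \<Longrightarrow> c \<le> p x" for c x
        unfolding u_def by (rule cINF_greatest[OF False that])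
      have "sublinear u"
        unfolding sublinear_def
      proof (intro conjI allI impI)
        fix x y
        have "u (x + y) - p' y \<le> u x" if p': "p' \<in> C" for p'
        proof (rule ge)
          fix p assume p: "p \<in> C"
          \<comment> \<open>The smaller of two chain members lies below both, so subadditivity of
            one functional suffices.\<close>
          define m where "m = (if p \<le> p' then p else p')"
          have m: "m \<in> C" "m \<le> p" "m \<le> p'" using ch[OF p p'] p p' by (auto simp: m_def)
          have "u (x + y) \<le> m (x + y)" using le m by blast
          also have "\<dots> \<le> m x + m y" using m CS by (auto simp: S_def sublinear_def)
          also have "\<dots> \<le> p x + p' y" using m by (auto simp: le_fun_def intro: add_mono)
          finally show "u (x + y) - p' y \<le> p x" by simp
        qed
        then have "u (x + y) - u x \<le> u y" by (intro ge) (simp add: algebra_simps)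
        then show "u (x + y) \<le> u x + u y" by simp
      next
        fix r :: real and x assume r: "r > 0"
        have "u (r *\<^sub>R x) / r \<le> u x"
        proof (rule ge)
          fix p assume p: "p \<in> C"
          then have "u (r *\<^sub>R x) \<le> r * p x" using le[OF p, of "r *\<^sub>R x"] CS r sublinear_scale[of p r x] by (auto simp: S_def)
          then show "u (r *\<^sub>R x) / r \<le> p x" using r by (simp add: field_simps)
        qed
        then show "u (r *\<^sub>R x) \<le> r * u x" using r by (simp add: field_simps)
      qed
      moreover obtain p where "p \<in> C" using False by blast
      then have "u \<le> q" using le CS by (force simp: le_fun_def S_def intro: order_trans)
      ultimately show ?thesis using le by (intro bexI[of _ u]) (auto simp: S_def le_fun_def)
    qed
  qed
  then obtain m where m: "sublinear m" "m \<le> q" and min: "\<And>a. sublinear a \<Longrightarrow> a \<le> q \<Longrightarrow> a \<le> m \<Longrightarrow> a = m"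
    by (auto simp: S_def)
  have super: "m x + m y \<le> m (x + y)" for x y
  proof -
    define q' where "q' = (\<lambda>x. INF t\<in>{0..}. m (x + t *\<^sub>R y) - t * m y)"
    note d = sublinear_directional[OF m(1), where y = y, folded q'_def]
    have "q' \<le> m" using d(2)[of 0] by (simp add: le_fun_def q'_def)
    then have "q' = m" using min d(1) m(2) order_trans by blast
    then have "m x = q' x" by simp
    also have "\<dots> \<le> m (x + y) - m y" using d(2)[of 1 x] by (simp add: q'_def)
    finally show ?thesis by simp
  qed
  have add: "m (x + y) = m x + m y" for x y
    using super[of x y] m(1) unfolding sublinear_def by (meson antisym)
  have neg: "m (- x) = - m x" for x
    using add[of x "- x"] sublinear_zero[OF m(1)] by simp
  have scale: "m (r *\<^sub>R x) = r *\<^sub>R m x" for r x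
  proof (cases "r \<ge> 0")
    case False
    then have "m (- ((-r) *\<^sub>R x)) = - ((-r) * m x)" using sublinear_scale[OF m(1), of "-r" x] neg by simp
    then show ?thesis by simp
  qed (use sublinear_scale[OF m(1)] in simp)
  show ?thesis
    by (rule that[of m]) (use m(2) add scale in \<open>auto intro: linearI simp: le_fun_def\<close>)
qed

text \<open>The norm modified in the direction \<open>x\<close> is at most - norm x at - x. A linear
  \<open>f\<close> below it thus satisfies f x \<ge> norm x, and it is dominated by the norm. The
  complex functional is f y - \<i> f (\<i> y), with real part \<open>f\<close>.\<close>

lemma separating_functional:
  fixes x :: "'a::complex_banach"
  assumes "x \<noteq> 0"
  obtains F :: "'a \<Rightarrow> complex"
    where "bounded_linear F" "\<And>c y. F (c *\<^sub>C y) = c * F y" "F x \<noteq> 0"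
proof -
  have "sublinear (norm :: 'a \<Rightarrow> real)" by (auto simp: sublinear_def norm_triangle_ineq)
  note d = sublinear_directional[OF this, where y = x]
  obtain f where f: "linear f" "\<And>y. f y \<le> (INF t\<in>{0..}. norm (y + t *\<^sub>R x) - t * norm x)"
    by (rule linear_below_sublinear[OF d(1)]) blast
  have fle: "f y \<le> norm y" for y using f(2)[of y] d(2)[of 0 y] by simp
  have "f (- x) \<le> - norm x" using f(2)[of "- x"] d(2)[of 1 "- x"] by simp
  then have fx: "f x \<noteq> 0" using linear_neg[OF f(1), of x] assms by auto
  have fabs: "\<bar>f y\<bar> \<le> norm y" for y using fle[of y] fle[of "- y"] linear_neg[OF f(1), of y] by simp
  define F where "F y = complex_of_real (f y) - \<i> * complex_of_real (f (\<i> *\<^sub>C y))" for y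
  have bl: "bounded_linear F"
  proof (rule bounded_linear_intro[of _ 2])
    show "F (y + z) = F y + F z" for y z
      by (simp add: F_def scaleC_add_right linear_add[OF f(1)] algebra_simps)
    show "F (r *\<^sub>R y) = r *\<^sub>R F y" for r y
      by (simp add: F_def scaleC.scaleR_right linear_scale[OF f(1)] algebra_simps scaleR_conv_of_real)
    show "norm (F y) \<le> norm y * 2" for y
      using norm_triangle_ineq4[of "complex_of_real (f y)" "\<i> * complex_of_real (f (\<i> *\<^sub>C y))"]
        fabs[of y] fabs[of "\<i> *\<^sub>C y"] by (simp add: F_def norm_mult norm_scaleC)
  qed
  moreover have "F (c *\<^sub>C y) = c * F y" for c y
  proof -
    have I: "F (\<i> *\<^sub>C z) = \<i> * F z" for z
      using linear_neg[OF f(1), of z] scaleC_of_real[of "-1" z] by (simp add: F_def scaleC_scaleC algebra_simps)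
    have R: "F (complex_of_real r *\<^sub>C z) = of_real r * F z" for r z
      using linear_scale[OF bounded_linear.linear[OF bl], of r z]
      by (simp add: scaleC_of_real scaleR_conv_of_real)
    have "c *\<^sub>C y = complex_of_real (Re c) *\<^sub>C y + \<i> *\<^sub>C complex_of_real (Im c) *\<^sub>C y"
      by (simp add: scaleC_scaleC scaleC_add_left[symmetric] complex_eq[symmetric])
    then have "F (c *\<^sub>C y) = (of_real (Re c) + \<i> * of_real (Im c)) * F y"
      by (simp add: linear_add[OF bounded_linear.linear[OF bl]] R I algebra_simps)
    then show ?thesis by (simp add: complex_eq[symmetric])
  qed
  moreover have "F x \<noteq> 0" using fx by (simp add: F_def complex_eq_iff)
  ultimately show ?thesis by (rule that)
qed

lemma eq_by_functionals:
  fixes x y :: "'a::complex_banach"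
  assumes "\<And>F :: 'a \<Rightarrow> complex. bounded_linear F \<Longrightarrow> (\<And>c y. F (c *\<^sub>C y) = c * F y) \<Longrightarrow> F x = F y"
  shows "x = y"
proof (rule ccontr)
  assume "x \<noteq> y"
  then have "x - y \<noteq> 0" by simp
  then obtain F :: "'a \<Rightarrow> complex" where "bounded_linear F" "\<And>c y. F (c *\<^sub>C y) = c * F y" "F (x - y) \<noteq> 0"
    by (rule separating_functional) blast
  then show False using assms by (simp add: linear_diff bounded_linear.linear)
qed

text \<open>Banach--Steinhaus by Baire: a point common to all \<open>U n\<close> would violate the
  pointwise bound, so some \<open>U n\<close> is not dense and misses a ball.\<close>

lemma uniform_boundedness:
  fixes T :: "'i \<Rightarrow> 'a::banach \<Rightarrow> 'b::real_normed_vector"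
  assumes lin: "\<And>i. i \<in> I \<Longrightarrow> bounded_linear (T i)"
    and pw: "\<And>x. \<exists>B. \<forall>i\<in>I. norm (T i x) \<le> B"
  obtains M where "0 \<le> M" "\<And>i x. i \<in> I \<Longrightarrow> norm (T i x) \<le> M * norm x"
proof -
  define U where "U n = (\<Union>i\<in>I. {x. norm (T i x) > real n})" for n :: nat
  have op: "open (U n)" for n
    unfolding U_def
    by (intro open_UN ballI open_Collect_less continuous_intros bounded_linear.continuous_on[OF lin]) auto
  have "\<exists>n. closure (U n) \<noteq> UNIV"
  proof (rule ccontr)
    assume "\<not> ?thesis"
    then have dense: "\<And>n. closure (U n) = UNIV" by blast
    have "Met_TC.mtopology closure_of (\<Inter>(range U)) = UNIV"
      by (rule Met_TC.metric_Baire_category) (auto simp: op dense complete_UNIV)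
    then have "\<Inter>(range U) \<noteq> {}" by auto
    then obtain x where x: "\<And>n. x \<in> U n" by auto
    obtain B where B: "\<forall>i\<in>I. norm (T i x) \<le> B" using pw by blast
    obtain n :: nat where "B < real n" using reals_Archimedean2 by blast
    with x[of n] B show False by (force simp: U_def)
  qed
  then obtain n x0 where "x0 \<notin> closure (U n)" by blast
  then obtain e where e: "e > 0" "\<And>y. dist y x0 < e \<Longrightarrow> y \<notin> U n"
    unfolding closure_approachable by (meson not_le)
  have bound: "norm (T i y) \<le> real n" if "i \<in> I" "dist y x0 < e" for i y
    using e(2)[OF that(2)] that(1) by (auto simp: U_def not_less)
  \<comment> \<open>The constant: a vector of length e/2 is the difference of two points of the
    ball, so its image has norm at most 2n.\<close>
  show ?thesis
  proof (rule that[of "4 * real n / e"])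
    show "0 \<le> 4 * real n / e" using e by simp
    fix i x assume i: "i \<in> I"
    interpret T: bounded_linear "T i" by (rule lin[OF i])
    show "norm (T i x) \<le> 4 * real n / e * norm x"
    proof (cases "x = 0")
      case False
      define y where "y = (e / (2 * norm x)) *\<^sub>R x"
      have "norm y = e / 2" using False e by (simp add: y_def)
      then have "norm (T i (x0 + y)) \<le> real n" "norm (T i x0) \<le> real n"
        using bound[OF i, of "x0 + y"] bound[OF i, of x0] e by (simp_all add: dist_norm)
      then have "norm (T i (x0 + y) - T i x0) \<le> 2 * real n"
        using norm_triangle_ineq4[of "T i (x0 + y)" "T i x0"] by simp
      then have "norm (T i y) \<le> 2 * real n" by (simp add: T.add)
      then have "e / (2 * norm x) * norm (T i x) \<le> 2 * real n" using e by (simp add: y_def T.scaleR)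
      then show ?thesis using False e by (simp add: field_simps)
    qed (simp add: T.zero)
  qed
qed

section \<open>Vector-valued integrals\<close>

text \<open>The error is small only relative to an integrable weight \<open>h\<close>, later the
  modulus of an unbounded kernel. Fine Riemann sums of \<open>h\<close> stay below H + 1, which
  takes the place of the length of the interval in the usual argument for uniform limits.\<close>

lemma integrable_weighted_limit:
  fixes g :: "real \<Rightarrow> 'a::banach" and h :: "real \<Rightarrow> real"
  assumes h: "h integrable_on {p..q}" and h0: "\<And>x. x \<in> {p..q} \<Longrightarrow> 0 \<le> h x"
    and appr: "\<And>e. e > 0 \<Longrightarrow> \<exists>g'. g' integrable_on {p..q} \<and> (\<forall>x\<in>{p..q}. norm (g' x - g x) \<le> e * h x)"
  shows "g integrable_on {p..q}"
proof -
  define e where "e n = 1 / real (Suc n)" for n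
  have e: "e n > 0" for n by (simp add: e_def)
  obtain G where G: "\<And>n. G n integrable_on {p..q}"
    "\<And>n x. x \<in> {p..q} \<Longrightarrow> norm (G n x - g x) \<le> e n * h x"
    using appr[OF e] by metis
  define H where "H = integral {p..q} h"
  have H0: "0 \<le> H" unfolding H_def by (rule integral_nonneg[OF h h0])
  have diff: "norm (integral {p..q} (G m) - integral {p..q} (G n)) \<le> (e m + e n) * H" for m n
  proof -
    have "norm (integral {p..q} (\<lambda>x. G m x - G n x)) \<le> integral {p..q} (\<lambda>x. (e m + e n) * h x)"
    proof (rule integral_norm_bound_integral)
      show "norm (G m x - G n x) \<le> (e m + e n) * h x" if "x \<in> {p..q}" for x
        using norm_triangle_ineq4[of "G m x - g x" "G n x - g x"] G(2)[OF that, of m] G(2)[OF that, of n]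
        by (simp add: algebra_simps)
    qed (auto intro: G Henstock_Kurzweil_Integration.integrable_diff integrable_on_mult_right h)
    then show ?thesis by (simp add: H_def Henstock_Kurzweil_Integration.integral_diff G)
  qed
  have e_lim: "e \<longlonglongrightarrow> 0" unfolding e_def by (rule LIMSEQ_Suc[OF lim_1_over_n])
  have "Cauchy (\<lambda>n. integral {p..q} (G n))"
  proof (rule CauchyI)
    fix \<epsilon> :: real assume "\<epsilon> > 0"
    then have "\<epsilon> / (2 * (H + 1)) > 0" using H0 by simp
    then obtain N where N: "\<And>n. n \<ge> N \<Longrightarrow> e n < \<epsilon> / (2 * (H + 1))"
      using order_tendstoD(2)[OF e_lim] by (auto simp: eventually_sequentially)
    have "norm (integral {p..q} (G m) - integral {p..q} (G n)) < \<epsilon>" if "m \<ge> N" "n \<ge> N" for m n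
    proof -
      have "(e m + e n) * H \<le> (e m + e n) * (H + 1)" using e[of m] e[of n] by simp
      also have "\<dots> < (\<epsilon> / (2 * (H + 1)) + \<epsilon> / (2 * (H + 1))) * (H + 1)"
        using N that H0 by (intro mult_strict_right_mono add_strict_mono) auto
      also have "\<dots> = \<epsilon>"
      proof -
        have "(x / (2 * K) + x / (2 * K)) * K = x" if "K > 0" for x K :: real
          using that by (simp add: field_simps)
        from this[of "H + 1"] show ?thesis using H0 by simp
      qed
      finally show ?thesis using diff[of m n] by linarith
    qed
    then show "\<exists>M. \<forall>m\<ge>M. \<forall>n\<ge>M. norm (integral {p..q} (G m) - integral {p..q} (G n)) < \<epsilon>" by blast
  qed
  then obtain I where I: "(\<lambda>n. integral {p..q} (G n)) \<longlonglongrightarrow> I"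
    using Cauchy_convergent convergent_def by blast
  have "(g has_integral I) {p..q}"
    unfolding has_integral_real
  proof (intro allI impI)
    fix \<epsilon> :: real assume eps: "\<epsilon> > 0"
    then have "\<epsilon> / (3 * (H + 1)) > 0" "\<epsilon> / 3 > 0" using H0 by auto
    then have "eventually (\<lambda>n. e n < \<epsilon> / (3 * (H + 1)) \<and> dist (integral {p..q} (G n)) I < \<epsilon> / 3) sequentially"
      by (intro eventually_conj order_tendstoD(2)[OF e_lim] tendstoD[OF I])
    from eventually_happens'[OF sequentially_bot this]
    obtain n where n: "e n < \<epsilon> / (3 * (H + 1))" "dist (integral {p..q} (G n)) I < \<epsilon> / 3" by blast
    obtain \<gamma>1 where \<gamma>1: "gauge \<gamma>1" "\<And>\<D>. \<D> tagged_division_of {p..q} \<Longrightarrow> \<gamma>1 fine \<D> \<Longrightarrow>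
        norm (sum (\<lambda>(x,k). measure lborel k *\<^sub>R G n x) \<D> - integral {p..q} (G n)) < \<epsilon> / 3"
      using integrable_integral[OF G(1)[of n], unfolded has_integral_real] \<open>\<epsilon> / 3 > 0\<close> by meson
    \<comment> \<open>This gauge serves only to keep the Riemann sums of \<open>h\<close> below H +
      1.\<close>
    obtain \<gamma>2 where \<gamma>2: "gauge \<gamma>2" "\<And>\<D>. \<D> tagged_division_of {p..q} \<Longrightarrow> \<gamma>2 fine \<D> \<Longrightarrow>
        norm (sum (\<lambda>(x,k). measure lborel k *\<^sub>R h x) \<D> - H) < 1"
      using integrable_integral[OF h, unfolded has_integral_real, folded H_def] zero_less_one by meson
    show "\<exists>\<gamma>. gauge \<gamma> \<and> (\<forall>\<D>. \<D> tagged_division_of {p..q} \<and> \<gamma> fine \<D> \<longrightarrow>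
        norm (sum (\<lambda>(x,k). measure lborel k *\<^sub>R g x) \<D> - I) < \<epsilon>)"
    proof (intro exI[of _ "\<lambda>x. \<gamma>1 x \<inter> \<gamma>2 x"] conjI allI impI gauge_Int \<gamma>1(1) \<gamma>2(1))
      fix \<D> assume "\<D> tagged_division_of {p..q} \<and> (\<lambda>x. \<gamma>1 x \<inter> \<gamma>2 x) fine \<D>"
      then have D: "\<D> tagged_division_of {p..q}" "\<gamma>1 fine \<D>" "\<gamma>2 fine \<D>" by (auto simp: fine_Int)
      have tag: "x \<in> {p..q}" if "(x, k) \<in> \<D>" for x k
        using tagged_division_ofD(2,3)[OF D(1) that] by blast
      have "norm (sum (\<lambda>(x,k). measure lborel k *\<^sub>R G n x) \<D> - sum (\<lambda>(x,k). measure lborel k *\<^sub>R g x) \<D>) =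
        norm (sum (\<lambda>(x,k). measure lborel k *\<^sub>R (G n x - g x)) \<D>)"
        by (simp add: sum_subtractf[symmetric] scaleR_diff_right case_prod_beta)
      also have "\<dots> \<le> sum (\<lambda>(x,k). e n * (measure lborel k *\<^sub>R h x)) \<D>"
      proof (rule sum_norm_le, clarify)
        fix x k assume xk: "(x, k) \<in> \<D>"
        show "norm (measure lborel k *\<^sub>R (G n x - g x)) \<le> e n * (measure lborel k *\<^sub>R h x)"
          using mult_left_mono[OF G(2)[OF tag[OF xk]], of "measure lborel k" n] by (simp add: mult.left_commute)
      qed
      also have "\<dots> = e n * sum (\<lambda>(x,k). measure lborel k *\<^sub>R h x) \<D>"
        by (simp add: sum_distrib_left case_prod_beta)
      also have "\<dots> \<le> e n * (H + 1)"
      proof (rule mult_left_mono)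
        have "\<bar>(\<Sum>(x,k)\<in>\<D>. measure lborel k *\<^sub>R h x) - H\<bar> < 1" using \<gamma>2(2)[OF D(1,3)] by (simp only: real_norm_def)
        then show "(\<Sum>(x,k)\<in>\<D>. measure lborel k *\<^sub>R h x) \<le> H + 1" by linarith
      qed (use e[of n] in simp)
      also have "\<dots> < \<epsilon> / 3"
        using n(1) H0 by (simp add: field_simps)
      finally have 1: "norm (sum (\<lambda>(x,k). measure lborel k *\<^sub>R G n x) \<D> - sum (\<lambda>(x,k). measure lborel k *\<^sub>R g x) \<D>) < \<epsilon> / 3" .
      have tri: "norm (X - I) < \<epsilon>" if "norm (Y - X) < \<epsilon> / 3" "norm (Y - J) < \<epsilon> / 3" "norm (J - I) < \<epsilon> / 3"
        for X Y J I :: 'a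
        using norm_triangle_ineq[of "X - Y" "(Y - J) + (J - I)"] norm_triangle_ineq[of "Y - J" "J - I"] that
        by (simp add: norm_minus_commute)
      show "norm (sum (\<lambda>(x,k). measure lborel k *\<^sub>R g x) \<D> - I) < \<epsilon>"
        by (rule tri[OF 1 \<gamma>1(2)[OF D(1,2)]]) (use n(2) in \<open>simp add: dist_norm\<close>)
    qed
  qed
  then show ?thesis by blast
qed

lemma scaleC_const_integrable:
  fixes x :: "'a::complex_banach"
  assumes "a integrable_on S"
  shows "(\<lambda>s. a s *\<^sub>C x) integrable_on S" "integral S (\<lambda>s. a s *\<^sub>C x) = integral S a *\<^sub>C x"
  using integrable_linear[OF assms scaleC.bounded_linear_left[of x]]
    integral_linear[OF assms scaleC.bounded_linear_left[of x]] by (simp_all add: o_def)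

text \<open>\<open>u\<close> is replaced by its values on a grid. This leaves a finite sum of scalar
  integrable functions times fixed vectors, with an error of at most \<epsilon> times the modulus of
  \<open>a\<close>, by uniform continuity.\<close>

lemma scaleC_integrable:
  fixes u :: "real \<Rightarrow> 'a::complex_banach"
  assumes a: "a absolutely_integrable_on {p..q}" and u: "continuous_on {p..q} u"
  shows "(\<lambda>s. a s *\<^sub>C u s) integrable_on {p..q}"
proof (rule integrable_weighted_limit)
  show "(\<lambda>s. norm (a s)) integrable_on {p..q}"
    using a by (auto simp: absolutely_integrable_on_def)
  fix \<epsilon> :: real assume eps: "\<epsilon> > 0"
  have "uniformly_continuous_on {p..q} u" by (rule compact_uniformly_continuous[OF u compact_Icc])
  then obtain d where d: "d > 0" "\<And>x y. x \<in> {p..q} \<Longrightarrow> y \<in> {p..q} \<Longrightarrow> dist y x < d \<Longrightarrow> dist (u y) (u x) < \<epsilon>"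
    using eps unfolding uniformly_continuous_on_def by metis
  define h where "h = d / 2"
  have h: "h > 0" "h < d" using d by (auto simp: h_def)
  define N where "N = nat \<lceil>(q - p) / h\<rceil>"
  define J where "J s = nat \<lfloor>(s - p) / h\<rfloor>" for s
  define c where "c j s = (if J s = j then a s else 0)" for j :: nat and s
  have cI: "(\<lambda>s. c j s) integrable_on {p..q}" for j
  proof -
    have "(\<lambda>s. a s * (if J s = j then 1 else 0)) absolutely_integrable_on {p..q}"
      by (rule absolutely_integrable_mult_bounded[OF a, where M = 1]) (auto simp: J_def)
    then have "(\<lambda>s. a s * (if J s = j then 1 else 0)) integrable_on {p..q}"
      by (rule set_lebesgue_integral_eq_integral)
    moreover have "c j = (\<lambda>s. a s * (if J s = j then 1 else 0))" by (auto simp: c_def)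
    ultimately show ?thesis by simp
  qed
  define g where "g s = (\<Sum>j\<le>N. c j s *\<^sub>C u (min q (p + real j * h)))" for s
  show "\<exists>g'. g' integrable_on {p..q} \<and> (\<forall>x\<in>{p..q}. norm (g' x - a x *\<^sub>C u x) \<le> \<epsilon> * norm (a x))"
  proof (intro exI[of _ g] conjI ballI)
    show "g integrable_on {p..q}"
      unfolding g_def by (intro Henstock_Kurzweil_Integration.integrable_sum scaleC_const_integrable cI) auto
    fix s assume s: "s \<in> {p..q}"
    have "0 \<le> (s - p) / h" using s h by auto
    then have J1: "real (J s) \<le> (s - p) / h" "(s - p) / h < real (J s) + 1" unfolding J_def by linarith+
    have "(s - p) / h \<le> (q - p) / h" using s h by (auto intro: divide_right_mono)
    then have JN: "J s \<le> N" unfolding J_def N_def by (intro nat_mono) linarith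
    have y: "p + real (J s) * h \<le> s" "s < p + real (J s) * h + h"
      using J1 h by (auto simp: field_simps)
    have gs: "g s = a s *\<^sub>C u (p + real (J s) * h)"
    proof -
      have "g s = (\<Sum>j\<le>N. if J s = j then a s *\<^sub>C u (min q (p + real j * h)) else 0)"
        unfolding g_def c_def by (intro sum.cong) (auto simp: scaleC.zero_left)
      moreover have "min q (p + real (J s) * h) = p + real (J s) * h" using y s by simp
      ultimately show ?thesis using JN by simp
    qed
    have "dist (u (p + real (J s) * h)) (u s) < \<epsilon>"
      by (rule d(2)) (use y s h in \<open>auto simp: dist_real_def\<close>)
    then have "norm (a s) * norm (u (p + real (J s) * h) - u s) \<le> norm (a s) * \<epsilon>"
      by (intro mult_left_mono) (auto simp: dist_norm)
    then show "norm (g s - a s *\<^sub>C u s) \<le> \<epsilon> * norm (a s)"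
      by (simp add: gs scaleC.diff_right[symmetric] norm_scaleC mult.commute)
  qed
qed auto

lemma norm_integral_scaleC_le:
  fixes u :: "real \<Rightarrow> 'a::complex_banach"
  assumes a: "a absolutely_integrable_on {p..q}" and u: "continuous_on {p..q} u"
    and B: "\<And>s. s \<in> {p..q} \<Longrightarrow> norm (u s) \<le> B"
  shows "norm (integral {p..q} (\<lambda>s. a s *\<^sub>C u s)) \<le> B * integral {p..q} (\<lambda>s. norm (a s))"
proof -
  have n: "(\<lambda>s. norm (a s)) integrable_on {p..q}"
    using a by (auto simp: absolutely_integrable_on_def)
  have "norm (integral {p..q} (\<lambda>s. a s *\<^sub>C u s)) \<le> integral {p..q} (\<lambda>s. B * norm (a s))"
  proof (rule integral_norm_bound_integral[OF scaleC_integrable[OF a u]])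
    show "(\<lambda>s. B * norm (a s)) integrable_on {p..q}" by (rule integrable_on_mult_right[OF n])
    show "norm (a s *\<^sub>C u s) \<le> B * norm (a s)" if "s \<in> {p..q}" for s
      using mult_left_mono[OF B[OF that], of "norm (a s)"] by (simp add: norm_scaleC mult.commute)
  qed
  then show ?thesis by simp
qed

lemma functional_integral:
  fixes u :: "real \<Rightarrow> 'a::complex_banach"
  assumes "bounded_linear F" "\<And>c y. F (c *\<^sub>C y) = c * F y" "(\<lambda>s. a s *\<^sub>C u s) integrable_on S"
  shows "F (integral S (\<lambda>s. a s *\<^sub>C u s)) = integral S (\<lambda>s. a s * F (u s))"
  using integral_linear[OF assms(3,1)] assms(2) by (simp add: o_def)

text \<open>\<open>A\<close> maps Riemann sums of \<open>f\<close> to Riemann sums of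
  \<open>g\<close>. A division fine for both puts a point of the graph near the pair of integrals,
  and the graph is closed.\<close>

lemma closed_operator_integral:
  fixes f g :: "real \<Rightarrow> 'a::complex_banach"
  assumes A: "closed_operator D A" and f: "f integrable_on {p..q}" and g: "g integrable_on {p..q}"
    and gr: "\<And>s. s \<in> {p..q} \<Longrightarrow> f s \<in> D \<and> A (f s) = g s"
  shows "integral {p..q} f \<in> D" "A (integral {p..q} f) = integral {p..q} g"
proof -
  let ?G = "{(x, A x) | x. x \<in> D}"
  have A0: "A 0 = 0"
    using A unfolding closed_operator_def by (metis add_cancel_right_left)
  have Ar: "r *\<^sub>R x \<in> D \<and> A (r *\<^sub>R x) = r *\<^sub>R A x" if "x \<in> D" for r x
    using A that unfolding closed_operator_def by (metis scaleC_of_real)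
  have As: "sum h T \<in> D \<and> A (sum h T) = sum (\<lambda>i. A (h i)) T" if "finite T" "\<And>i. i \<in> T \<Longrightarrow> h i \<in> D"
    for h and T :: "(real \<times> real set) set"
    using that
  proof (induction T rule: finite_induct)
    case empty
    then show ?case using A A0 by (simp add: closed_operator_def)
  next
    case (insert i T)
    then show ?case using A by (simp add: closed_operator_def)
  qed
  have "(integral {p..q} f, integral {p..q} g) \<in> closure ?G"
    unfolding closure_approachable
  proof (intro allI impI)
    fix \<epsilon> :: real assume "\<epsilon> > 0"
    then have e: "\<epsilon> / 2 > 0" by simp
    obtain \<gamma>1 where \<gamma>1: "gauge \<gamma>1" "\<And>\<D>. \<D> tagged_division_of {p..q} \<Longrightarrow> \<gamma>1 fine \<D> \<Longrightarrow>
        norm (sum (\<lambda>(x,k). measure lborel k *\<^sub>R f x) \<D> - integral {p..q} f) < \<epsilon> / 2"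
      using integrable_integral[OF f, unfolded has_integral_real] e by meson
    obtain \<gamma>2 where \<gamma>2: "gauge \<gamma>2" "\<And>\<D>. \<D> tagged_division_of {p..q} \<Longrightarrow> \<gamma>2 fine \<D> \<Longrightarrow>
        norm (sum (\<lambda>(x,k). measure lborel k *\<^sub>R g x) \<D> - integral {p..q} g) < \<epsilon> / 2"
      using integrable_integral[OF g, unfolded has_integral_real] e by meson
    obtain \<D> where D0: "\<D> tagged_division_of {p..q}" "(\<lambda>x. \<gamma>1 x \<inter> \<gamma>2 x) fine \<D>"
      by (rule fine_division_exists_real[OF gauge_Int[OF \<gamma>1(1) \<gamma>2(1)]]) blast
    then have D: "\<D> tagged_division_of {p..q}" "\<gamma>1 fine \<D>" "\<gamma>2 fine \<D>" by (auto simp: fine_Int)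
    let ?x = "sum (\<lambda>(x,k). measure lborel k *\<^sub>R f x) \<D>" and ?y = "sum (\<lambda>(x,k). measure lborel k *\<^sub>R g x) \<D>"
    have tag: "x \<in> {p..q}" if "(x, k) \<in> \<D>" for x k
      using tagged_division_ofD(2,3)[OF D(1) that] by blast
    have fin: "finite \<D>" by (rule tagged_division_ofD(1)[OF D(1)])
    have "?x \<in> D \<and> A ?x = sum (\<lambda>i. A (case i of (x, k) \<Rightarrow> measure lborel k *\<^sub>R f x)) \<D>"
      by (rule As[OF fin]) (use tag gr Ar in auto)
    moreover have "sum (\<lambda>i. A (case i of (x, k) \<Rightarrow> measure lborel k *\<^sub>R f x)) \<D> = ?y"
      by (rule sum.cong[OF refl]) (use tag gr Ar in auto)
    ultimately have "(?x, ?y) \<in> ?G" by auto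
    moreover have "dist (?x, ?y) (integral {p..q} f, integral {p..q} g) < \<epsilon>"
    proof -
      have "dist (?x, ?y) (integral {p..q} f, integral {p..q} g) \<le>
        dist ?x (integral {p..q} f) + dist ?y (integral {p..q} g)"
        unfolding dist_Pair_Pair by (rule sqrt_sum_squares_le_sum) auto
      then show ?thesis using \<gamma>1(2)[OF D(1,2)] \<gamma>2(2)[OF D(1,3)] by (simp add: dist_norm)
    qed
    ultimately show "\<exists>z\<in>?G. dist z (integral {p..q} f, integral {p..q} g) < \<epsilon>" by blast
  qed
  moreover have "closed ?G" using A by (simp add: closed_operator_def)
  ultimately have "(integral {p..q} f, integral {p..q} g) \<in> ?G" by simp
  then show "integral {p..q} f \<in> D" "A (integral {p..q} f) = integral {p..q} g" by auto
qed

section \<open>Convolution of an integrable kernel with a vector-valued function\<close>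

lemma integrable_on_subinterval_Icc:
  fixes f :: "real \<Rightarrow> 'a::banach"
  shows "f integrable_on {p..q} \<Longrightarrow> p \<le> p' \<Longrightarrow> q' \<le> q \<Longrightarrow> f integrable_on {p'..q'}"
  by (rule integrable_on_subinterval) auto

lemma absolutely_integrable_subinterval_Icc:
  fixes f :: "real \<Rightarrow> complex"
  shows "f absolutely_integrable_on {p..q} \<Longrightarrow> p \<le> p' \<Longrightarrow> q' \<le> q \<Longrightarrow> f absolutely_integrable_on {p'..q'}"
  by (rule absolutely_integrable_on_subinterval) auto

lemma absolutely_integrable_reflect_shift:
  fixes a :: "real \<Rightarrow> complex"
  assumes "a absolutely_integrable_on {t - q..t - p}"
  shows "(\<lambda>s. a (t - s)) absolutely_integrable_on {p..q}"
proof -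
  have *: "(\<lambda>s. f (t - s)) integrable_on {p..q}" if "f integrable_on {t - q..t - p}" for f :: "real \<Rightarrow> 'b::real_normed_vector"
  proof -
    have "(\<lambda>s. f (s + t)) integrable_on {-q..-p}"
      using integrable_shift_real_ivl[OF that, of t] by simp
    then show ?thesis
      using Henstock_Kurzweil_Integration.integrable_reflect_real[of "\<lambda>s. f (s + t)" "- p" "- q"]
      by (simp add: add.commute)
  qed
  show ?thesis
    using assms *[of a] *[of "\<lambda>s. norm (a s)"] by (simp add: absolutely_integrable_on_def)
qed

text \<open>Convolution with a function on \<open>[0, L]\<close> is continuous because it is the convolution with
  the uniformly continuous function \<open>u(max 0 (min s L))\<close>, up to two explicit boundary terms.\<close>

lemma conv_vector_continuous:
  fixes u :: "real \<Rightarrow> 'a::complex_banach"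
  assumes a: "a absolutely_integrable_on {0..T}" and u: "continuous_on {0..L} u" and L: "0 \<le> L"
  shows "\<And>t. t \<in> {0..T} \<Longrightarrow> (\<lambda>s. a (t - s) *\<^sub>C u s) integrable_on {0..min t L}"
    and "continuous_on {0..T} (\<lambda>t. integral {0..min t L} (\<lambda>s. a (t - s) *\<^sub>C u s))"
proof -
  show int: "(\<lambda>s. a (t - s) *\<^sub>C u s) integrable_on {0..min t L}" if "t \<in> {0..T}" for t
    by (intro scaleC_integrable absolutely_integrable_reflect_shift
        absolutely_integrable_subinterval_Icc[OF a] continuous_on_subset[OF u]) (use that in auto)
  define w where "w s = u (max 0 (min s L))" for s
  have wc: "continuous_on A w" for A
    unfolding w_def by (intro continuous_on_compose2[OF u] continuous_intros) (use L in auto)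
  have wu: "uniformly_continuous_on UNIV w"
    unfolding uniformly_continuous_on_def
  proof (intro allI impI)
    fix e :: real assume "e > 0"
    moreover have "uniformly_continuous_on {0..L} u" by (rule compact_uniformly_continuous[OF u compact_Icc])
    ultimately obtain d where d: "d > 0" "\<And>x y. x \<in> {0..L} \<Longrightarrow> y \<in> {0..L} \<Longrightarrow> dist y x < d \<Longrightarrow> dist (u y) (u x) < e"
      unfolding uniformly_continuous_on_def by metis
    show "\<exists>d>0. \<forall>x\<in>UNIV. \<forall>x'\<in>UNIV. dist x' x < d \<longrightarrow> dist (w x') (w x) < e"
      by (rule exI[of _ d]) (use d L in \<open>auto simp: w_def dist_real_def intro!: d(2)\<close>)
  qed
  define N where "N = integral {0..T} (\<lambda>v. norm (a v))"
  have N0: "0 \<le> N" unfolding N_def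
    by (rule integral_nonneg) (use a in \<open>auto simp: absolutely_integrable_on_def\<close>)
  have main: "continuous_on UNIV (\<lambda>t. integral {0..T} (\<lambda>v. a v *\<^sub>C w (t - v)))"
    unfolding continuous_on_iff
  proof (intro ballI allI impI)
    fix t e :: real assume e: "e > 0"
    then have "e / (N + 1) > 0" using N0 by simp
    then obtain d where d: "d > 0" "\<And>x y. dist y x < d \<Longrightarrow> dist (w y) (w x) < e / (N + 1)"
      using wu unfolding uniformly_continuous_on_def by (meson UNIV_I)
    show "\<exists>d>0. \<forall>t'\<in>UNIV. dist t' t < d \<longrightarrow>
      dist (integral {0..T} (\<lambda>v. a v *\<^sub>C w (t' - v))) (integral {0..T} (\<lambda>v. a v *\<^sub>C w (t - v))) < e"
    proof (intro exI[of _ d] conjI d(1) ballI impI)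
      fix t' assume t': "dist t' t < d"
      have i: "(\<lambda>v. a v *\<^sub>C w (t - v)) integrable_on {0..T}" for t
        by (intro scaleC_integrable a continuous_on_compose2[OF wc[of UNIV]] continuous_intros) auto
      have "norm (integral {0..T} (\<lambda>v. a v *\<^sub>C (w (t' - v) - w (t - v)))) \<le> e / (N + 1) * N"
      proof -
        have c: "continuous_on {0..T} (\<lambda>v. w (t' - v) - w (t - v))"
          by (intro continuous_on_diff continuous_on_compose2[OF wc[of UNIV]] continuous_intros) auto
        have "norm (w (t' - v) - w (t - v)) \<le> e / (N + 1)" for v
          using d(2)[of "t' - v" "t - v"] t' by (simp add: dist_norm)
        from norm_integral_scaleC_le[OF a c this] show ?thesis by (simp only: N_def)
      qed
      also have "\<dots> < e" using e N0 by (simp add: field_simps)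
      finally show "dist (integral {0..T} (\<lambda>v. a v *\<^sub>C w (t' - v))) (integral {0..T} (\<lambda>v. a v *\<^sub>C w (t - v))) < e"
        using i by (simp add: dist_norm scaleC.diff_right Henstock_Kurzweil_Integration.integral_diff)
    qed
  qed
  have ai: "a integrable_on {0..T}" using a by (auto simp: absolutely_integrable_on_def)
  have ac: "continuous_on {0..T} (\<lambda>t. integral {0..t} a)" by (rule indefinite_integral_continuous_1[OF ai])
  \<comment> \<open>With v = t - s, the constant extension \<open>w\<close> equals
    \<open>u L\<close> for v below t - min t L and \<open>u 0\<close> for v above t. These two
    ranges produce the terms subtracted.\<close>
  have eq: "integral {0..min t L} (\<lambda>s. a (t - s) *\<^sub>C u s) =
      integral {0..T} (\<lambda>v. a v *\<^sub>C w (t - v)) - integral {0..t - min t L} a *\<^sub>C u L -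
      (integral {0..T} a - integral {0..t} a) *\<^sub>C u 0" if t: "t \<in> {0..T}" for t
  proof -
    have i: "(\<lambda>v. a v *\<^sub>C w (t - v)) integrable_on {0..T}"
      by (intro scaleC_integrable a continuous_on_compose2[OF wc[of UNIV]] continuous_intros) auto
    let ?r = "t - min t L"
    have r: "0 \<le> ?r" "?r \<le> t" using t L by auto
    have "integral {0..T} (\<lambda>v. a v *\<^sub>C w (t - v)) =
      integral {0..?r} (\<lambda>v. a v *\<^sub>C w (t - v)) + integral {?r..t} (\<lambda>v. a v *\<^sub>C w (t - v)) + integral {t..T} (\<lambda>v. a v *\<^sub>C w (t - v))"
      using Henstock_Kurzweil_Integration.integral_combine[OF _ _ i, of t]
        Henstock_Kurzweil_Integration.integral_combine[OF r integrable_on_subinterval_Icc[OF i]] t by simp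
    moreover have "integral {0..?r} (\<lambda>v. a v *\<^sub>C w (t - v)) = integral {0..?r} a *\<^sub>C u L"
    proof (cases "t \<le> L")
      case True then show ?thesis by (simp add: min_def scaleC.zero_left)
    next
      case False
      have "integral {0..?r} (\<lambda>v. a v *\<^sub>C w (t - v)) = integral {0..?r} (\<lambda>v. a v *\<^sub>C u L)"
      proof (rule integral_cong)
        fix v assume "v \<in> {0..?r}"
        then have "max 0 (min (t - v) L) = L" using False L by auto
        then show "a v *\<^sub>C w (t - v) = a v *\<^sub>C u L" by (simp add: w_def)
      qed
      also have "\<dots> = integral {0..?r} a *\<^sub>C u L"
        by (rule scaleC_const_integrable(2)[OF integrable_on_subinterval_Icc[OF ai]]) (use r t in auto)
      finally show ?thesis .
    qed
    moreover have "integral {t..T} (\<lambda>v. a v *\<^sub>C w (t - v)) = (integral {0..T} a - integral {0..t} a) *\<^sub>C u 0"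
    proof -
      have "integral {t..T} (\<lambda>v. a v *\<^sub>C w (t - v)) = integral {t..T} (\<lambda>v. a v *\<^sub>C u 0)"
        by (intro integral_cong) (use L in \<open>auto simp: w_def min_def max_def\<close>)
      also have "\<dots> = integral {t..T} a *\<^sub>C u 0"
        by (rule scaleC_const_integrable(2)[OF integrable_on_subinterval_Icc[OF ai]]) (use t in auto)
      also have "integral {t..T} a = integral {0..T} a - integral {0..t} a"
        using Henstock_Kurzweil_Integration.integral_combine[OF _ _ ai, of t] t by (auto simp: algebra_simps)
      finally show ?thesis .
    qed
    moreover have "integral {?r..t} (\<lambda>v. a v *\<^sub>C w (t - v)) = integral {0..min t L} (\<lambda>s. a (t - s) *\<^sub>C u s)"
    proof -
      have "integral {0..min t L} (\<lambda>s. a (t - s) *\<^sub>C u s) = integral {0..min t L} (\<lambda>s. a (t - s) *\<^sub>C w (t - (t - s)))"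
      proof (rule integral_cong)
        fix s assume "s \<in> {0..min t L}"
        then have "max 0 (min s L) = s" by auto
        then show "a (t - s) *\<^sub>C u s = a (t - s) *\<^sub>C w (t - (t - s))" by (simp add: w_def)
      qed
      also have "\<dots> = integral {t - min t L..t - 0} (\<lambda>v. a v *\<^sub>C w (t - v))"
        by (rule integral_reflect_shift)
      finally show ?thesis by simp
    qed
    ultimately show ?thesis by (simp add: algebra_simps)
  qed
  have "continuous_on {0..T} (\<lambda>t. integral {0..T} (\<lambda>v. a v *\<^sub>C w (t - v)) - integral {0..t - min t L} a *\<^sub>C u L -
      (integral {0..T} a - integral {0..t} a) *\<^sub>C u 0)"
    by (intro continuous_on_diff continuous_on_scaleC continuous_on_const continuous_on_subset[OF main] ac
        continuous_on_compose2[OF ac] continuous_intros) (use L in auto)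
  then show "continuous_on {0..T} (\<lambda>t. integral {0..min t L} (\<lambda>s. a (t - s) *\<^sub>C u s))"
    by (rule continuous_on_eq) (simp add: eq)
qed

section \<open>Test functions\<close>

text \<open>A quadratic remainder survives integration against a kernel and the estimates for
  \<open>G\<close>, so derivatives of such expressions are obtained in this form.\<close>

lemma has_vector_derivative_quadratic:
  fixes f :: "real \<Rightarrow> 'a::real_normed_vector"
  assumes "\<And>y. y \<in> S \<Longrightarrow> norm (f y - f x - (y - x) *\<^sub>R v) \<le> C * (y - x)\<^sup>2"
  shows "(f has_vector_derivative v) (at x within S)"
  unfolding has_vector_derivative_def has_derivative_within_alt
proof (intro conjI allI impI)
  fix e :: real assume e: "e > 0"
  show "\<exists>d>0. \<forall>y\<in>S. norm (y - x) < d \<longrightarrow> norm (f y - f x - (y - x) *\<^sub>R v) \<le> e * norm (y - x)"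
  proof (intro exI[of _ "e / (\<bar>C\<bar> + 1)"] conjI ballI impI)
    fix y assume y: "y \<in> S" "norm (y - x) < e / (\<bar>C\<bar> + 1)"
    have "norm (f y - f x - (y - x) *\<^sub>R v) \<le> \<bar>C\<bar> * (y - x)\<^sup>2"
      using assms[OF y(1)] mult_right_mono[OF abs_ge_self[of C] zero_le_power2[of "y - x"]] by linarith
    also have "\<dots> = (\<bar>C\<bar> * \<bar>y - x\<bar>) * \<bar>y - x\<bar>" by (simp add: power2_abs[of "y - x", symmetric] power2_eq_square)
    also have "\<dots> \<le> e * \<bar>y - x\<bar>"
    proof (rule mult_right_mono)
      have "\<bar>C\<bar> * \<bar>y - x\<bar> \<le> (\<bar>C\<bar> + 1) * (e / (\<bar>C\<bar> + 1))"
        using y(2) by (intro mult_mono) auto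
      then show "\<bar>C\<bar> * \<bar>y - x\<bar> \<le> e" by simp
    qed auto
    finally show "norm (f y - f x - (y - x) *\<^sub>R v) \<le> e * norm (y - x)" by simp
  qed (use e in auto)
qed (rule bounded_linear_scaleR_left)

text \<open>The mean value inequality is used twice, hence the constant B instead of B/2.\<close>

lemma taylor_first_order_bound:
  fixes f :: "real \<Rightarrow> 'a::real_normed_vector"
  assumes f: "\<And>t. (f has_vector_derivative f' t) (at t)"
    and f': "\<And>t. (f' has_vector_derivative f'' t) (at t)" and B: "\<And>t. norm (f'' t) \<le> B"
  shows "norm (f y - f x - (y - x) *\<^sub>R f' x) \<le> B * (y - x)\<^sup>2"
proof -
  have lip: "norm (f' s - f' x) \<le> B * norm (s - x)" for s
    by (rule differentiable_bound[where S = UNIV and f' = "\<lambda>t h. h *\<^sub>R f'' t"])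
      (use f' B in \<open>auto simp: has_vector_derivative_def onorm_scaleR_left onorm_id\<close>)
  define S where "S = closed_segment x y"
  have B0: "0 \<le> B" using B[of 0] norm_ge_zero order_trans by blast
  have "norm ((f y - (y - x) *\<^sub>R f' x) - (f x - (x - x) *\<^sub>R f' x)) \<le> (B * norm (y - x)) * norm (y - x)"
  proof (rule differentiable_bound[where S = S and f' = "\<lambda>s h. h *\<^sub>R (f' s - f' x)"])
    show "convex S" "x \<in> S" "y \<in> S" by (auto simp: S_def)
    fix s assume s: "s \<in> S"
    have "((\<lambda>s. f s - (s - x) *\<^sub>R f' x) has_vector_derivative f' s - f' x) (at s)"
      using f[of s] by (auto intro!: derivative_eq_intros)
    then show "((\<lambda>s. f s - (s - x) *\<^sub>R f' x) has_derivative (\<lambda>h. h *\<^sub>R (f' s - f' x))) (at s within S)"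
      unfolding has_vector_derivative_def by (rule has_derivative_at_withinI)
    have "norm (s - x) \<le> norm (y - x)"
      using s unfolding S_def by (rule segment_bound1)
    then have "norm (f' s - f' x) \<le> B * norm (y - x)"
      using lip[of s] B0 by (meson mult_left_mono order_trans)
    then show "onorm (\<lambda>h. h *\<^sub>R (f' s - f' x)) \<le> B * norm (y - x)"
      by (simp add: onorm_scaleR_left onorm_id)
  qed
  then show ?thesis by (simp add: power2_eq_square algebra_simps abs_mult[symmetric])
qed

text \<open>Test functions are handled through an extension to the whole line, where derivatives at
  0 are two-sided and translation in both directions makes sense.\<close>

definition restr :: "(real \<Rightarrow> complex) \<Rightarrow> real \<Rightarrow> complex" where
  "restr \<Phi> t = (if t \<ge> 0 then \<Phi> t else 0)"

definition supported_in :: "real \<Rightarrow> (real \<Rightarrow> complex) \<Rightarrow> bool" where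
  "supported_in R \<Phi> \<longleftrightarrow> 0 < R \<and> (\<forall>t. R \<le> \<bar>t\<bar> \<longrightarrow> \<Phi> t = 0)"

lemma supported_in_mono: "supported_in R \<Phi> \<Longrightarrow> R \<le> R' \<Longrightarrow> supported_in R' \<Phi>"
  by (auto simp: supported_in_def)

lemma compact_supp_iff: "compact (supp \<Phi>) \<longleftrightarrow> (\<exists>R. supported_in R \<Phi>)"
proof
  assume "compact (supp \<Phi>)"
  then obtain R where R: "R > 0" "\<forall>x\<in>supp \<Phi>. norm x \<le> R"
    using compact_imp_bounded bounded_pos by blast
  have "\<Phi> t = 0" if "R + 1 \<le> \<bar>t\<bar>" for t
  proof (rule ccontr)
    assume "\<Phi> t \<noteq> 0"
    then have "t \<in> supp \<Phi>" using closure_subset by (force simp: supp_def)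
    with R that show False by force
  qed
  with R show "\<exists>R. supported_in R \<Phi>" by (intro exI[of _ "R + 1"]) (auto simp: supported_in_def)
next
  assume "\<exists>R. supported_in R \<Phi>"
  then obtain R where R: "supported_in R \<Phi>" ..
  have "{t. \<Phi> t \<noteq> 0} \<subseteq> {-R..R}"
    using R by (auto simp: supported_in_def) (smt (verit))+
  then have "supp \<Phi> \<subseteq> {-R..R}" unfolding supp_def by (rule closure_minimal) simp
  then show "compact (supp \<Phi>)"
    by (metis bounded_closed_interval bounded_subset closed_closure compact_eq_bounded_closed supp_def)
qed

lemma Dplus_eq: "Dplus = {restr \<Phi> | \<Phi> R. smooth \<Phi> \<and> supported_in R \<Phi>}"
  unfolding Dplus_def compact_supp_iff restr_def by (auto simp: fun_eq_iff)

lemma DplusI: "smooth \<Phi> \<Longrightarrow> supported_in R \<Phi> \<Longrightarrow> restr \<Phi> \<in> Dplus"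
  by (auto simp: Dplus_eq)

lemma DplusE:
  assumes "\<phi> \<in> Dplus"
  obtains \<Phi> R where "\<phi> = restr \<Phi>" "smooth \<Phi>" "supported_in R \<Phi>"
  using assms by (auto simp: Dplus_eq)

lemma smoothE:
  assumes "smooth \<Phi>"
  obtains \<Phi>' where "smooth \<Phi>'" "\<And>t. (\<Phi> has_vector_derivative \<Phi>' t) (at t)"
proof -
  obtain d where d: "d 0 = \<Phi>" "\<And>n t. (d n has_vector_derivative d (Suc n) t) (at t)"
    using assms by (auto simp: smooth_def)
  have "smooth (d 1)" unfolding smooth_def by (rule exI[of _ "\<lambda>n. d (Suc n)"]) (use d in auto)
  then show ?thesis using that[of "d 1"] d(2)[of 0] d(1) by simp
qed

lemma smooth_continuous: "smooth \<Phi> \<Longrightarrow> continuous_on A \<Phi>"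
  by (metis smoothE continuous_at_imp_continuous_on has_vector_derivative_continuous)

lemma smooth_add: "smooth \<Phi> \<Longrightarrow> smooth \<Gamma> \<Longrightarrow> smooth (\<lambda>t. \<Phi> t + \<Gamma> t)"
proof -
  assume "smooth \<Phi>" "smooth \<Gamma>"
  then obtain d e where "d 0 = \<Phi>" "\<And>n t. (d n has_vector_derivative d (Suc n) t) (at t)"
    "e 0 = \<Gamma>" "\<And>n t. (e n has_vector_derivative e (Suc n) t) (at t)" by (auto simp: smooth_def)
  then show ?thesis unfolding smooth_def
    by (intro exI[of _ "\<lambda>n t. d n t + e n t"]) (auto intro!: derivative_intros)
qed

lemma smooth_cmult: "smooth \<Phi> \<Longrightarrow> smooth (\<lambda>t. c * \<Phi> t)"
proof -
  assume "smooth \<Phi>"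
  then obtain d where "d 0 = \<Phi>" "\<And>n t. (d n has_vector_derivative d (Suc n) t) (at t)"
    by (auto simp: smooth_def)
  then show ?thesis unfolding smooth_def
    by (intro exI[of _ "\<lambda>n t. c * d n t"]) (auto intro!: derivative_intros)
qed

lemma smooth_shift: "smooth \<Phi> \<Longrightarrow> smooth (\<lambda>t. \<Phi> (t + s))"
proof -
  assume "smooth \<Phi>"
  then obtain d where d: "d 0 = \<Phi>" "\<And>n t. (d n has_vector_derivative d (Suc n) t) (at t)"
    by (auto simp: smooth_def)
  have "((\<lambda>t. d n (t + s)) has_vector_derivative d (Suc n) (t + s)) (at t)" for n t
  proof -
    have "((\<lambda>t. t + s) has_vector_derivative 1) (at t)" by (auto intro!: derivative_eq_intros)
    from vector_diff_chain_at[OF this d(2)] show ?thesis by (simp add: o_def)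
  qed
  with d show ?thesis unfolding smooth_def
    by (intro exI[of _ "\<lambda>n t. d n (t + s)"]) auto
qed

text \<open>The extra 1 puts \<open>t\<close> inside an open set on which the function is
  identically 0.\<close>

lemma supported_in_deriv:
  assumes "supported_in R \<Phi>" "\<And>t. (\<Phi> has_vector_derivative \<Phi>' t) (at t)"
  shows "supported_in (R + 1) \<Phi>'"
  unfolding supported_in_def
proof (intro conjI allI impI)
  show "0 < R + 1" using assms by (simp add: supported_in_def)
  fix t assume t: "R + 1 \<le> \<bar>t\<bar>"
  have "((\<lambda>_. 0) has_vector_derivative \<Phi>' t) (at t)"
  proof (rule has_vector_derivative_transform_within_open[OF assms(2)])
    show "open {x. R < \<bar>x\<bar>}" by (intro open_Collect_less continuous_intros)
  qed (use t assms(1) in \<open>auto simp: supported_in_def\<close>)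
  then show "\<Phi>' t = 0"
    using vector_derivative_unique_at[OF _ has_vector_derivative_const] by blast
qed

lemma supported_in_bound:
  assumes "supported_in R \<Phi>" "continuous_on UNIV \<Phi>"
  obtains B where "0 \<le> B" "\<And>t. norm (\<Phi> t) \<le> B"
proof -
  obtain B where B: "0 \<le> B" "\<And>t. t \<in> {-R..R} \<Longrightarrow> norm (\<Phi> t) \<le> B"
    by (rule continuous_on_Icc_bound[OF continuous_on_subset[OF assms(2)]]) auto
  have "norm (\<Phi> t) \<le> B" for t
  proof (cases "R \<le> \<bar>t\<bar>")
    case False
    then show ?thesis by (intro B(2)) auto
  qed (use B assms(1) in \<open>auto simp: supported_in_def\<close>)
  then show ?thesis using B(1) that by blast
qed

lemma absolutely_integrable_mult_continuous:
  fixes a c :: "real \<Rightarrow> complex"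
  assumes a: "a absolutely_integrable_on {p..q}" and c: "continuous_on {p..q} c"
  shows "(\<lambda>u. a u * c u) absolutely_integrable_on {p..q}"
proof (cases "p \<le> q")
  case True
  define d where "d u = c (max p (min q u))" for u
  have "continuous_on UNIV d"
    unfolding d_def by (intro continuous_on_compose2[OF c] continuous_intros) (use True in auto)
  then have dm: "d \<in> borel_measurable borel" by (rule borel_measurable_continuous_onI)
  obtain B where B: "\<And>u. u \<in> {p..q} \<Longrightarrow> norm (c u) \<le> B" by (rule continuous_on_Icc_bound[OF c]) blast
  have dc: "d u = c u" if "u \<in> {p..q}" for u
  proof -
    have "max p (min q u) = u" using that by auto
    then show ?thesis by (simp add: d_def)
  qed
  have "(\<lambda>u. a u * d u) absolutely_integrable_on {p..q}"
    by (rule absolutely_integrable_mult_bounded[OF a dm, of B]) (simp add: dc B)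
  then show ?thesis by (rule absolutely_integrable_spike[OF _ negligible_empty]) (simp add: dc)
qed auto

text \<open>The integrated Taylor remainder is at most the L1 norm of \<open>a\<close> times B (y -
  t)^2, so \<open>a\<close> need only be integrable for differentiation under the integral.\<close>

lemma translation_average_derivative:
  fixes \<Phi> a :: "real \<Rightarrow> complex"
  assumes a: "a absolutely_integrable_on {p..q}"
    and \<Phi>: "\<And>t. (\<Phi> has_vector_derivative \<Phi>' t) (at t)"
    and \<Phi>': "\<And>t. (\<Phi>' has_vector_derivative \<Phi>'' t) (at t)" and B: "\<And>t. norm (\<Phi>'' t) \<le> B"
  shows "((\<lambda>t. integral {p..q} (\<lambda>u. a u * \<Phi> (t + u))) has_vector_derivative
    integral {p..q} (\<lambda>u. a u * \<Phi>' (t + u))) (at t within S)"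
proof (rule has_vector_derivative_quadratic)
  fix y assume "y \<in> S"
  have c: "continuous_on UNIV \<Phi>" "continuous_on UNIV \<Phi>'"
    using \<Phi> \<Phi>' by (metis continuous_at_imp_continuous_on has_vector_derivative_continuous)+
  have i: "(\<lambda>u. a u * f (t + u)) integrable_on {p..q}" if "continuous_on UNIV f" for f t
    by (intro set_lebesgue_integral_eq_integral(1) absolutely_integrable_mult_continuous[OF a]
        continuous_on_compose2[OF that] continuous_intros) auto
  have "norm (integral {p..q} (\<lambda>u. a u * \<Phi> (y + u)) - integral {p..q} (\<lambda>u. a u * \<Phi> (t + u)) -
      (y - t) *\<^sub>R integral {p..q} (\<lambda>u. a u * \<Phi>' (t + u))) =
    norm (integral {p..q} (\<lambda>u. a u * \<Phi> (y + u) - a u * \<Phi> (t + u) - (y - t) *\<^sub>R (a u * \<Phi>' (t + u))))"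
    by (simp add: Henstock_Kurzweil_Integration.integral_diff Henstock_Kurzweil_Integration.integrable_diff
        i c integrable_cmul)
  also have "\<dots> \<le> integral {p..q} (\<lambda>u. norm (a u) * (B * (y - t)\<^sup>2))"
  proof (rule integral_norm_bound_integral)
    show "(\<lambda>u. norm (a u) * (B * (y - t)\<^sup>2)) integrable_on {p..q}"
      using a by (intro integrable_on_mult_left) (auto simp: absolutely_integrable_on_def)
    fix u
    have "norm (a u * \<Phi> (y + u) - a u * \<Phi> (t + u) - (y - t) *\<^sub>R (a u * \<Phi>' (t + u))) =
      norm (a u) * norm (\<Phi> (y + u) - \<Phi> (t + u) - ((y + u) - (t + u)) *\<^sub>R \<Phi>' (t + u))"
      by (simp add: norm_mult[symmetric] algebra_simps)
    also have "\<dots> \<le> norm (a u) * (B * ((y + u) - (t + u))\<^sup>2)"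
      by (intro mult_left_mono taylor_first_order_bound[OF \<Phi> \<Phi>' B]) auto
    finally show "norm (a u * \<Phi> (y + u) - a u * \<Phi> (t + u) - (y - t) *\<^sub>R (a u * \<Phi>' (t + u))) \<le>
      norm (a u) * (B * (y - t)\<^sup>2)" by simp
  qed (auto intro!: Henstock_Kurzweil_Integration.integrable_diff i c integrable_cmul)
  also have "\<dots> = integral {p..q} (\<lambda>u. norm (a u)) * B * (y - t)\<^sup>2" by simp
  finally show "norm (integral {p..q} (\<lambda>u. a u * \<Phi> (y + u)) - integral {p..q} (\<lambda>u. a u * \<Phi> (t + u)) -
      (y - t) *\<^sub>R integral {p..q} (\<lambda>u. a u * \<Phi>' (t + u))) \<le> integral {p..q} (\<lambda>u. norm (a u)) * B * (y - t)\<^sup>2" .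
qed

text \<open>With \<open>a\<close> supported on a compact interval, the average has compact support on all of the line;
  so kernels are truncated before they act on an extension of a test function.\<close>

lemma translation_average_smooth:
  assumes a: "a absolutely_integrable_on {p..q}" and \<Phi>: "smooth \<Phi>" "supported_in R \<Phi>"
  shows "smooth (\<lambda>t. integral {p..q} (\<lambda>u. a u * \<Phi> (t + u)))"
    and "supported_in (R + \<bar>p\<bar> + \<bar>q\<bar>) (\<lambda>t. integral {p..q} (\<lambda>u. a u * \<Phi> (t + u)))"
proof -
  obtain d where d: "d 0 = \<Phi>" "\<And>n t. (d n has_vector_derivative d (Suc n) t) (at t)"
    using \<Phi>(1) by (auto simp: smooth_def)
  have "\<exists>R. supported_in R (d n)" for n
    by (induction n) (use \<Phi>(2) d supported_in_deriv in blast)+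
  then have bd: "\<exists>B. \<forall>t. norm (d n t) \<le> B" for n
    by (metis supported_in_bound d(2) continuous_at_imp_continuous_on has_vector_derivative_continuous)
  show "smooth (\<lambda>t. integral {p..q} (\<lambda>u. a u * \<Phi> (t + u)))"
    unfolding smooth_def
  proof (intro exI[of _ "\<lambda>n t. integral {p..q} (\<lambda>u. a u * d n (t + u))"] conjI allI)
    fix n t
    obtain B where "\<forall>t. norm (d (Suc (Suc n)) t) \<le> B" using bd by blast
    then show "((\<lambda>t. integral {p..q} (\<lambda>u. a u * d n (t + u))) has_vector_derivative
        integral {p..q} (\<lambda>u. a u * d (Suc n) (t + u))) (at t)"
      by (intro translation_average_derivative[OF a d(2) d(2)]) auto
  qed (simp add: d)
  show "supported_in (R + \<bar>p\<bar> + \<bar>q\<bar>) (\<lambda>t. integral {p..q} (\<lambda>u. a u * \<Phi> (t + u)))"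
    unfolding supported_in_def
  proof (intro conjI allI impI)
    show "0 < R + \<bar>p\<bar> + \<bar>q\<bar>"
      using \<Phi>(2) abs_ge_zero[of p] abs_ge_zero[of q] unfolding supported_in_def by linarith
    fix t assume t: "R + \<bar>p\<bar> + \<bar>q\<bar> \<le> \<bar>t\<bar>"
    have "a u * \<Phi> (t + u) = 0" if "u \<in> {p..q}" for u
    proof -
      have "R \<le> \<bar>t + u\<bar>" using t that by auto
      then show ?thesis using \<Phi>(2) by (simp add: supported_in_def)
    qed
    then show "integral {p..q} (\<lambda>u. a u * \<Phi> (t + u)) = 0"
      by (subst integral_cong[of _ _ "\<lambda>_. 0"]) auto
  qed
qed

lemma translation_average_deriv:
  assumes a: "a absolutely_integrable_on {p..q}" and \<Phi>: "smooth \<Phi>" "supported_in R \<Phi>"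
    and \<Phi>': "smooth \<Phi>'" "\<And>t. (\<Phi> has_vector_derivative \<Phi>' t) (at t)"
  shows "((\<lambda>t. integral {p..q} (\<lambda>u. a u * \<Phi> (t + u))) has_vector_derivative
    integral {p..q} (\<lambda>u. a u * \<Phi>' (t + u))) (at t within S)"
proof -
  obtain \<Phi>'' where d: "smooth \<Phi>''" "\<And>t. (\<Phi>' has_vector_derivative \<Phi>'' t) (at t)" by (rule smoothE[OF \<Phi>'(1)]) blast
  have "supported_in (R + 1 + 1) \<Phi>''"
    by (rule supported_in_deriv[OF supported_in_deriv[OF \<Phi>(2) \<Phi>'(2)] d(2)])
  then obtain B where "\<And>t. norm (\<Phi>'' t) \<le> B" using supported_in_bound smooth_continuous[OF d(1)] by metis
  then show ?thesis by (intro translation_average_derivative[OF a \<Phi>'(2) d(2)])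
qed

subsection \<open>Operations on test functions\<close>

lemma restr_add: "restr (\<lambda>t. \<Phi> t + \<Gamma> t) = (\<lambda>t. restr \<Phi> t + restr \<Gamma> t)"
  by (auto simp: restr_def)

lemma Dplus_add: "\<phi> \<in> Dplus \<Longrightarrow> \<psi> \<in> Dplus \<Longrightarrow> (\<lambda>t. \<phi> t + \<psi> t) \<in> Dplus"
proof (elim DplusE)
  fix \<Phi> R \<Psi> R' assume *: "\<phi> = restr \<Phi>" "smooth \<Phi>" "supported_in R \<Phi>" "\<psi> = restr \<Psi>" "smooth \<Psi>" "supported_in R' \<Psi>"
  have "restr (\<lambda>t. \<Phi> t + \<Psi> t) \<in> Dplus"
    by (rule DplusI[of _ "max R R'"]) (use * smooth_add in \<open>auto simp: supported_in_def\<close>)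
  then show ?thesis using * by (simp add: restr_add)
qed

lemma Dplus_cmult: "\<phi> \<in> Dplus \<Longrightarrow> (\<lambda>t. c * \<phi> t) \<in> Dplus"
proof (elim DplusE)
  fix \<Phi> R assume *: "\<phi> = restr \<Phi>" "smooth \<Phi>" "supported_in R \<Phi>"
  have "restr (\<lambda>t. c * \<Phi> t) \<in> Dplus"
    by (rule DplusI[of _ R]) (use * smooth_cmult in \<open>auto simp: supported_in_def\<close>)
  moreover have "restr (\<lambda>t. c * \<Phi> t) = (\<lambda>t. c * \<phi> t)" using * by (auto simp: restr_def)
  ultimately show ?thesis by simp
qed

lemma Dplus_diff: "\<phi> \<in> Dplus \<Longrightarrow> \<psi> \<in> Dplus \<Longrightarrow> (\<lambda>t. \<phi> t - \<psi> t) \<in> Dplus"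
  using Dplus_add[of \<phi> "\<lambda>t. (-1) * \<psi> t"] Dplus_cmult[of \<psi> "-1"] by simp

lemma Dplus_neg: "\<phi> \<in> Dplus \<Longrightarrow> t < 0 \<Longrightarrow> \<phi> t = 0"
  by (auto simp: Dplus_def)

lemma Dplus_vanishes:
  assumes "\<phi> \<in> Dplus" obtains R where "0 < R" "\<And>t. R \<le> t \<Longrightarrow> \<phi> t = 0"
  using assms by (elim DplusE) (metis supported_in_def restr_def abs_of_pos order_less_le_trans)

lemma Dplus_continuous: "\<phi> \<in> Dplus \<Longrightarrow> continuous_on {0..} \<phi>"
proof (elim DplusE)
  fix \<Phi> R assume *: "\<phi> = restr \<Phi>" "smooth \<Phi>"
  have "continuous_on {0..} \<Phi>" using * smooth_continuous by blast
  then show ?thesis by (rule continuous_on_eq) (simp add: * restr_def)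
qed

lemma Dplus_measurable: "\<phi> \<in> Dplus \<Longrightarrow> \<phi> \<in> borel_measurable borel"
proof (elim DplusE)
  fix \<Phi> R assume *: "\<phi> = restr \<Phi>" "smooth \<Phi>"
  have [measurable]: "\<Phi> \<in> borel_measurable borel"
    using smooth_continuous[OF *(2)] by (rule borel_measurable_continuous_onI)
  show ?thesis unfolding * restr_def[abs_def] by measurable
qed

lemma Dplus_bounded:
  assumes "\<phi> \<in> Dplus" obtains B where "0 \<le> B" "\<And>t. norm (\<phi> t) \<le> B"
  using assms
proof (elim DplusE)
  fix \<Phi> R assume *: "\<phi> = restr \<Phi>" "smooth \<Phi>" "supported_in R \<Phi>"
  obtain B where "0 \<le> B" "\<And>t. norm (\<Phi> t) \<le> B"
    using supported_in_bound[OF *(3) smooth_continuous[OF *(2)]] by metis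
  then show thesis by (intro that[of B]) (auto simp: * restr_def)
qed

lemma Dplus_absolutely_integrable: "\<phi> \<in> Dplus \<Longrightarrow> \<phi> absolutely_integrable_on {p..q}"
proof -
  assume \<phi>: "\<phi> \<in> Dplus"
  obtain B where B: "\<And>t. norm (\<phi> t) \<le> B" by (rule Dplus_bounded[OF \<phi>]) blast
  have "(\<lambda>u. 1 * \<phi> u) absolutely_integrable_on {p..q}"
    by (rule absolutely_integrable_mult_bounded[OF _ Dplus_measurable[OF \<phi>], of _ _ _ B])
      (use B in \<open>auto intro!: absolutely_integrable_continuous_real\<close>)
  then show ?thesis by simp
qed

lemma deriv_plus_restr:
  assumes "\<And>t. t \<ge> 0 \<Longrightarrow> (\<Phi> has_vector_derivative \<Phi>' t) (at t within {0..})"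
  shows "deriv_plus (restr \<Phi>) = restr \<Phi>'"
    "t \<ge> 0 \<Longrightarrow> (restr \<Phi> has_vector_derivative restr \<Phi>' t) (at t within {0..})"
proof -
  show *: "(restr \<Phi> has_vector_derivative restr \<Phi>' t) (at t within {0..})" if "t \<ge> 0" for t
    by (rule has_vector_derivative_transform[OF _ _ assms[OF that], THEN has_vector_derivative_eq_rhs])
      (use that in \<open>auto simp: restr_def\<close>)
  have "at t within {0::real..} \<noteq> bot" if "t \<ge> 0" for t
  proof -
    have "{0::real..} \<noteq> {x}" for x
      using atLeast_iff[of 0 "0::real"] atLeast_iff[of 1 "0::real"] by (metis singletonD zero_le_one zero_neq_one order_refl)
    then have "t islimpt {0..}" by (intro connected_imp_perfect) (use that in auto)
    then show ?thesis by (simp add: trivial_limit_within)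
  qed
  with * show "deriv_plus (restr \<Phi>) = restr \<Phi>'"
    by (auto simp: deriv_plus_def fun_eq_iff vector_derivative_within restr_def)
qed

lemma Dplus_derivE:
  assumes "\<phi> \<in> Dplus"
  obtains \<Phi> \<Phi>' R where "\<phi> = restr \<Phi>" "smooth \<Phi>" "supported_in R \<Phi>" "deriv_plus \<phi> = restr \<Phi>'"
    "smooth \<Phi>'" "supported_in R \<Phi>'" "\<And>t. (\<Phi> has_vector_derivative \<Phi>' t) (at t)"
  using assms
proof (elim DplusE)
  fix \<Phi> R assume *: "\<phi> = restr \<Phi>" "smooth \<Phi>" "supported_in R \<Phi>"
  obtain \<Phi>' where d: "smooth \<Phi>'" "\<And>t. (\<Phi> has_vector_derivative \<Phi>' t) (at t)" by (rule smoothE[OF *(2)]) blast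
  show thesis
    by (rule that[of \<Phi> "R + 1" \<Phi>'])
      (use * d supported_in_mono[OF *(3)] supported_in_deriv[OF *(3)] deriv_plus_restr(1)[OF has_vector_derivative_at_within[OF d(2)]]
      in auto)
qed

lemma Dplus_deriv: "\<phi> \<in> Dplus \<Longrightarrow> deriv_plus \<phi> \<in> Dplus"
  by (elim Dplus_derivE) (use DplusI in auto)

lemma Dplus_has_derivative:
  "\<phi> \<in> Dplus \<Longrightarrow> t \<ge> 0 \<Longrightarrow> (\<phi> has_vector_derivative deriv_plus \<phi> t) (at t within {0..})"
  by (elim Dplus_derivE) (simp add: deriv_plus_restr(2)[OF has_vector_derivative_at_within])

lemma Dplus_deriv_vanishes:
  assumes \<phi>: "\<phi> \<in> Dplus" and z: "\<And>t. R \<le> t \<Longrightarrow> \<phi> t = 0" and t: "R \<le> t" "0 \<le> R"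
  shows "deriv_plus \<phi> t = 0"
proof -
  have gt: "deriv_plus \<phi> t = 0" if "R < t" for t
  proof -
    have d: "(\<phi> has_vector_derivative deriv_plus \<phi> t) (at t)"
      using Dplus_has_derivative[OF \<phi>, of t] that t at_within_interior[of t "{0..}"] by simp
    have "((\<lambda>_. 0) has_vector_derivative deriv_plus \<phi> t) (at t)"
      by (rule has_vector_derivative_transform_within_open[OF d open_greaterThan[of R]]) (use z that in auto)
    then show ?thesis using vector_derivative_unique_at[OF _ has_vector_derivative_const] by blast
  qed
  \<comment> \<open>The point \<open>R\<close> itself is reached by continuity from the
    right.\<close>
  have "continuous_on {R..} (deriv_plus \<phi>)"
    using continuous_on_subset[OF Dplus_continuous[OF Dplus_deriv[OF \<phi>]]] t by auto
  then show ?thesis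
    using continuous_constant_on_closure[of "{R<..}" "deriv_plus \<phi>" 0 t] gt t by auto
qed

text \<open>Left translation, cut off at 0 again so that the result is a representative in the sense
  of \<open>Dplus\<close>.\<close>

definition shift :: "real \<Rightarrow> (real \<Rightarrow> complex) \<Rightarrow> real \<Rightarrow> complex" where
  "shift s f t = (if t \<ge> 0 then f (t + s) else 0)"

lemma Dplus_shift: "\<phi> \<in> Dplus \<Longrightarrow> s \<ge> 0 \<Longrightarrow> shift s \<phi> \<in> Dplus"
proof (elim DplusE)
  fix \<Phi> R assume *: "s \<ge> 0" "\<phi> = restr \<Phi>" "smooth \<Phi>" "supported_in R \<Phi>"
  have "restr (\<lambda>t. \<Phi> (t + s)) \<in> Dplus"
    by (rule DplusI[of _ "R + s"]) (use * smooth_shift in \<open>auto simp: supported_in_def\<close>)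
  moreover have "restr (\<lambda>t. \<Phi> (t + s)) = shift s \<phi>" using * by (auto simp: restr_def shift_def)
  ultimately show ?thesis by simp
qed

lemma deriv_plus_shift:
  assumes "\<phi> \<in> Dplus" "s \<ge> 0"
  shows "deriv_plus (shift s \<phi>) = shift s (deriv_plus \<phi>)"
  using assms(1)
proof (elim Dplus_derivE)
  fix \<Phi> \<Phi>' R
  assume *: "\<phi> = restr \<Phi>" "deriv_plus \<phi> = restr \<Phi>'" "\<And>t. (\<Phi> has_vector_derivative \<Phi>' t) (at t)"
  have "((\<lambda>t. \<Phi> (t + s)) has_vector_derivative \<Phi>' (t + s)) (at t)" for t
  proof -
    have "((\<lambda>t. t + s) has_vector_derivative 1) (at t)" by (auto intro!: derivative_eq_intros)
    from vector_diff_chain_at[OF this *(3)] show ?thesis by (simp add: o_def)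
  qed
  then have "deriv_plus (restr (\<lambda>t. \<Phi> (t + s))) = restr (\<lambda>t. \<Phi>' (t + s))"
    by (rule deriv_plus_restr(1)[OF has_vector_derivative_at_within])
  moreover have "restr (\<lambda>t. \<Phi> (t + s)) = shift s \<phi>" "restr (\<lambda>t. \<Phi>' (t + s)) = shift s (deriv_plus \<phi>)"
    using *(1,2) assms(2) by (auto simp: restr_def shift_def)
  ultimately show ?thesis by simp
qed

section \<open>Convolution and dual convolution on test functions\<close>

text \<open>The positive and the negative part of \<open>r\<close> are densities of two measures
  that agree and are finite on all rays, so they are equal almost everywhere. One of them is 0 at
  each point, hence so is the other.\<close>

lemma AE_zero_of_tail_integrals:
  fixes r :: "real \<Rightarrow> real"
  assumes r: "integrable lborel r" and z: "\<And>x. (LINT t|lborel. indicator {x<..} t * r t) = 0"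
  shows "AE t in lborel. r t = 0"
proof -
  have [measurable]: "r \<in> borel_measurable borel" using r by auto
  define P where "P s = density lborel (\<lambda>t. ennreal (max 0 (s * r t)))" for s :: real
  have int: "integrable lborel (\<lambda>t. max 0 (s * r t) * indicator {x<..} t)" for s x
    by (rule Bochner_Integration.integrable_bound[of _ "\<lambda>t. s * r t"]) (use r in \<open>auto simp: indicator_def\<close>)
  have em: "emeasure (P s) {x<..} = ennreal (LINT t|lborel. max 0 (s * r t) * indicator {x<..} t)" for s x
  proof -
    have "emeasure (P s) {x<..} = (\<integral>\<^sup>+ t. ennreal (max 0 (s * r t) * indicator {x<..} t) \<partial>lborel)"
      unfolding P_def by (subst emeasure_density) (auto intro!: nn_integral_cong simp: indicator_def)
    also have "\<dots> = ennreal (LINT t|lborel. max 0 (s * r t) * indicator {x<..} t)"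
      by (rule nn_integral_eq_integral[OF int]) auto
    finally show ?thesis .
  qed
  have "P 1 = P (-1)"
  proof (rule measure_eqI_lessThan)
    fix x
    have "(LINT t|lborel. max 0 (1 * r t) * indicator {x<..} t) - (LINT t|lborel. max 0 (-1 * r t) * indicator {x<..} t)
      = (LINT t|lborel. max 0 (1 * r t) * indicator {x<..} t - max 0 (-1 * r t) * indicator {x<..} t)"
      by (rule Bochner_Integration.integral_diff[symmetric, OF int int])
    also have "\<dots> = (LINT t|lborel. indicator {x<..} t * r t)"
      by (intro Bochner_Integration.integral_cong) (auto simp: indicator_def max_def)
    finally show "emeasure (P 1) {x<..} = emeasure (P (-1)) {x<..}" unfolding em z by simp
    show "emeasure (P 1) {x<..} < \<infinity>" unfolding em by simp
  qed (auto simp: P_def)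
  then have "AE t in lborel. ennreal (max 0 (1 * r t)) = ennreal (max 0 (-1 * r t))"
    unfolding P_def by (intro sigma_finite_measure.density_unique[OF lborel.sigma_finite_measure_axioms]) auto
  then show ?thesis by eventually_elim (auto simp: max_def split: if_splits)
qed

lemma AE_zero_of_primitive_zero:
  fixes a :: "real \<Rightarrow> complex"
  assumes a: "a absolutely_integrable_on {0..q}" and q: "0 \<le> q"
    and z: "\<And>t. t \<in> {0..q} \<Longrightarrow> integral {0..t} a = 0"
  shows "AE t in lebesgue. t \<in> {0..q} \<longrightarrow> a t = 0"
proof -
  obtain a' N where a': "integrable lborel a'" "\<And>u. u \<notin> {0..q} \<Longrightarrow> a' u = 0"
    "negligible N" "\<And>u. u \<in> {0..q} - N \<Longrightarrow> a u = a' u"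
    by (rule borel_representative[OF a]) blast
  have ai: "a integrable_on {0..q}" using a by (auto simp: absolutely_integrable_on_def)
  \<comment> \<open>A tail integral is the difference of two values of the primitive.\<close>
  have tail: "(LINT t|lborel. a' t * (if x < t then 1 else 0)) = 0" for x
  proof -
    have "(LINT t|lborel. a' t * (if x < t then 1 else 0)) = integral {0..q} (\<lambda>t. a t * (if x < t then 1 else 0))"
      by (rule integral_representative(1)[OF a', where M = 1, symmetric]) auto
    also have "\<dots> = integral {0..q} (\<lambda>t. if t \<in> {max 0 x..q} then a t else 0)"
      by (rule integral_spike[of "{x}"]) auto
    also have "\<dots> = integral {max 0 x..q} a" by (subst integral_if_subset) auto
    also have "\<dots> = 0"
    proof (cases "x \<le> q")
      case True
      then show ?thesis
        using Henstock_Kurzweil_Integration.integral_combine[OF _ _ ai, of "max 0 x"] z[of "max 0 x"] z[of q] q by simp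
    qed (use q in auto)
    finally show ?thesis .
  qed
  have comp: "AE t in lborel. L (a' t) = 0" if L: "bounded_linear L" for L :: "complex \<Rightarrow> real"
  proof (rule AE_zero_of_tail_integrals)
    show "integrable lborel (\<lambda>t. L (a' t))" by (rule integrable_bounded_linear[OF L a'(1)])
    fix x
    have i: "integrable lborel (\<lambda>t. a' t * (if x < t then 1 else 0))"
      by (rule Bochner_Integration.integrable_bound[OF a'(1)]) (use a'(1) in auto)
    have "(LINT t|lborel. indicator {x<..} t * L (a' t)) = (LINT t|lborel. L (a' t * (if x < t then 1 else 0)))"
      by (intro Bochner_Integration.integral_cong)
        (auto simp: indicator_def linear_0[OF bounded_linear.linear[OF L]])
    also have "\<dots> = L (LINT t|lborel. a' t * (if x < t then 1 else 0))"
      by (rule integral_bounded_linear[OF L i])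
    finally show "(LINT t|lborel. indicator {x<..} t * L (a' t)) = 0"
      using tail linear_0[OF bounded_linear.linear[OF L]] by simp
  qed
  have "AE t in lborel. a' t = 0"
    using comp[OF bounded_linear_Re] comp[OF bounded_linear_Im] by eventually_elim (simp add: complex_eq_iff)
  then have "AE t in lebesgue. a' t = 0" by (rule AE_completion)
  moreover have "AE t in lebesgue. t \<notin> N"
    using a'(3) by (simp add: negligible_iff_null_sets AE_not_in)
  ultimately show ?thesis by eventually_elim (use a'(4) in auto)
qed

section \<open>Dual convolution as an operator on \<open>Dplus\<close>\<close>

lemma locally_integrableD:
  assumes "locally_integrable a" "0 \<le> p"
  shows "a absolutely_integrable_on {p..q}"
proof -
  have "a absolutely_integrable_on {0..max 1 q}" using assms(1) by (simp add: locally_integrable_def)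
  then show ?thesis by (rule absolutely_integrable_subinterval_Icc) (use assms(2) in auto)
qed

lemma locally_integrable_conv:
  "locally_integrable a \<Longrightarrow> locally_integrable b \<Longrightarrow> locally_integrable (conv a b)"
  by (auto simp: locally_integrable_def intro: conv_absolutely_integrable)

lemma integral_extend_zero:
  fixes f :: "real \<Rightarrow> 'a::banach"
  assumes "p \<le> T" "T \<le> T'" "\<And>s. T < s \<Longrightarrow> f s = 0"
  shows "integral {p..T'} f = integral {p..T} f"
proof -
  have "integral {p..T'} f = integral {p..T'} (\<lambda>s. if s \<in> {p..T} then f s else 0)"
    by (intro integral_cong) (use assms(3) in auto)
  also have "\<dots> = integral {p..T} f" by (rule integral_if_subset) (use assms in auto)
  finally show ?thesis .
qed

text \<open>The substitution u = s - t gives an average of translates over an interval that does not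
  depend on \<open>t\<close>; in this form it can be differentiated and enters Fubini's
  theorem.\<close>

lemma dual_conv_eq:
  fixes a \<phi> :: "real \<Rightarrow> complex"
  assumes z: "\<And>s. R \<le> s \<Longrightarrow> \<phi> s = 0" and T: "R \<le> T" and t: "0 \<le> t"
  shows "dual_conv a \<phi> t = integral {0..T} (\<lambda>u. a u * \<phi> (t + u))"
proof -
  have "dual_conv a \<phi> t = integral {t..} (\<lambda>s. if s \<in> {t..t + T} then a (s - t) * \<phi> s else 0)"
    unfolding dual_conv_def using t T z by (auto intro!: integral_cong)
  also have "\<dots> = integral {t..t + T} (\<lambda>s. a (s - t) * \<phi> s)"
    by (rule integral_if_subset) auto
  also have "\<dots> = integral {0..T} (\<lambda>u. a u * \<phi> (t + u))"
    using integral_shift_real_ivl[where a = t and b = "t + T" and c = t and f = "\<lambda>s. a (s - t) * \<phi> s"]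
    by (simp add: add.commute)
  finally show ?thesis .
qed

lemma dual_conv_restr:
  assumes \<Phi>: "supported_in R \<Phi>"
  shows "dual_conv a (restr \<Phi>) = restr (\<lambda>t. integral {0..R} (\<lambda>u. a u * \<Phi> (t + u)))"
proof
  fix t
  have "dual_conv a (restr \<Phi>) t = integral {0..R} (\<lambda>u. a u * restr \<Phi> (t + u))" if "0 \<le> t"
    by (rule dual_conv_eq[where R = R]) (use \<Phi> that in \<open>auto simp: supported_in_def restr_def\<close>)
  also have "integral {0..R} (\<lambda>u. a u * restr \<Phi> (t + u)) = integral {0..R} (\<lambda>u. a u * \<Phi> (t + u))" if "0 \<le> t"
    by (intro integral_cong) (use that in \<open>auto simp: restr_def\<close>)
  finally show "dual_conv a (restr \<Phi>) t = restr (\<lambda>t. integral {0..R} (\<lambda>u. a u * \<Phi> (t + u))) t"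
    by (cases "0 \<le> t") (auto simp: restr_def dual_conv_def)
qed

lemma dual_conv_Dplus:
  assumes a: "locally_integrable a" and \<phi>: "\<phi> \<in> Dplus"
  shows "dual_conv a \<phi> \<in> Dplus" "deriv_plus (dual_conv a \<phi>) = dual_conv a (deriv_plus \<phi>)"
proof -
  obtain \<Phi> \<Phi>' R where *: "\<phi> = restr \<Phi>" "smooth \<Phi>" "supported_in R \<Phi>" "deriv_plus \<phi> = restr \<Phi>'"
    "smooth \<Phi>'" "supported_in R \<Phi>'" "\<And>t. (\<Phi> has_vector_derivative \<Phi>' t) (at t)"
    by (rule Dplus_derivE[OF \<phi>]) blast
  have ai: "a absolutely_integrable_on {0..R}" by (rule locally_integrableD[OF a]) simp
  show "dual_conv a \<phi> \<in> Dplus"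
    unfolding *(1) dual_conv_restr[OF *(3)]
    by (rule DplusI[OF translation_average_smooth[OF ai *(2,3)]])
  show "deriv_plus (dual_conv a \<phi>) = dual_conv a (deriv_plus \<phi>)"
    unfolding *(4) unfolding *(1) dual_conv_restr[OF *(3)] dual_conv_restr[OF *(6)]
    by (rule deriv_plus_restr(1)[OF translation_average_deriv[OF ai *(2,3,5,7)]])
qed

lemma dual_conv_vanishes:
  assumes "\<And>s. R \<le> s \<Longrightarrow> \<phi> s = 0" "R \<le> t" "0 \<le> R"
  shows "dual_conv a \<phi> t = 0"
proof -
  have "dual_conv a \<phi> t = integral {0..R} (\<lambda>u. a u * \<phi> (t + u))"
    by (rule dual_conv_eq[where R = R]) (use assms in auto)
  also have "\<dots> = integral {0..R} (\<lambda>u. 0)" by (intro integral_cong) (use assms in auto)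
  finally show ?thesis by simp
qed

lemma dual_conv_integrand:
  assumes a: "a absolutely_integrable_on {0..T}" and \<phi>: "\<phi> \<in> Dplus" and t: "0 \<le> t"
  shows "(\<lambda>u. a u * \<phi> (t + u)) absolutely_integrable_on {0..T}"
  by (intro absolutely_integrable_mult_continuous[OF a] continuous_on_compose2[OF Dplus_continuous[OF \<phi>]]
      continuous_intros) (use t in auto)

lemma Dplus_vanishes2:
  assumes "\<phi> \<in> Dplus" "\<psi> \<in> Dplus"
  obtains R where "0 < R" "\<And>t. R \<le> t \<Longrightarrow> \<phi> t = 0" "\<And>t. R \<le> t \<Longrightarrow> \<psi> t = 0"
proof -
  obtain R where "0 < R" "\<And>t. R \<le> t \<Longrightarrow> \<phi> t = 0" by (rule Dplus_vanishes[OF assms(1)]) blast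
  moreover obtain R' where "0 < R'" "\<And>t. R' \<le> t \<Longrightarrow> \<psi> t = 0" by (rule Dplus_vanishes[OF assms(2)]) blast
  ultimately show ?thesis using that[of "max R R'"] by simp
qed

lemma dual_conv_add:
  assumes a: "locally_integrable a" and \<phi>: "\<phi> \<in> Dplus" and \<psi>: "\<psi> \<in> Dplus"
  shows "dual_conv a (\<lambda>t. \<phi> t + \<psi> t) = (\<lambda>t. dual_conv a \<phi> t + dual_conv a \<psi> t)"
proof
  fix t
  obtain R where R: "0 < R" "\<And>t. R \<le> t \<Longrightarrow> \<phi> t = 0" "\<And>t. R \<le> t \<Longrightarrow> \<psi> t = 0"
    by (rule Dplus_vanishes2[OF \<phi> \<psi>]) blast
  have ai: "a absolutely_integrable_on {0..R}" by (rule locally_integrableD[OF a]) simp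
  show "dual_conv a (\<lambda>t. \<phi> t + \<psi> t) t = dual_conv a \<phi> t + dual_conv a \<psi> t"
  proof (cases "0 \<le> t")
    case True
    then have e: "dual_conv a f t = integral {0..R} (\<lambda>u. a u * f (t + u))" if "\<And>s. R \<le> s \<Longrightarrow> f s = 0" for f
      by (intro dual_conv_eq[where R = R]) (use that in auto)
    have "dual_conv a (\<lambda>t. \<phi> t + \<psi> t) t = integral {0..R} (\<lambda>u. a u * \<phi> (t + u) + a u * \<psi> (t + u))"
      using e[of "\<lambda>t. \<phi> t + \<psi> t"] R by (simp add: distrib_left)
    also have "\<dots> = dual_conv a \<phi> t + dual_conv a \<psi> t"
      using e[of \<phi>] e[of \<psi>] R dual_conv_integrand[OF ai \<phi> True] dual_conv_integrand[OF ai \<psi> True]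
      by (simp add: Henstock_Kurzweil_Integration.integral_add set_lebesgue_integral_eq_integral(1))
    finally show ?thesis .
  qed (simp add: dual_conv_def)
qed

lemma dual_conv_cmult: "dual_conv a (\<lambda>t. c * \<phi> t) = (\<lambda>t. c * dual_conv a \<phi> t)"
  by (auto simp: dual_conv_def fun_eq_iff mult.left_commute)

lemma dual_conv_diff:
  assumes a: "locally_integrable a" and \<phi>: "\<phi> \<in> Dplus" and \<psi>: "\<psi> \<in> Dplus"
  shows "dual_conv a (\<lambda>t. \<phi> t - \<psi> t) = (\<lambda>t. dual_conv a \<phi> t - dual_conv a \<psi> t)"
  using dual_conv_add[OF a \<phi> Dplus_cmult[OF \<psi>, of "-1"]] dual_conv_cmult[of a "-1" \<psi>] by simp

lemma dual_conv_shift: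
  assumes \<phi>: "\<phi> \<in> Dplus" and s: "0 \<le> s"
  shows "dual_conv a (shift s \<phi>) = shift s (dual_conv a \<phi>)"
proof
  fix t
  obtain R where R: "0 < R" "\<And>t. R \<le> t \<Longrightarrow> \<phi> t = 0" by (rule Dplus_vanishes[OF \<phi>]) blast
  show "dual_conv a (shift s \<phi>) t = shift s (dual_conv a \<phi>) t"
  proof (cases "0 \<le> t")
    case True
    then have "dual_conv a (shift s \<phi>) t = integral {0..R} (\<lambda>u. a u * shift s \<phi> (t + u))"
      by (intro dual_conv_eq[where R = R]) (use R s in \<open>auto simp: shift_def\<close>)
    also have "\<dots> = integral {0..R} (\<lambda>u. a u * \<phi> (t + s + u))"
      by (intro integral_cong) (use True in \<open>auto simp: shift_def algebra_simps\<close>)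
    also have "\<dots> = dual_conv a \<phi> (t + s)"
      by (intro dual_conv_eq[where R = R, symmetric]) (use R s True in auto)
    finally show ?thesis using True by (simp add: shift_def)
  qed (simp add: shift_def dual_conv_def)
qed

text \<open>Dual convolution is the transpose of convolution: \<open>conv a b\<close> is integrated
  against the translate \<phi> (t + w). The cutoff u + v \<le> R costs nothing, as \<phi> vanishes
  beyond \<open>R\<close>.\<close>

lemma dual_conv_conv:
  assumes a: "locally_integrable a" and b: "locally_integrable b" and \<phi>: "\<phi> \<in> Dplus"
  shows "dual_conv (conv a b) \<phi> = dual_conv b (dual_conv a \<phi>)"
proof
  fix t
  obtain R where R: "0 < R" "\<And>t. R \<le> t \<Longrightarrow> \<phi> t = 0" by (rule Dplus_vanishes[OF \<phi>]) blast
  obtain B where B: "\<And>t. norm (\<phi> t) \<le> B" by (rule Dplus_bounded[OF \<phi>]) blast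
  show "dual_conv (conv a b) \<phi> t = dual_conv b (dual_conv a \<phi>) t"
  proof (cases "0 \<le> t")
    case True
    have [measurable]: "\<phi> \<in> borel_measurable borel" by (rule Dplus_measurable[OF \<phi>])
    have "dual_conv (conv a b) \<phi> t = integral {0..R} (\<lambda>w. conv a b w * \<phi> (t + w))"
      by (rule dual_conv_eq[where R = R]) (use R True in auto)
    also have "\<dots> = integral {0..R} (\<lambda>u. b u * integral {0..R} (\<lambda>v. a v * (if u + v \<le> R then \<phi> (t + (u + v)) else 0)))"
      by (rule conv_kernel(2)[where M = B]) (use a b locally_integrableD B in auto)
    also have "\<dots> = integral {0..R} (\<lambda>u. b u * dual_conv a \<phi> (t + u))"
    proof (intro integral_cong arg_cong2[where f = "(*)"] refl)
      fix u assume u: "u \<in> {0..R}"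
      have "integral {0..R} (\<lambda>v. a v * (if u + v \<le> R then \<phi> (t + (u + v)) else 0)) =
        integral {0..R} (\<lambda>v. a v * \<phi> (t + u + v))"
        by (intro integral_cong) (use R True in \<open>auto simp: algebra_simps\<close>)
      also have "\<dots> = dual_conv a \<phi> (t + u)"
        by (rule dual_conv_eq[where R = R, symmetric]) (use R True u in auto)
      finally show "integral {0..R} (\<lambda>v. a v * (if u + v \<le> R then \<phi> (t + (u + v)) else 0)) = dual_conv a \<phi> (t + u)" .
    qed
    also have "\<dots> = dual_conv b (dual_conv a \<phi>) t"
      by (rule dual_conv_eq[where R = R, symmetric]) (use R True dual_conv_vanishes[of R \<phi>] in auto)
    finally show ?thesis .
  qed (simp add: dual_conv_def)
qed

section \<open>Injectivity of the dual convolution and preservation of supports\<close>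

lemma continuous_on_primitive:
  assumes a: "locally_integrable a"
  shows "continuous_on UNIV (\<lambda>s. integral {0..s} a)"
proof -
  let ?K = "\<lambda>s. integral {0..s} a"
  have ain: "a integrable_on {0..q}" for q
    using locally_integrableD[OF a, of 0 q] by (auto simp: absolutely_integrable_on_def)
  have Kc: "continuous_on {0..q} ?K" for q by (rule indefinite_integral_continuous_1[OF ain])
  have "isCont ?K x" for x
  proof -
    have "continuous_on {-\<bar>x\<bar>-1..\<bar>x\<bar>+1} (\<lambda>s. ?K (max 0 s))"
      by (intro continuous_on_compose2[OF Kc[of "\<bar>x\<bar>+1"]] continuous_intros) auto
    \<comment> \<open>For negative \<open>s\<close> the interval is empty and the primitive is
      0.\<close>
    moreover have "?K (max 0 s) = ?K s" for s by (simp add: max_def)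
    ultimately have "continuous_on {-\<bar>x\<bar>-1..\<bar>x\<bar>+1} ?K" by simp
    then show ?thesis by (rule continuous_on_interior) (auto simp: interior_atLeastAtMost_real)
  qed
  then show ?thesis by (simp add: continuous_at_imp_continuous_on)
qed

lemma primitive_not_vanishing:
  assumes a: "locally_integrable a" "zero_in_supp a" and e: "0 < \<epsilon>"
  shows "\<not> vanishes_before (\<lambda>s. integral {0..s} a) \<epsilon>"
proof
  assume v: "vanishes_before (\<lambda>s. integral {0..s} a) \<epsilon>"
  have "AE t in lebesgue. t \<in> {0..\<epsilon>/2} \<longrightarrow> a t = 0"
    by (rule AE_zero_of_primitive_zero[OF locally_integrableD[OF a(1)]])
      (use v e in \<open>auto simp: vanishes_before_def\<close>)
  then have "AE t in lebesgue. t \<in> {0..<\<epsilon>/2} \<longrightarrow> a t = 0" by eventually_elim auto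
  then show False using a(2) half_gt_zero[OF e] unfolding zero_in_supp_def by blast
qed

text \<open>Integration by parts moves the problem to the continuous primitive of the kernel and to
  \<open>deriv_plus \<phi>\<close>; reflecting the latter turns the dual convolution into a convolution.\<close>

lemma dual_conv_zero_imp_zero:
  assumes a: "locally_integrable a" "zero_in_supp a" and \<phi>: "\<phi> \<in> Dplus" and r: "0 \<le> r"
    and z: "\<And>t. r \<le> t \<Longrightarrow> dual_conv a \<phi> t = 0" and t: "r \<le> t"
  shows "\<phi> t = 0"
proof -
  obtain \<Phi> \<Phi>' R0 where *: "\<phi> = restr \<Phi>" "smooth \<Phi>" "supported_in R0 \<Phi>" "deriv_plus \<phi> = restr \<Phi>'"
    "smooth \<Phi>'" "supported_in R0 \<Phi>'" "\<And>t. (\<Phi> has_vector_derivative \<Phi>' t) (at t)"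
    by (rule Dplus_derivE[OF \<phi>]) blast
  \<comment> \<open>Large enough for both supports and strictly above \<open>t\<close>, hence above
    \<open>r\<close>.\<close>
  define T where "T = max R0 (t + 1)"
  have T: "supported_in T \<Phi>" "supported_in T \<Phi>'" "r < T" "0 < T" "t < T"
    using supported_in_mono *(3,6) t r by (auto simp: T_def)
  have \<Phi>T: "\<Phi> s = 0" "\<Phi>' s = 0" if "T \<le> s" for s
    using T(1,2,4) that by (auto simp: supported_in_def)
  define K where "K s = integral {0..s} a" for s
  have ai: "a absolutely_integrable_on {0..q}" for q by (rule locally_integrableD[OF a(1)]) simp
  have ain: "a integrable_on {0..q}" for q using ai[of q] by (auto simp: absolutely_integrable_on_def)
  have K_cont: "continuous_on UNIV K" unfolding K_def by (rule continuous_on_primitive[OF a(1)])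
  have \<Phi>'c: "continuous_on A \<Phi>'" for A by (rule smooth_continuous[OF *(5)])
  have key: "integral {0..T} (\<lambda>v. \<Phi>' (s + v) * K v) = 0" if s: "r \<le> s" for s
  proof -
    have s0: "0 \<le> s" using s r by simp
    have ftc: "\<Phi> (s + u) = - integral {0..T} (\<lambda>v. \<Phi>' (s + v) * (if u \<le> v then 1 else 0))" if u: "u \<in> {0..T}" for u
    proof -
      have "((\<lambda>v. \<Phi>' (s + v)) has_integral \<Phi> (s + T) - \<Phi> (s + u)) {u..T}"
      proof (rule fundamental_theorem_of_calculus)
        fix v
        have "((\<lambda>t. s + t) has_vector_derivative 1) (at v within {u..T})" by (auto intro!: derivative_eq_intros)
        from vector_diff_chain_within[OF this has_vector_derivative_at_within[OF *(7)]]
        show "((\<lambda>v. \<Phi> (s + v)) has_vector_derivative \<Phi>' (s + v)) (at v within {u..T})" by (simp add: o_def)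
      qed (use u in auto)
      then have "integral {u..T} (\<lambda>v. \<Phi>' (s + v)) = - \<Phi> (s + u)"
        using \<Phi>T(1)[of "s + T"] s0 by (simp add: integral_unique)
      moreover have "integral {0..T} (\<lambda>v. \<Phi>' (s + v) * (if u \<le> v then 1 else 0)) = integral {u..T} (\<lambda>v. \<Phi>' (s + v))"
        by (rule integral_from) (use u in auto)
      ultimately show ?thesis by simp
    qed
    have bi: "(\<lambda>v. \<Phi>' (s + v)) absolutely_integrable_on {0..T}"
      by (intro absolutely_integrable_continuous_real continuous_on_compose2[OF \<Phi>'c[of UNIV]] continuous_intros) auto
    have "0 = dual_conv a \<phi> s" using z[OF s] by simp
    also have "\<dots> = integral {0..T} (\<lambda>u. a u * \<Phi> (s + u))"
      unfolding *(1) dual_conv_restr[OF T(1)] using s0 by (simp add: restr_def)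
    also have "\<dots> = integral {0..T} (\<lambda>u. - (a u * integral {0..T} (\<lambda>v. \<Phi>' (s + v) * (if u \<le> v then 1 else 0))))"
      by (intro integral_cong) (simp add: ftc)
    also have "\<dots> = - integral {0..T} (\<lambda>u. a u * integral {0..T} (\<lambda>v. \<Phi>' (s + v) * (if u \<le> v then 1 else 0)))"
      by simp
    also have "integral {0..T} (\<lambda>u. a u * integral {0..T} (\<lambda>v. \<Phi>' (s + v) * (if u \<le> v then 1 else 0))) =
      integral {0..T} (\<lambda>v. \<Phi>' (s + v) * integral {0..T} (\<lambda>u. a u * (if u \<le> v then 1 else 0)))"
      by (rule fubini_kernel(2)[OF ai bi, where M = 1]) auto
    also have "\<dots> = integral {0..T} (\<lambda>v. \<Phi>' (s + v) * K v)"
      by (intro integral_cong) (simp add: integral_upto K_def)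
    finally show ?thesis by simp
  qed
  define g where "g s = \<Phi>' (T - s)" for s
  have g_cont: "continuous_on UNIV g"
    unfolding g_def by (intro continuous_on_compose2[OF \<Phi>'c[of UNIV]] continuous_intros) auto
  \<comment> \<open>Reflection at \<open>T\<close> sends the half-line from \<open>r\<close> on,
    where \<open>key\<close> holds, to arguments up to T - r.\<close>
  have "vanishes_before (conv K g) (T - r)"
    unfolding vanishes_before_def
  proof (intro allI impI)
    fix s assume s: "0 \<le> s" "s < T - r"
    have "conv K g s = integral {0..s} (\<lambda>v. \<Phi>' (T - s + v) * K v)"
      by (subst conv_commute) (simp add: conv_def g_def algebra_simps)
    also have "\<dots> = integral {0..T} (\<lambda>v. \<Phi>' (T - s + v) * K v)"
      by (rule integral_extend_zero[symmetric]) (use s r \<Phi>T in auto)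
    also have "\<dots> = 0" by (rule key) (use s in simp)
    finally show "conv K g s = 0" .
  qed
  note tit = titchmarsh_continuous[OF K_cont g_cont this]
  \<comment> \<open>A nonzero value of \<open>g\<close> would force the primitive \<open>K\<close>
    to vanish near 0, contrary to 0 being in the support of the kernel.\<close>
  have g0: "g s = 0" if s: "0 \<le> s" "s < T - r" for s
  proof (rule ccontr)
    assume "g s \<noteq> 0"
    with tit s have v: "vanishes_before K (T - r - s)" by blast
    then show False using primitive_not_vanishing[OF a, of "T - r - s"] s unfolding K_def by simp
  qed
  have \<Phi>'0: "\<Phi>' s = 0" if "s \<in> {r<..T}" for s
    using g0[of "T - s"] that by (simp add: g_def)
  have "(\<Phi>' has_integral \<Phi> T - \<Phi> t) {t..T}"
    by (rule fundamental_theorem_of_calculus) (use T in \<open>auto intro: has_vector_derivative_at_within[OF *(7)]\<close>)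
  moreover have "(\<Phi>' has_integral 0) {t..T}"
    by (rule has_integral_spike[where S = "{t}" and f = "\<lambda>_. 0"]) (use \<Phi>'0 t in auto)
  ultimately have "\<Phi> T - \<Phi> t = 0" using has_integral_unique by blast
  then show ?thesis using \<Phi>T(1)[of T] by (simp add: *(1) restr_def)
qed

text \<open>The integral over [0, t] is the one over [0, R + t] minus the one over [t, R + t]. Each
  of these is an average of translates with weight on a fixed interval, which brings the smoothness
  results for averages to bear.\<close>

lemma conv_restr:
  assumes \<Phi>: "smooth \<Phi>" "supported_in R \<Phi>" and \<Gamma>: "smooth \<Gamma>" "supported_in R \<Gamma>"
  shows "conv (restr \<Phi>) (restr \<Gamma>) = restr (\<lambda>t. integral {-R..0} (\<lambda>u. \<Gamma> (- u) * \<Phi> (t + u)) -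
    integral {0..R} (\<lambda>v. \<Phi> (- v) * \<Gamma> (t + v)))"
proof
  fix t
  note c = smooth_continuous[OF \<Phi>(1), of UNIV] smooth_continuous[OF \<Gamma>(1), of UNIV]
  have R: "0 < R" using \<Phi>(2) by (simp add: supported_in_def)
  have i: "(\<lambda>s. \<Phi> (t - s) * \<Gamma> s) integrable_on {p..q}" for p q
    by (intro integrable_continuous_real continuous_on_mult continuous_on_compose2[OF c(1)] continuous_on_subset[OF c(2)]
        continuous_intros) auto
  show "conv (restr \<Phi>) (restr \<Gamma>) t = restr (\<lambda>t. integral {-R..0} (\<lambda>u. \<Gamma> (- u) * \<Phi> (t + u)) -
    integral {0..R} (\<lambda>v. \<Phi> (- v) * \<Gamma> (t + v))) t"
  proof (cases "0 \<le> t")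
    case True
    have "integral {-R..0} (\<lambda>u. \<Gamma> (- u) * \<Phi> (t + u)) = integral {0..R} (\<lambda>s. \<Phi> (t - s) * \<Gamma> s)"
      using integral_reflect_shift[of 0 R "\<lambda>u. \<Gamma> (- u) * \<Phi> (t + u)" 0] by (simp add: mult.commute)
    also have "\<dots> = integral {0..R + t} (\<lambda>s. \<Phi> (t - s) * \<Gamma> s)"
      by (rule integral_extend_zero[symmetric]) (use R True \<Gamma>(2) in \<open>auto simp: supported_in_def\<close>)
    also have "\<dots> = integral {0..t} (\<lambda>s. \<Phi> (t - s) * \<Gamma> s) + integral {t..R + t} (\<lambda>s. \<Phi> (t - s) * \<Gamma> s)"
      using Henstock_Kurzweil_Integration.integral_combine[OF _ _ i, of 0 t "R + t"] R True by simp
    also have "integral {t..R + t} (\<lambda>s. \<Phi> (t - s) * \<Gamma> s) = integral {0..R} (\<lambda>v. \<Phi> (- v) * \<Gamma> (t + v))"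
      using integral_shift_real_ivl[where a = t and b = "R + t" and c = t and f = "\<lambda>s. \<Phi> (t - s) * \<Gamma> s"]
      by (simp add: add.commute)
    also have "integral {0..t} (\<lambda>s. \<Phi> (t - s) * \<Gamma> s) = conv (restr \<Phi>) (restr \<Gamma>) t"
      unfolding conv_def by (intro integral_cong) (auto simp: restr_def)
    finally show ?thesis using True by (simp add: restr_def)
  qed (simp add: conv_eq_0_nonpos restr_def)
qed

lemma conv_Dplus:
  assumes \<phi>: "\<phi> \<in> Dplus" and \<gamma>: "\<gamma> \<in> Dplus"
  shows "conv \<phi> \<gamma> \<in> Dplus"
    and "deriv_plus (conv \<phi> \<gamma>) = (\<lambda>t. conv (deriv_plus \<phi>) \<gamma> t + \<phi> 0 * \<gamma> t)"
proof -
  obtain \<Phi> \<Phi>' R1 where 1: "\<phi> = restr \<Phi>" "smooth \<Phi>" "supported_in R1 \<Phi>" "deriv_plus \<phi> = restr \<Phi>'"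
    "smooth \<Phi>'" "supported_in R1 \<Phi>'" "\<And>t. (\<Phi> has_vector_derivative \<Phi>' t) (at t)"
    by (rule Dplus_derivE[OF \<phi>]) blast
  obtain \<Gamma> \<Gamma>' R2 where 2: "\<gamma> = restr \<Gamma>" "smooth \<Gamma>" "supported_in R2 \<Gamma>" "deriv_plus \<gamma> = restr \<Gamma>'"
    "smooth \<Gamma>'" "supported_in R2 \<Gamma>'" "\<And>t. (\<Gamma> has_vector_derivative \<Gamma>' t) (at t)"
    by (rule Dplus_derivE[OF \<gamma>]) blast
  define R where "R = max R1 R2"
  have s: "supported_in R \<Phi>" "supported_in R \<Phi>'" "supported_in R \<Gamma>" "supported_in R \<Gamma>'"
    using 1 2 supported_in_mono by (auto simp: R_def)
  have R: "0 < R" using s(1) by (simp add: supported_in_def)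
  have ai: "(\<lambda>u. F (- u)) absolutely_integrable_on {p..q}" if "smooth F" for F p q
    by (intro absolutely_integrable_continuous_real continuous_on_compose2[OF smooth_continuous[OF that, of UNIV]]
        continuous_intros) auto
  let ?h = "\<lambda>\<Phi> \<Gamma> t. integral {-R..0} (\<lambda>u. \<Gamma> (- u) * \<Phi> (t + u)) - integral {0..R} (\<lambda>v. \<Phi> (- v) * \<Gamma> (t + v))"
  have d: "((?h \<Phi> \<Gamma>) has_vector_derivative integral {-R..0} (\<lambda>u. \<Gamma> (- u) * \<Phi>' (t + u)) - integral {0..R} (\<lambda>v. \<Phi> (- v) * \<Gamma>' (t + v)))
      (at t within {0..})" for t
    by (intro has_vector_derivative_diff translation_average_deriv[OF ai[OF 2(2)] 1(2) s(1) 1(5,7)]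
        translation_average_deriv[OF ai[OF 1(2)] 2(2) s(3) 2(5,7)])
  show "conv \<phi> \<gamma> \<in> Dplus"
  proof -
    note sm1 = translation_average_smooth[OF ai[OF 2(2)] 1(2) s(1), of "-R" 0]
      and sm2 = translation_average_smooth[OF ai[OF 1(2)] 2(2) s(3), of 0 R]
    have "smooth (\<lambda>t. integral {-R..0} (\<lambda>u. \<Gamma> (- u) * \<Phi> (t + u)) + (-1) * integral {0..R} (\<lambda>v. \<Phi> (- v) * \<Gamma> (t + v)))"
      by (intro smooth_add smooth_cmult sm1(1) sm2(1))
    moreover have "supported_in (R + R) (\<lambda>t. integral {-R..0} (\<lambda>u. \<Gamma> (- u) * \<Phi> (t + u)) + (-1) * integral {0..R} (\<lambda>v. \<Phi> (- v) * \<Gamma> (t + v)))"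
      using sm1(2) sm2(2) R by (simp add: supported_in_def)
    ultimately have "restr (\<lambda>t. integral {-R..0} (\<lambda>u. \<Gamma> (- u) * \<Phi> (t + u)) + (-1) * integral {0..R} (\<lambda>v. \<Phi> (- v) * \<Gamma> (t + v))) \<in> Dplus"
      by (rule DplusI)
    then show ?thesis unfolding 1(1) 2(1) conv_restr[OF 1(2) s(1) 2(2) s(3)] by simp
  qed
  \<comment> \<open>Differentiating the second average hits \<Gamma>. Moving the derivative to
    \<Phi> restores the shape of \<open>conv_restr\<close>, and the boundary value at v = 0 is the
    term \<open>\<phi> 0 * \<gamma> t\<close>.\<close>
  have parts: "integral {0..R} (\<lambda>v. \<Phi> (- v) * \<Gamma>' (t + v)) = integral {0..R} (\<lambda>v. \<Phi>' (- v) * \<Gamma> (t + v)) - \<Phi> 0 * \<Gamma> t"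
    if t: "0 \<le> t" for t
  proof -
    have "((\<lambda>v. \<Phi> (- v) * \<Gamma>' (t + v) - \<Phi>' (- v) * \<Gamma> (t + v)) has_integral (\<Phi> (- R) * \<Gamma> (t + R) - \<Phi> (- 0) * \<Gamma> (t + 0))) {0..R}"
    proof (rule fundamental_theorem_of_calculus)
      fix v
      have a: "((\<lambda>v. - v) has_vector_derivative -1) (at v within {0..R})" "((\<lambda>v. t + v) has_vector_derivative 1) (at v within {0..R})"
        by (auto intro!: derivative_eq_intros)
      have "((\<lambda>v. \<Phi> (- v)) has_vector_derivative - \<Phi>' (- v)) (at v within {0..R})"
        "((\<lambda>v. \<Gamma> (t + v)) has_vector_derivative \<Gamma>' (t + v)) (at v within {0..R})"
        using vector_diff_chain_within[OF a(1) has_vector_derivative_at_within[OF 1(7)]]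
          vector_diff_chain_within[OF a(2) has_vector_derivative_at_within[OF 2(7)]] by (simp_all add: o_def)
      from has_vector_derivative_mult[OF this]
      show "((\<lambda>v. \<Phi> (- v) * \<Gamma> (t + v)) has_vector_derivative \<Phi> (- v) * \<Gamma>' (t + v) - \<Phi>' (- v) * \<Gamma> (t + v)) (at v within {0..R})"
        by simp
    qed (use R in simp)
    moreover have "\<Gamma> (t + R) = 0" using s(3) t by (simp add: supported_in_def)
    ultimately have "integral {0..R} (\<lambda>v. \<Phi> (- v) * \<Gamma>' (t + v) - \<Phi>' (- v) * \<Gamma> (t + v)) = - \<Phi> 0 * \<Gamma> t"
      by (simp add: integral_unique)
    moreover have "(\<lambda>v. F (- v) * F' (t + v)) integrable_on {0..R}" if "smooth F" "smooth F'" for F F'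
      by (intro integrable_continuous_real continuous_on_mult continuous_on_compose2[OF smooth_continuous[OF that(1), of UNIV]]
          continuous_on_compose2[OF smooth_continuous[OF that(2), of UNIV]] continuous_intros) auto
    ultimately show ?thesis using 1 2 by (simp add: Henstock_Kurzweil_Integration.integral_diff algebra_simps)
  qed
  show "deriv_plus (conv \<phi> \<gamma>) = (\<lambda>t. conv (deriv_plus \<phi>) \<gamma> t + \<phi> 0 * \<gamma> t)"
  proof
    fix t
    have "deriv_plus (conv \<phi> \<gamma>) t = restr (\<lambda>t. integral {-R..0} (\<lambda>u. \<Gamma> (- u) * \<Phi>' (t + u)) - integral {0..R} (\<lambda>v. \<Phi> (- v) * \<Gamma>' (t + v))) t"
      unfolding 1(1) 2(1) conv_restr[OF 1(2) s(1) 2(2) s(3)] by (subst deriv_plus_restr(1)[OF d]) auto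
    also have "\<dots> = restr (\<lambda>t. ?h \<Phi>' \<Gamma> t + \<Phi> 0 * \<Gamma> t) t"
      using parts by (auto simp: restr_def)
    also have "\<dots> = conv (deriv_plus \<phi>) \<gamma> t + \<phi> 0 * \<gamma> t"
    proof -
      have c: "conv (deriv_plus \<phi>) \<gamma> = restr (?h \<Phi>' \<Gamma>)"
        unfolding 1(4) unfolding 2(1) by (rule conv_restr[OF 1(5) s(2) 2(2) s(3)])
      show ?thesis unfolding c by (auto simp: restr_def 1(1) 2(1))
    qed
    finally show "deriv_plus (conv \<phi> \<gamma>) t = conv (deriv_plus \<phi>) \<gamma> t + \<phi> 0 * \<gamma> t" .
  qed
qed

lemma conv_vanishes:
  assumes "\<And>t. R \<le> t \<Longrightarrow> f t = 0" "\<And>t. R' \<le> t \<Longrightarrow> g t = 0" "R + R' \<le> t"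
  shows "conv f g t = 0"
proof -
  have "f (t - s) * g s = 0" for s
    using assms by (cases "R' \<le> s") auto
  then have "(\<lambda>s. f (t - s) * g s) = (\<lambda>_. 0)" by blast
  then show ?thesis by (simp only: conv_def integral_0)
qed

subsection \<open>Convolution products of dual convolutions\<close>

text \<open>\<open>cross_kernel k \<phi> R\<close> is \<open>\<phi> \<circ> k\<close> on \<open>[0, R]\<close> for \<open>\<phi>\<close> vanishing beyond \<open>R\<close>.\<close>

definition cross_kernel :: "(real \<Rightarrow> complex) \<Rightarrow> (real \<Rightarrow> complex) \<Rightarrow> real \<Rightarrow> real \<Rightarrow> complex" where
  "cross_kernel k \<phi> R v = integral {0..2 * R} (\<lambda>u. k u * (if v \<le> u then \<phi> (u - v) else 0))"

text \<open>The function (\<phi> \<circ> k) \<circ> \<psi>, provided that \<phi> and \<psi> vanish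
  beyond \<open>R\<close>.\<close>

definition cross_term :: "(real \<Rightarrow> complex) \<Rightarrow> (real \<Rightarrow> complex) \<Rightarrow> (real \<Rightarrow> complex) \<Rightarrow> real \<Rightarrow> real \<Rightarrow> complex" where
  "cross_term k \<phi> \<psi> R t = (if 0 \<le> t then integral {0..R} (\<lambda>v. cross_kernel k \<phi> R v * \<psi> (t + v)) else 0)"

lemma cross_kernel_measurable:
  assumes "\<phi> \<in> Dplus"
  shows "(\<lambda>(v, u). if v \<le> u then \<phi> (u - v) else 0) \<in> borel_measurable (borel \<Otimes>\<^sub>M borel)"
proof -
  have [measurable]: "\<phi> \<in> borel_measurable borel" by (rule Dplus_measurable[OF assms])
  show ?thesis by measurable
qed

lemma cross_kernel_absolutely_integrable:
  assumes k: "locally_integrable k" and \<phi>: "\<phi> \<in> Dplus"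
  shows "cross_kernel k \<phi> R absolutely_integrable_on {0..T}"
proof -
  obtain B where B: "0 \<le> B" "\<And>t. norm (\<phi> t) \<le> B" by (rule Dplus_bounded[OF \<phi>]) blast
  have "(\<lambda>v. 1 * integral {0..2 * R} (\<lambda>u. k u * (if v \<le> u then \<phi> (u - v) else 0))) absolutely_integrable_on {0..T}"
    by (rule fubini_kernel(1)[where M = B, OF _ locally_integrableD[OF k]])
      (use B cross_kernel_measurable[OF \<phi>] in \<open>auto intro!: absolutely_integrable_continuous_real\<close>)
  then show ?thesis by (simp add: cross_kernel_def[abs_def])
qed

lemma cross_term_Dplus:
  assumes k: "locally_integrable k" and \<phi>: "\<phi> \<in> Dplus" and \<psi>: "\<psi> \<in> Dplus"
  shows "cross_term k \<phi> \<psi> R \<in> Dplus"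
proof -
  obtain \<Psi> R' where *: "\<psi> = restr \<Psi>" "smooth \<Psi>" "supported_in R' \<Psi>" by (rule DplusE[OF \<psi>]) blast
  have "cross_term k \<phi> \<psi> R t = restr (\<lambda>t. integral {0..R} (\<lambda>v. cross_kernel k \<phi> R v * \<Psi> (t + v))) t" for t
    by (auto simp: cross_term_def restr_def * intro!: integral_cong)
  moreover have "restr (\<lambda>t. integral {0..R} (\<lambda>v. cross_kernel k \<phi> R v * \<Psi> (t + v))) \<in> Dplus"
    by (rule DplusI[OF translation_average_smooth[OF cross_kernel_absolutely_integrable[OF k \<phi>] *(2,3)]])
  ultimately show ?thesis by presburger
qed

lemma cross_term_vanishes:
  assumes "\<And>t. R \<le> t \<Longrightarrow> \<psi> t = 0" "R \<le> t" "0 \<le> R"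
  shows "cross_term k \<phi> \<psi> R t = 0"
proof -
  have "integral {0..R} (\<lambda>v. cross_kernel k \<phi> R v * \<psi> (t + v)) = integral {0..R} (\<lambda>v. 0)"
    by (intro integral_cong) (use assms in auto)
  then show ?thesis by (simp add: cross_term_def)
qed

text \<open>With g = k \<circ> \<psi>, the integral of g s \<phi> (t + u - s) over [0, t] is
  \<open>conv \<phi> g (t + u)\<close> minus the piece over [t, t + u]. Integration against
  \<open>k\<close> makes the first part k \<circ> (\<phi> * g). In the second, inserting g = k
  \<circ> \<psi> and exchanging the integrals brings \<open>k\<close> outside again.\<close>

lemma conv_dual_conv:
  assumes k: "locally_integrable k" and \<phi>: "\<phi> \<in> Dplus" and \<psi>: "\<psi> \<in> Dplus" and R: "0 < R"
    and z: "\<And>t. R \<le> t \<Longrightarrow> \<phi> t = 0" "\<And>t. R \<le> t \<Longrightarrow> \<psi> t = 0"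
  shows "conv (dual_conv k \<phi>) (dual_conv k \<psi>) =
    dual_conv k (\<lambda>t. conv \<phi> (dual_conv k \<psi>) t - cross_term k \<phi> \<psi> R t)"
proof
  fix t
  define g where "g = dual_conv k \<psi>"
  have g: "g \<in> Dplus" unfolding g_def by (rule dual_conv_Dplus(1)[OF k \<psi>])
  have gz: "g s = 0" if "R \<le> s" for s unfolding g_def by (rule dual_conv_vanishes[OF z(2)]) (use that R in auto)
  have [measurable]: "\<phi> \<in> borel_measurable borel" "\<psi> \<in> borel_measurable borel" "g \<in> borel_measurable borel"
    using Dplus_measurable \<phi> \<psi> g by blast+
  obtain B where B: "0 \<le> B" "\<And>t. norm (\<phi> t) \<le> B" by (rule Dplus_bounded[OF \<phi>]) blast
  obtain C where C: "0 \<le> C" "\<And>t. norm (\<psi> t) \<le> C" by (rule Dplus_bounded[OF \<psi>]) blast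
  have ki: "k absolutely_integrable_on {0..q}" for q by (rule locally_integrableD[OF k]) simp
  let ?c = "\<lambda>v u. if v \<le> u then \<phi> (u - v) else 0"
  have cg: "conv \<phi> g \<in> Dplus" by (rule conv_Dplus(1)[OF \<phi> g])
  show "conv (dual_conv k \<phi>) (dual_conv k \<psi>) t = dual_conv k (\<lambda>t. conv \<phi> (dual_conv k \<psi>) t - cross_term k \<phi> \<psi> R t) t"
  proof (cases "0 \<le> t")
    case True
    have gi: "(\<lambda>v. g (t + v)) absolutely_integrable_on {0..q}" for q
      by (intro absolutely_integrable_continuous_real continuous_on_compose2[OF Dplus_continuous[OF g]] continuous_intros)
        (use True in auto)
    have "conv (dual_conv k \<phi>) g t = integral {0..t} (\<lambda>s. g s * integral {0..2 * R} (\<lambda>u. k u * \<phi> (t - s + u)))"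
      unfolding conv_def
      by (intro integral_cong) (use z R True dual_conv_eq[where a = k and \<phi> = \<phi> and R = R and T = "2 * R"] in auto)
    also have "\<dots> = integral {0..2 * R} (\<lambda>u. k u * integral {0..t} (\<lambda>s. g s * \<phi> (t - s + u)))"
      by (rule fubini_kernel(2)[OF Dplus_absolutely_integrable[OF g] ki, where M = B]) (use B in auto)
    also have "\<dots> = integral {0..2 * R} (\<lambda>u. k u * conv \<phi> g (t + u) - k u * integral {0..R} (\<lambda>v. g (t + v) * ?c v u))"
    proof (rule integral_cong)
      fix u assume u: "u \<in> {0..2 * R}"
      have i: "(\<lambda>s. g s * \<phi> (t + u - s)) integrable_on {0..t + u}"
        by (intro set_lebesgue_integral_eq_integral(1) absolutely_integrable_mult_bounded[OF Dplus_absolutely_integrable[OF g], where M = B])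
          (use B in auto)
      have "conv \<phi> g (t + u) = integral {0..t + u} (\<lambda>s. g s * \<phi> (t + u - s))"
        by (simp add: conv_def mult.commute)
      also have "\<dots> = integral {0..t} (\<lambda>s. g s * \<phi> (t + u - s)) + integral {t..t + u} (\<lambda>s. g s * \<phi> (t + u - s))"
        using Henstock_Kurzweil_Integration.integral_combine[OF _ _ i, of t] True u by simp
      also have "integral {t..t + u} (\<lambda>s. g s * \<phi> (t + u - s)) = integral {0..u} (\<lambda>v. g (t + v) * \<phi> (u - v))"
        using integral_shift_real_ivl[where a = t and b = "t + u" and c = t and f = "\<lambda>s. g s * \<phi> (t + u - s)"]
        by (simp add: algebra_simps)
      also have "\<dots> = integral {0..R + u} (\<lambda>v. g (t + v) * ?c v u)"
      proof -
        have "integral {0..R + u} (\<lambda>v. g (t + v) * ?c v u) = integral {0..R + u} (\<lambda>v. if v \<in> {0..u} then g (t + v) * \<phi> (u - v) else 0)"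
          by (intro integral_cong) auto
        also have "\<dots> = integral {0..u} (\<lambda>v. g (t + v) * \<phi> (u - v))"
          by (rule integral_if_subset) (use R in auto)
        finally show ?thesis by simp
      qed
      also have "\<dots> = integral {0..R} (\<lambda>v. g (t + v) * ?c v u)"
        by (rule integral_extend_zero) (use R u gz True in auto)
      finally have "integral {0..t} (\<lambda>s. g s * \<phi> (t - s + u)) = conv \<phi> g (t + u) - integral {0..R} (\<lambda>v. g (t + v) * ?c v u)"
        by (simp add: algebra_simps)
      then show "k u * integral {0..t} (\<lambda>s. g s * \<phi> (t - s + u)) = k u * conv \<phi> g (t + u) - k u * integral {0..R} (\<lambda>v. g (t + v) * ?c v u)"
        by (simp only: right_diff_distrib)
    qed
    also have "\<dots> = integral {0..2 * R} (\<lambda>u. k u * conv \<phi> g (t + u)) - integral {0..2 * R} (\<lambda>u. k u * integral {0..R} (\<lambda>v. g (t + v) * ?c v u))"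
    proof (intro Henstock_Kurzweil_Integration.integral_diff set_lebesgue_integral_eq_integral(1) dual_conv_integrand[OF ki cg True])
      show "(\<lambda>u. k u * integral {0..R} (\<lambda>v. g (t + v) * ?c v u)) absolutely_integrable_on {0..2 * R}"
        by (rule fubini_kernel(1)[OF ki gi, where M = B]) (use B in auto)
    qed
    also have "integral {0..2 * R} (\<lambda>u. k u * conv \<phi> g (t + u)) = dual_conv k (conv \<phi> g) t"
      by (rule dual_conv_eq[where R = "2 * R", symmetric]) (use True conv_vanishes[of R \<phi> R g] z gz in auto)
    also have "integral {0..2 * R} (\<lambda>u. k u * integral {0..R} (\<lambda>v. g (t + v) * ?c v u)) =
      integral {0..R} (\<lambda>v. g (t + v) * cross_kernel k \<phi> R v)"
      unfolding cross_kernel_def by (rule fubini_kernel(2)[OF ki gi, where M = B]) (use B in auto)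
    also have "\<dots> = integral {0..R} (\<lambda>v. cross_kernel k \<phi> R v * integral {0..R} (\<lambda>w. k w * \<psi> (t + v + w)))"
      by (intro integral_cong) (use z R True dual_conv_eq[where a = k and \<phi> = \<psi> and R = R and T = R] in \<open>auto simp: g_def\<close>)
    also have "\<dots> = integral {0..R} (\<lambda>w. k w * integral {0..R} (\<lambda>v. cross_kernel k \<phi> R v * \<psi> (t + v + w)))"
      by (rule fubini_kernel(2)[OF cross_kernel_absolutely_integrable[OF k \<phi>] ki, where M = C]) (use C in auto)
    also have "\<dots> = integral {0..R} (\<lambda>w. k w * cross_term k \<phi> \<psi> R (t + w))"
      by (intro integral_cong) (use True in \<open>auto simp: cross_term_def algebra_simps\<close>)
    also have "\<dots> = dual_conv k (cross_term k \<phi> \<psi> R) t"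
      by (rule dual_conv_eq[where R = R, symmetric]) (use True cross_term_vanishes[OF z(2)] R in auto)
    finally show ?thesis
      using dual_conv_diff[OF k cg cross_term_Dplus[OF k \<phi> \<psi>]] by (simp add: g_def)
  qed (simp add: conv_eq_0_nonpos dual_conv_def)
qed

section \<open>Convolution powers and the spaces of test functions\<close>

lemma conv_pow_1: "conv_pow k (Suc 0) = k"
  by (simp add: conv_pow_def)

lemma conv_pow_Suc: "1 \<le> n \<Longrightarrow> conv_pow k (Suc n) = conv k (conv_pow k n)"
  by (cases n) (auto simp: conv_pow_def)

lemma Dplus_supp:
  assumes f: "f \<in> Dplus" and r: "0 < r"
  shows "supp f \<subseteq> {0..r} \<longleftrightarrow> (\<forall>t\<ge>r. f t = 0)"
proof
  assume s: "supp f \<subseteq> {0..r}"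
  have gt: "f t = 0" if "r < t" for t
    using s closure_subset[of "{t. f t \<noteq> 0}"] that by (force simp: supp_def)
  have "continuous_on {r..} f"
    by (rule continuous_on_subset[OF Dplus_continuous[OF f]]) (use r in auto)
  then show "\<forall>t\<ge>r. f t = 0"
    using continuous_constant_on_closure[of "{r<..}" f 0] gt by auto
next
  assume z: "\<forall>t\<ge>r. f t = 0"
  have "{t. f t \<noteq> 0} \<subseteq> {0..r}"
  proof
    fix t assume "t \<in> {t. f t \<noteq> 0}"
    then show "t \<in> {0..r}" using z Dplus_neg[OF f, of t] by (cases "t < 0"; cases "r \<le> t") auto
  qed
  then show "supp f \<subseteq> {0..r}" unfolding supp_def by (rule closure_minimal) simp
qed

lemma Dplus_ext: "\<phi> \<in> Dplus \<Longrightarrow> \<psi> \<in> Dplus \<Longrightarrow> (\<And>t. 0 \<le> t \<Longrightarrow> \<phi> t = \<psi> t) \<Longrightarrow> \<phi> = \<psi>"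
  by (rule ext) (metis Dplus_neg not_le)

locale kernel =
  fixes k :: "real \<Rightarrow> complex"
  assumes k_int: "locally_integrable k" and k_supp: "zero_in_supp k"
begin

abbreviation kn :: "nat \<Rightarrow> real \<Rightarrow> complex" where "kn \<equiv> conv_pow k"

lemma kn_int: "1 \<le> n \<Longrightarrow> locally_integrable (kn n)"
  by (induction n rule: dec_induct)
    (simp_all add: conv_pow_1 conv_pow_Suc k_int locally_integrable_conv)

lemma dual_conv_kn_Suc:
  "1 \<le> n \<Longrightarrow> \<phi> \<in> Dplus \<Longrightarrow> dual_conv (kn (Suc n)) \<phi> = dual_conv (kn n) (dual_conv k \<phi>)"
  by (simp add: conv_pow_Suc dual_conv_conv k_int kn_int)

text \<open>Induction peels off one factor \<open>k\<close> at a time, so the support condition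
  enters through \<open>k\<close> itself.\<close>

lemma dual_conv_kn_zero_imp_zero:
  assumes "1 \<le> n" "\<phi> \<in> Dplus" "0 \<le> r" "\<And>t. r \<le> t \<Longrightarrow> dual_conv (kn n) \<phi> t = 0" "r \<le> t"
  shows "\<phi> t = 0"
  using assms
proof (induction n arbitrary: \<phi> t rule: dec_induct)
  case base
  then show ?case using dual_conv_zero_imp_zero[OF k_int k_supp, of \<phi> r t] by (simp add: conv_pow_1)
next
  case (step n)
  have "dual_conv k \<phi> s = 0" if "r \<le> s" for s
    using step.IH[OF dual_conv_Dplus(1)[OF k_int step.prems(1)] \<open>0 \<le> r\<close> _ that] step.prems step.hyps
    by (simp add: dual_conv_kn_Suc)
  then show ?case using dual_conv_zero_imp_zero[OF k_int k_supp] step.prems by blast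
qed

lemma inj_on_dual_conv_kn: "1 \<le> n \<Longrightarrow> inj_on (dual_conv (kn n)) Dplus"
proof (rule inj_onI)
  fix \<phi> \<psi> assume n: "1 \<le> n" and *: "\<phi> \<in> Dplus" "\<psi> \<in> Dplus" "dual_conv (kn n) \<phi> = dual_conv (kn n) \<psi>"
  have "\<phi> t - \<psi> t = 0" if "0 \<le> t" for t
    by (rule dual_conv_kn_zero_imp_zero[OF n Dplus_diff[OF *(1,2)] order_refl _ that])
      (simp add: dual_conv_diff[OF kn_int[OF n] *(1,2)] *(3))
  then show "\<phi> = \<psi>" by (intro Dplus_ext *(1,2)) simp
qed

lemma W_dual_conv: "1 \<le> n \<Longrightarrow> \<phi> \<in> Dplus \<Longrightarrow> W (kn n) (dual_conv (kn n) \<phi>) = \<phi>"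
  unfolding W_def by (rule the_inv_into_f_f[OF inj_on_dual_conv_kn])

lemma D_infD:
  assumes "f \<in> D_inf k" "1 \<le> n"
  shows "W (kn n) f \<in> Dplus" "dual_conv (kn n) (W (kn n) f) = f"
proof -
  obtain \<phi> where "\<phi> \<in> Dplus" "f = dual_conv (kn n) \<phi>" using assms by (auto simp: D_inf_def D_of_def)
  then show "W (kn n) f \<in> Dplus" "dual_conv (kn n) (W (kn n) f) = f"
    using W_dual_conv[OF assms(2)] by auto
qed

lemma D_infI: "(\<And>n. 1 \<le> n \<Longrightarrow> \<exists>\<phi>\<in>Dplus. f = dual_conv (kn n) \<phi>) \<Longrightarrow> f \<in> D_inf k"
  by (auto simp: D_inf_def D_of_def)

lemma W_eqI: "1 \<le> n \<Longrightarrow> \<phi> \<in> Dplus \<Longrightarrow> dual_conv (kn n) \<phi> = f \<Longrightarrow> W (kn n) f = \<phi>"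
  using W_dual_conv by blast

lemma D_inf_Dplus: "f \<in> D_inf k \<Longrightarrow> f \<in> Dplus"
  using D_infD[of f 1] dual_conv_Dplus(1)[OF kn_int[of 1]] by force

lemma D_inf_add:
  assumes f: "f \<in> D_inf k" and g: "g \<in> D_inf k"
  shows "(\<lambda>t. f t + g t) \<in> D_inf k"
    and "1 \<le> n \<Longrightarrow> W (kn n) (\<lambda>t. f t + g t) = (\<lambda>t. W (kn n) f t + W (kn n) g t)"
proof -
  have *: "(\<lambda>t. W (kn n) f t + W (kn n) g t) \<in> Dplus"
    "dual_conv (kn n) (\<lambda>t. W (kn n) f t + W (kn n) g t) = (\<lambda>t. f t + g t)" if "1 \<le> n" for n
    using that D_infD f g by (simp_all add: Dplus_add dual_conv_add kn_int)
  then show "(\<lambda>t. f t + g t) \<in> D_inf k" by (intro D_infI) metis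
  show "1 \<le> n \<Longrightarrow> W (kn n) (\<lambda>t. f t + g t) = (\<lambda>t. W (kn n) f t + W (kn n) g t)"
    by (intro W_eqI *)
qed

lemma D_inf_cmult:
  assumes f: "f \<in> D_inf k"
  shows "(\<lambda>t. c * f t) \<in> D_inf k"
    and "1 \<le> n \<Longrightarrow> W (kn n) (\<lambda>t. c * f t) = (\<lambda>t. c * W (kn n) f t)"
proof -
  have *: "(\<lambda>t. c * W (kn n) f t) \<in> Dplus"
    "dual_conv (kn n) (\<lambda>t. c * W (kn n) f t) = (\<lambda>t. c * f t)" if "1 \<le> n" for n
    using that D_infD f by (simp_all add: Dplus_cmult dual_conv_cmult)
  then show "(\<lambda>t. c * f t) \<in> D_inf k" by (intro D_infI) metis
  show "1 \<le> n \<Longrightarrow> W (kn n) (\<lambda>t. c * f t) = (\<lambda>t. c * W (kn n) f t)"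
    by (intro W_eqI *)
qed

lemma W_kn_Suc:
  assumes f: "f \<in> D_inf k" and n: "1 \<le> n"
  shows "W (kn n) f = dual_conv k (W (kn (Suc n)) f)"
  using D_infD[OF f, of "Suc n"] n
  by (intro W_eqI) (simp_all add: dual_conv_Dplus k_int dual_conv_kn_Suc[symmetric])

lemma W_vanishes:
  assumes f: "f \<in> D_inf k" and n: "1 \<le> n" and r: "0 \<le> r" "\<And>t. r \<le> t \<Longrightarrow> f t = 0" "r \<le> t"
  shows "W (kn n) f t = 0"
  by (rule dual_conv_kn_zero_imp_zero[OF n _ r(1) _ r(3)]) (use D_infD[OF f n] r(2) in auto)

lemma D_inf_deriv:
  assumes f: "f \<in> D_inf k"
  shows "deriv_plus f \<in> D_inf k"
    and "1 \<le> n \<Longrightarrow> W (kn n) (deriv_plus f) = deriv_plus (W (kn n) f)"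
proof -
  have *: "deriv_plus (W (kn n) f) \<in> Dplus"
    "dual_conv (kn n) (deriv_plus (W (kn n) f)) = deriv_plus f" if "1 \<le> n" for n
    using D_infD[OF f that] dual_conv_Dplus(2)[OF kn_int[OF that]] by (auto simp: Dplus_deriv) metis
  then show "deriv_plus f \<in> D_inf k" by (intro D_infI) metis
  show "1 \<le> n \<Longrightarrow> W (kn n) (deriv_plus f) = deriv_plus (W (kn n) f)" by (intro W_eqI *)
qed

lemma D_inf_shift:
  assumes f: "f \<in> D_inf k" and s: "0 \<le> s"
  shows "shift s f \<in> D_inf k"
    and "1 \<le> n \<Longrightarrow> W (kn n) (shift s f) = shift s (W (kn n) f)"
proof -
  have *: "shift s (W (kn n) f) \<in> Dplus"
    "dual_conv (kn n) (shift s (W (kn n) f)) = shift s f" if "1 \<le> n" for n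
    using D_infD[OF f that] dual_conv_shift[OF _ s] s by (simp_all add: Dplus_shift)
  then show "shift s f \<in> D_inf k" by (intro D_infI) metis
  show "1 \<le> n \<Longrightarrow> W (kn n) (shift s f) = shift s (W (kn n) f)" by (intro W_eqI *)
qed

text \<open>The product formula for the kernel \<open>kn n\<close>; \<open>R\<close> also bounds the
  supports of the preimages because \<open>W\<close> does not enlarge supports. Its explicit form is
  what later bounds \<open>W\<close> of a convolution.\<close>

lemma D_inf_conv:
  assumes f: "f \<in> D_inf k" and g: "g \<in> D_inf k"
  shows "conv f g \<in> D_inf k"
    and "1 \<le> n \<Longrightarrow> 0 < R \<Longrightarrow> (\<And>t. R \<le> t \<Longrightarrow> f t = 0) \<Longrightarrow> (\<And>t. R \<le> t \<Longrightarrow> g t = 0) \<Longrightarrow>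
      W (kn n) (conv f g) = (\<lambda>t. conv (W (kn n) f) g t - cross_term (kn n) (W (kn n) f) (W (kn n) g) R t)"
proof -
  have *: "(\<lambda>t. conv (W (kn n) f) g t - cross_term (kn n) (W (kn n) f) (W (kn n) g) R t) \<in> Dplus"
    "dual_conv (kn n) (\<lambda>t. conv (W (kn n) f) g t - cross_term (kn n) (W (kn n) f) (W (kn n) g) R t) = conv f g"
    if "1 \<le> n" "0 < R" "\<And>t. R \<le> t \<Longrightarrow> f t = 0" "\<And>t. R \<le> t \<Longrightarrow> g t = 0" for n R
  proof -
    note W = D_infD[OF f that(1)] D_infD[OF g that(1)]
    have v: "W (kn n) f t = 0" "W (kn n) g t = 0" if "R \<le> t" for t
      using W_vanishes[OF f \<open>1 \<le> n\<close>, of R t] W_vanishes[OF g \<open>1 \<le> n\<close>, of R t] \<open>0 < R\<close>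
        \<open>\<And>t. R \<le> t \<Longrightarrow> f t = 0\<close> \<open>\<And>t. R \<le> t \<Longrightarrow> g t = 0\<close> that by auto
    show "(\<lambda>t. conv (W (kn n) f) g t - cross_term (kn n) (W (kn n) f) (W (kn n) g) R t) \<in> Dplus"
      by (intro Dplus_diff conv_Dplus cross_term_Dplus kn_int that W D_inf_Dplus g)
    have "conv f g = conv (dual_conv (kn n) (W (kn n) f)) (dual_conv (kn n) (W (kn n) g))" using W by simp
    also have "\<dots> = dual_conv (kn n) (\<lambda>t. conv (W (kn n) f) g t - cross_term (kn n) (W (kn n) f) (W (kn n) g) R t)"
      by (subst conv_dual_conv[OF kn_int[OF that(1)] W(1,3) that(2)])
        (use v W in auto)
    finally show "dual_conv (kn n) (\<lambda>t. conv (W (kn n) f) g t - cross_term (kn n) (W (kn n) f) (W (kn n) g) R t) = conv f g" ..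
  qed
  show "conv f g \<in> D_inf k"
  proof (rule D_infI)
    fix n :: nat assume n: "1 \<le> n"
    obtain R where "0 < R" "\<And>t. R \<le> t \<Longrightarrow> f t = 0" "\<And>t. R \<le> t \<Longrightarrow> g t = 0"
      by (rule Dplus_vanishes2[OF f[THEN D_inf_Dplus] g[THEN D_inf_Dplus]]) blast
    from *[OF n this] show "\<exists>\<phi>\<in>Dplus. conv f g = dual_conv (kn n) \<phi>" by metis
  qed
  show "1 \<le> n \<Longrightarrow> 0 < R \<Longrightarrow> (\<And>t. R \<le> t \<Longrightarrow> f t = 0) \<Longrightarrow> (\<And>t. R \<le> t \<Longrightarrow> g t = 0) \<Longrightarrow>
      W (kn n) (conv f g) = (\<lambda>t. conv (W (kn n) f) g t - cross_term (kn n) (W (kn n) f) (W (kn n) g) R t)"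
    by (intro W_eqI *)
qed

section \<open>Admissible levels\<close>

lemma admissible_iff:
  assumes "f \<in> D_inf k" "0 < \<tau>"
  shows "admissible \<tau> f n \<longleftrightarrow> 1 \<le> n \<and> (\<forall>t\<ge>real n * \<tau>. f t = 0)"
  using Dplus_supp[OF D_inf_Dplus[OF assms(1)], of "real n * \<tau>"] assms(2)
  unfolding admissible_def by (cases "1 \<le> n") simp_all

lemma admissible_ex:
  assumes "f \<in> D_inf k" "0 < \<tau>"
  shows "\<exists>n. admissible \<tau> f n"
proof -
  obtain R where R: "0 < R" "\<And>t. R \<le> t \<Longrightarrow> f t = 0" by (rule Dplus_vanishes[OF D_inf_Dplus[OF assms(1)]]) blast
  obtain n :: nat where "R < real n * \<tau>" using reals_Archimedean3[OF assms(2)] by blast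
  moreover from this R assms(2) have "1 \<le> n" by (cases n) auto
  ultimately show ?thesis using R by (intro exI[of _ n]) (simp add: admissible_iff[OF assms])
qed

lemma admissible_mono:
  assumes "f \<in> D_inf k" "0 < \<tau>" "admissible \<tau> f n" "n \<le> m"
  shows "admissible \<tau> f m"
proof -
  have "real n * \<tau> \<le> real m * \<tau>" using assms by simp
  then show ?thesis using assms(3,4) unfolding admissible_iff[OF assms(1,2)] by (meson order_trans)
qed

end

section \<open>Extension of local convoluted semigroups\<close>

lemma bounded_clinearD:
  assumes "bounded_clinear T"
  shows "bounded_linear T" "T (c *\<^sub>C x) = c *\<^sub>C T x" "T (x + y) = T x + T y" "T (x - y) = T x - T y" "T 0 = 0"
  using assms by (auto simp: bounded_clinear_def linear_add linear_diff linear_0 bounded_linear.linear)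

lemma bounded_clinear_add: "bounded_clinear S \<Longrightarrow> bounded_clinear T \<Longrightarrow> bounded_clinear (\<lambda>x. S x + T x)"
  by (auto simp: bounded_clinear_def scaleC_add_right bounded_linear_add)

lemma bounded_clinear_compose: "bounded_clinear S \<Longrightarrow> bounded_clinear T \<Longrightarrow> bounded_clinear (\<lambda>x. S (T x))"
  by (auto simp: bounded_clinear_def bounded_linear_compose)

lemma strongly_continuous_bound:
  fixes T :: "real \<Rightarrow> 'a::complex_banach \<Rightarrow> 'a"
  assumes T: "\<And>s. s \<in> {p..q} \<Longrightarrow> bounded_clinear (T s)" and c: "\<And>x. continuous_on {p..q} (\<lambda>s. T s x)"
  obtains M where "0 \<le> M" "\<And>s x. s \<in> {p..q} \<Longrightarrow> norm (T s x) \<le> M * norm x"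
proof (rule uniform_boundedness[of "{p..q}" T])
  show "bounded_linear (T s)" if "s \<in> {p..q}" for s using T[OF that] by (rule bounded_clinearD)
  show "\<exists>B. \<forall>s\<in>{p..q}. norm (T s x) \<le> B" for x
    by (rule continuous_on_Icc_bound[OF c[of x]]) blast
qed (use that in blast)

lemma strong_integral_bounded_clinear:
  fixes T :: "real \<Rightarrow> 'a::complex_banach \<Rightarrow> 'a"
  assumes a: "a absolutely_integrable_on {p..q}"
    and T: "\<And>s. s \<in> {p..q} \<Longrightarrow> bounded_clinear (T s)" and c: "\<And>x. continuous_on {p..q} (\<lambda>s. T s x)"
  shows "bounded_clinear (\<lambda>x. integral {p..q} (\<lambda>s. a s *\<^sub>C T s x))"
proof -
  obtain M where M: "0 \<le> M" "\<And>s x. s \<in> {p..q} \<Longrightarrow> norm (T s x) \<le> M * norm x"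
    using strongly_continuous_bound[of p q T, OF T c] by metis
  note i = scaleC_integrable[OF a c]
  have cl: "integral {p..q} (\<lambda>s. a s *\<^sub>C T s (e *\<^sub>C x)) = e *\<^sub>C integral {p..q} (\<lambda>s. a s *\<^sub>C T s x)" for e x
  proof -
    have "integral {p..q} (\<lambda>s. a s *\<^sub>C T s (e *\<^sub>C x)) = integral {p..q} (\<lambda>s. e *\<^sub>C (a s *\<^sub>C T s x))"
      by (intro integral_cong) (simp add: bounded_clinearD(2)[OF T] scaleC_scaleC mult.commute)
    also have "\<dots> = e *\<^sub>C integral {p..q} (\<lambda>s. a s *\<^sub>C T s x)"
      using integral_linear[OF i scaleC.bounded_linear_right] by (simp add: o_def)
    finally show ?thesis .
  qed
  have "bounded_linear (\<lambda>x. integral {p..q} (\<lambda>s. a s *\<^sub>C T s x))"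
  proof (rule bounded_linear_intro)
    show "integral {p..q} (\<lambda>s. a s *\<^sub>C T s (x + y)) = integral {p..q} (\<lambda>s. a s *\<^sub>C T s x) + integral {p..q} (\<lambda>s. a s *\<^sub>C T s y)" for x y
    proof -
      have "integral {p..q} (\<lambda>s. a s *\<^sub>C T s (x + y)) = integral {p..q} (\<lambda>s. a s *\<^sub>C T s x + a s *\<^sub>C T s y)"
        by (intro integral_cong) (simp add: bounded_clinearD(3)[OF T] scaleC_add_right)
      then show ?thesis by (simp add: Henstock_Kurzweil_Integration.integral_add i)
    qed
    show "integral {p..q} (\<lambda>s. a s *\<^sub>C T s (r *\<^sub>R x)) = r *\<^sub>R integral {p..q} (\<lambda>s. a s *\<^sub>C T s x)" for r x
      using cl[of "complex_of_real r" x] by (simp add: scaleC_of_real)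
    show "norm (integral {p..q} (\<lambda>s. a s *\<^sub>C T s x)) \<le> norm x * (M * integral {p..q} (\<lambda>s. norm (a s)))" for x
      using norm_integral_scaleC_le[OF a c[of x] M(2)[of _ x]] by (simp add: mult_ac)
  qed
  then show ?thesis using cl by (simp add: bounded_clinear_def)
qed

lemma closed_operatorD:
  assumes "closed_operator D A"
  shows "0 \<in> D" "x \<in> D \<Longrightarrow> y \<in> D \<Longrightarrow> x + y \<in> D" "x \<in> D \<Longrightarrow> y \<in> D \<Longrightarrow> A (x + y) = A x + A y"
    "x \<in> D \<Longrightarrow> c *\<^sub>C x \<in> D" "x \<in> D \<Longrightarrow> A (c *\<^sub>C x) = c *\<^sub>C A x"
    "A 0 = 0"
proof -
  show "A 0 = 0" using assms unfolding closed_operator_def by (metis add_cancel_right_left)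
qed (use assms in \<open>auto simp: closed_operator_def\<close>)

lemma closed_operator_minus:
  assumes "closed_operator D A" "x \<in> D"
  shows "- x \<in> D" "A (- x) = - A x"
  using closed_operatorD(4,5)[OF assms, of "-1"] scaleC_of_real[of "-1" x] scaleC_of_real[of "-1" "A x"] by simp_all

lemma closed_operator_diff:
  assumes "closed_operator D A" "x \<in> D" "y \<in> D"
  shows "x - y \<in> D" "A (x - y) = A x - A y"
  using closed_operatorD(2,3)[OF assms(1,2), of "- y"] closed_operator_minus[OF assms(1,3)] by simp_all

lemma closed_operator_weighted_integral:
  fixes v w :: "real \<Rightarrow> 'a::complex_banach"
  assumes A: "closed_operator D A" and a: "a absolutely_integrable_on {p..q}"
    and v: "continuous_on {p..q} v" and w: "continuous_on {p..q} w"
    and gr: "\<And>s. s \<in> {p..q} \<Longrightarrow> v s \<in> D \<and> A (v s) = w s"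
  shows "integral {p..q} (\<lambda>s. a s *\<^sub>C v s) \<in> D"
    "A (integral {p..q} (\<lambda>s. a s *\<^sub>C v s)) = integral {p..q} (\<lambda>s. a s *\<^sub>C w s)"
  using closed_operator_integral[OF A scaleC_integrable[OF a v] scaleC_integrable[OF a w]]
    closed_operatorD(4,5)[OF A] gr by auto

text \<open>\<open>conv_kernel\<close> with the constant function 1. Although
  \<open>conv a b\<close> is determined only almost everywhere, the resulting identity holds at the
  given endpoint exactly.\<close>

lemma integral_conv:
  fixes a b :: "real \<Rightarrow> complex"
  assumes a: "a absolutely_integrable_on {0..t}" and b: "b absolutely_integrable_on {0..t}"
  shows "integral {0..t} (conv a b) = conv a (\<lambda>s. integral {0..s} b) t"
proof -
  have "integral {0..t} (conv a b) = integral {0..t} (\<lambda>s. conv b a s * 1)" by (subst conv_commute_ext) simp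
  also have "\<dots> = integral {0..t} (\<lambda>u. a u * integral {0..t} (\<lambda>v. b v * (if u + v \<le> t then 1 else 0)))"
    by (rule conv_kernel(2)[OF b a, where M = 1]) auto
  also have "\<dots> = integral {0..t} (\<lambda>u. a u * integral {0..t - u} b)"
  proof (rule integral_cong)
    fix u assume u: "u \<in> {0..t}"
    have "integral {0..t} (\<lambda>v. b v * (if u + v \<le> t then 1 else 0)) = integral {0..t} (\<lambda>v. b v * (if v \<le> t - u then 1 else 0))"
      by (intro integral_cong) auto
    then show "a u * integral {0..t} (\<lambda>v. b v * (if u + v \<le> t then 1 else 0)) = a u * integral {0..t - u} b"
      using u by (simp add: integral_upto)
  qed
  also have "\<dots> = conv (\<lambda>s. integral {0..s} b) a t"
    by (simp add: conv_def mult.commute)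
  finally show ?thesis by (simp add: conv_commute)
qed

text \<open>Vector version of \<open>integral_conv\<close>, tested by functionals. The minimum with
  \<open>L\<close> stands for extending \<open>u\<close> by 0 beyond \<open>L\<close>, as done with
  \<open>y\<close>.\<close>

lemma integral_conv_vector:
  fixes u :: "real \<Rightarrow> 'a::complex_banach"
  assumes a: "a absolutely_integrable_on {0..t}" and u: "continuous_on {0..L} u" and L: "0 \<le> L" and t: "0 \<le> t"
  shows "integral {0..t} (\<lambda>s. integral {0..min s L} (\<lambda>v. a (s - v) *\<^sub>C u v)) =
    integral {0..t} (\<lambda>s. a (t - s) *\<^sub>C integral {0..min s L} u)"
proof (rule eq_by_functionals)
  fix F :: "'a \<Rightarrow> complex" assume F: "bounded_linear F" "\<And>c y. F (c *\<^sub>C y) = c * F y"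
  define y where "y v = (if v \<le> L then F (u v) else 0)" for v
  have Fu: "continuous_on {0..L} (\<lambda>v. F (u v))" by (rule bounded_linear.continuous_on[OF F(1) u])
  have uI: "u integrable_on {0..min s L}" for s
    by (rule integrable_continuous_real) (rule continuous_on_subset[OF u], auto)
  have ybI: "y absolutely_integrable_on {0..t}"
  proof -
    have "(\<lambda>v. F (u v)) absolutely_integrable_on {0..L}" by (rule absolutely_integrable_continuous_real[OF Fu])
    then have "(\<lambda>v. F (u v)) absolutely_integrable_on {0..min t L}"
      by (rule absolutely_integrable_subinterval_Icc) (use t in auto)
    then have "(\<lambda>v. if v \<in> {0..min t L} then F (u v) else 0) absolutely_integrable_on UNIV"
      by (simp only: absolutely_integrable_restrict_UNIV)
    then have "(\<lambda>v. if v \<in> {0..min t L} then F (u v) else 0) absolutely_integrable_on {0..t}"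
      by (rule set_integrable_subset) auto
    then show ?thesis
      by (rule absolutely_integrable_spike[OF _ negligible_empty]) (auto simp: y_def)
  qed
  have Fint: "integral {0..s} y = F (integral {0..min s L} u)" if s: "s \<in> {0..t}" for s
  proof -
    have "integral {0..s} y = integral {0..s} (\<lambda>v. if v \<in> {0..min s L} then F (u v) else 0)"
      by (intro integral_cong) (auto simp: y_def)
    also have "\<dots> = integral {0..min s L} (\<lambda>v. F (u v))" by (rule integral_if_subset) auto
    also have "\<dots> = F (integral {0..min s L} u)"
      using integral_linear[OF uI F(1)] by (simp add: o_def)
    finally show ?thesis .
  qed
  have Fconv: "F (integral {0..min s L} (\<lambda>v. a (s - v) *\<^sub>C u v)) = conv a y s" if s: "s \<in> {0..t}" for s
  proof -
    have "conv a y s = integral {0..s} (\<lambda>v. if v \<in> {0..min s L} then a (s - v) * F (u v) else 0)"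
      unfolding conv_def by (intro integral_cong) (auto simp: y_def)
    also have "\<dots> = integral {0..min s L} (\<lambda>v. a (s - v) * F (u v))" by (rule integral_if_subset) auto
    also have "\<dots> = F (integral {0..min s L} (\<lambda>v. a (s - v) *\<^sub>C u v))"
      by (rule functional_integral[OF F conv_vector_continuous(1)[OF a u L s], symmetric])
    finally show ?thesis by simp
  qed
  have c1: "continuous_on {0..t} (\<lambda>s. integral {0..min s L} (\<lambda>v. a (s - v) *\<^sub>C u v))"
    by (rule conv_vector_continuous(2)[OF a u L])
  have "F (integral {0..t} (\<lambda>s. integral {0..min s L} (\<lambda>v. a (s - v) *\<^sub>C u v))) =
      integral {0..t} (\<lambda>s. F (integral {0..min s L} (\<lambda>v. a (s - v) *\<^sub>C u v)))"
    using integral_linear[OF integrable_continuous_real[OF c1] F(1)] by (simp add: o_def)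
  also have "\<dots> = integral {0..t} (conv a y)" by (intro integral_cong Fconv)
  also have "\<dots> = conv a (\<lambda>s. integral {0..s} y) t" by (rule integral_conv[OF a ybI])
  also have "\<dots> = integral {0..t} (\<lambda>s. a (t - s) * F (integral {0..min s L} u))"
    unfolding conv_def by (intro integral_cong) (simp add: Fint)
  also have "\<dots> = F (integral {0..t} (\<lambda>s. a (t - s) *\<^sub>C integral {0..min s L} u))"
  proof (rule functional_integral[OF F, symmetric])
    have "u integrable_on {0..L}" by (rule integrable_continuous_real[OF u])
    from indefinite_integral_continuous_1[OF this]
    have "continuous_on {0..t} (\<lambda>s. integral {0..min s L} u)"
      by (rule continuous_on_compose2) (use L in \<open>auto intro!: continuous_intros\<close>)
    then show "(\<lambda>s. a (t - s) *\<^sub>C integral {0..min s L} u) integrable_on {0..t}"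
      by (intro scaleC_integrable absolutely_integrable_reflect_shift) (use a in auto)
  qed
  finally show "F (integral {0..t} (\<lambda>s. integral {0..min s L} (\<lambda>v. a (s - v) *\<^sub>C u v))) =
    F (integral {0..t} (\<lambda>s. a (t - s) *\<^sub>C integral {0..min s L} u))" .
qed

lemma local_convoluted_semigroupD:
  assumes "local_convoluted_semigroup k \<sigma> D A S"
  shows "closed_operator D A" "t \<in> {0..\<sigma>} \<Longrightarrow> bounded_clinear (S t)"
    "continuous_on {0..\<sigma>} (\<lambda>t. S t x)"
    "t \<in> {0..\<sigma>} \<Longrightarrow> x \<in> D \<Longrightarrow> S t x \<in> D" "t \<in> {0..\<sigma>} \<Longrightarrow> x \<in> D \<Longrightarrow> A (S t x) = S t (A x)"
    "t \<in> {0..\<sigma>} \<Longrightarrow> integral {0..t} (\<lambda>s. S s x) \<in> D"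
    "t \<in> {0..\<sigma>} \<Longrightarrow> A (integral {0..t} (\<lambda>s. S s x)) = S t x - integral {0..t} k *\<^sub>C x"
  using assms by (simp_all add: local_convoluted_semigroup_def)

lemma local_convoluted_semigroup_0:
  assumes "local_convoluted_semigroup k \<sigma> D A S" "0 \<le> \<sigma>"
  shows "S 0 x = 0"
  using local_convoluted_semigroupD(7)[OF assms(1), of 0 x] assms(2)
    closed_operatorD(6)[OF local_convoluted_semigroupD(1)[OF assms(1)]] by (simp add: scaleC.zero_left)

lemma shifted_absolutely_integrable:
  fixes l :: "real \<Rightarrow> complex"
  assumes l: "locally_integrable l" and \<sigma>: "0 \<le> \<sigma>"
  shows "(\<lambda>v. l (v + \<sigma>)) absolutely_integrable_on {0..r}"
proof -
  have *: "(\<lambda>v. f (v + \<sigma>)) integrable_on {0..r}" if "f integrable_on {\<sigma>..\<sigma> + r}" for f :: "real \<Rightarrow> 'c::real_normed_vector"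
    using integrable_shift_real_ivl[OF that, of \<sigma>] by (simp add: add.commute)
  have "l absolutely_integrable_on {\<sigma>..\<sigma> + r}" by (rule locally_integrableD[OF l \<sigma>])
  then show ?thesis using *[of l] *[of "\<lambda>v. norm (l v)"]
    by (simp add: absolutely_integrable_on_def)
qed

text \<open>The scalar part of the generator relation for the extended semigroup. The primitive of
  \<open>l\<close> is split at \<sigma>; what lies beyond is the primitive of the translate of
  \<open>l\<close>, and commutativity of convolution moves the primitive over to
  \<open>k\<close>.\<close>

lemma convolution_power_split:
  fixes k l :: "real \<Rightarrow> complex"
  assumes k: "locally_integrable k" and l: "locally_integrable l" and t: "0 \<le> t" and \<sigma>: "0 \<le> \<sigma>"
  shows "integral {0..t} (conv k l) =
    integral {0..t} (\<lambda>s. k (t - s) * integral {0..min s \<sigma>} l) +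
    integral {0..max 0 (t - \<sigma>)} (\<lambda>s. l (t - s) * integral {0..s} k)"
proof -
  have ki: "k absolutely_integrable_on {0..q}" and li: "l absolutely_integrable_on {0..q}" for q
    using locally_integrableD k l by auto
  have lI: "l integrable_on {0..q}" for q using li[of q] by (auto simp: absolutely_integrable_on_def)
  have Lc: "continuous_on {0..q} (\<lambda>s. integral {0..s} l)" for q
    by (rule indefinite_integral_continuous_1[OF lI])
  have eq: "integral {0..t} (conv k l) = integral {0..t} (\<lambda>s. k (t - s) * integral {0..s} l)"
    by (simp add: integral_conv[OF ki li] conv_def)
  show ?thesis
  proof (cases "t \<le> \<sigma>")
    case True
    have "integral {0..t} (\<lambda>s. k (t - s) * integral {0..min s \<sigma>} l) = integral {0..t} (\<lambda>s. k (t - s) * integral {0..s} l)"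
      by (intro integral_cong) (use True in auto)
    then show ?thesis using True eq by simp
  next
    case False
    define r where "r = t - \<sigma>"
    have r: "0 < r" "t = \<sigma> + r" using False by (auto simp: r_def)
    define b where "b v = l (v + \<sigma>)" for v
    have b: "b absolutely_integrable_on {0..r}"
      unfolding b_def by (rule shifted_absolutely_integrable[OF l \<sigma>])
    have i1: "(\<lambda>s. k (t - s) * integral {0..s} l) integrable_on {0..t}"
      by (intro set_lebesgue_integral_eq_integral(1) absolutely_integrable_mult_continuous
          absolutely_integrable_reflect_shift Lc) (use ki in auto)
    have i2: "(\<lambda>s. k (t - s) * integral {0..min s \<sigma>} l) integrable_on {0..t}"
      by (intro set_lebesgue_integral_eq_integral(1) absolutely_integrable_mult_continuous
          absolutely_integrable_reflect_shift continuous_on_compose2[OF Lc[of \<sigma>]] continuous_intros) (use ki \<sigma> in auto)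
    have "integral {0..t} (\<lambda>s. k (t - s) * integral {0..s} l) - integral {0..t} (\<lambda>s. k (t - s) * integral {0..min s \<sigma>} l) =
      integral {0..t} (\<lambda>s. k (t - s) * integral {0..s} l - k (t - s) * integral {0..min s \<sigma>} l)"
      by (rule Henstock_Kurzweil_Integration.integral_diff[OF i1 i2, symmetric])
    also have "\<dots> = integral {0..t} (\<lambda>s. if s \<in> {\<sigma>..t} then k (t - s) * integral {0..s - \<sigma>} b else 0)"
    proof (rule integral_cong)
      fix s assume s: "s \<in> {0..t}"
      show "k (t - s) * integral {0..s} l - k (t - s) * integral {0..min s \<sigma>} l =
        (if s \<in> {\<sigma>..t} then k (t - s) * integral {0..s - \<sigma>} b else 0)"
      proof (cases "\<sigma> \<le> s")
        case True
        have "integral {0..s} l = integral {0..\<sigma>} l + integral {\<sigma>..s} l"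
          using Henstock_Kurzweil_Integration.integral_combine[OF \<sigma> True lI] by simp
        moreover have "integral {\<sigma>..s} l = integral {0..s - \<sigma>} b"
          using integral_shift_real_ivl[where a = \<sigma> and b = s and c = \<sigma> and f = l] by (simp add: b_def[abs_def])
        ultimately show ?thesis using True s by (simp add: algebra_simps)
      qed auto
    qed
    also have "\<dots> = integral {\<sigma>..t} (\<lambda>s. k (t - s) * integral {0..s - \<sigma>} b)"
      by (rule integral_if_subset) (use \<sigma> in auto)
    also have "\<dots> = integral {0..r} (\<lambda>s. k (r - s) * integral {0..s} b)"
      using integral_shift_real_ivl[where a = \<sigma> and b = t and c = \<sigma> and f = "\<lambda>s. k (t - s) * integral {0..s - \<sigma>} b"]
      by (simp add: r_def algebra_simps)
    also have "\<dots> = integral {0..r} (conv k b)"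
      by (simp add: integral_conv[OF ki b] conv_def)
    also have "\<dots> = integral {0..r} (conv b k)"
      by (subst conv_commute_ext) (rule refl)
    also have "\<dots> = integral {0..r} (\<lambda>s. l (t - s) * integral {0..s} k)"
      unfolding integral_conv[OF b ki] conv_def by (simp add: b_def r_def)
    finally show ?thesis using eq r(1) by (simp add: r_def algebra_simps)
  qed
qed

text \<open>With \<open>r = max 0 (t - \<sigma>)\<close> the two cases in the definition of the extension become one
  formula, because \<open>S 0 = 0\<close>.\<close>

lemma local_convoluted_semigroup_extend:
  fixes S T :: "real \<Rightarrow> 'a::complex_banach \<Rightarrow> 'a"
  assumes k: "locally_integrable k" and l: "locally_integrable l"
    and S: "local_convoluted_semigroup k \<tau> D A S" and T: "local_convoluted_semigroup l \<sigma> D A T"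
    and \<tau>: "0 \<le> \<tau>" and \<sigma>: "0 \<le> \<sigma>"
    and U: "\<And>t x. t \<in> {0..\<sigma> + \<tau>} \<Longrightarrow> U t x = T \<sigma> (S (max 0 (t - \<sigma>)) x)
      + integral {0..min t \<sigma>} (\<lambda>s. k (t - s) *\<^sub>C T s x)
      + integral {0..max 0 (t - \<sigma>)} (\<lambda>s. l (t - s) *\<^sub>C S s x)"
  shows "local_convoluted_semigroup (conv k l) (\<sigma> + \<tau>) D A U"
proof -
  note SD = local_convoluted_semigroupD[OF S] and TD = local_convoluted_semigroupD[OF T]
  note clo = SD(1)
  note cloD = closed_operatorD[OF clo]
  have ki: "k absolutely_integrable_on {0..q}" and li: "l absolutely_integrable_on {0..q}" for q
    using locally_integrableD k l by auto
  have kI: "k integrable_on {0..q}" and lI: "l integrable_on {0..q}" for q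
    using ki[of q] li[of q] by (auto simp: absolutely_integrable_on_def)
  define r where "r t = max 0 (t - \<sigma>)" for t
  have r: "r t \<in> {0..\<tau>}" if "t \<in> {0..\<sigma> + \<tau>}" for t using that \<tau> by (auto simp: r_def)
  define b where "b v = l (v + \<sigma>)" for v
  have bi: "b absolutely_integrable_on {0..q}" for q
    unfolding b_def by (rule shifted_absolutely_integrable[OF l \<sigma>])
  define P where "P t x = T \<sigma> (S (r t) x)" for t x
  define Q where "Q t x = integral {0..min t \<sigma>} (\<lambda>s. k (t - s) *\<^sub>C T s x)" for t x
  \<comment> \<open>With q = t - \<sigma> one has l (t - s) = b (q - s), so the last summand is a
    convolution in the variable \<open>q\<close>. The minimum fits
    \<open>conv_vector_continuous\<close> and equals \<open>q\<close> on [0, \<tau>].\<close>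
  define J where "J q x = integral {0..min q \<tau>} (\<lambda>s. b (q - s) *\<^sub>C S s x)" for q x
  have Jr: "integral {0..r t} (\<lambda>s. l (t - s) *\<^sub>C S s x) = J (r t) x" if t: "t \<in> {0..\<sigma> + \<tau>}" for t x
  proof (cases "t \<le> \<sigma>")
    case True then show ?thesis using \<tau> by (simp add: J_def r_def)
  next
    case False
    then have "r t = t - \<sigma>" by (simp add: r_def)
    moreover have "min (r t) \<tau> = r t" using r[OF t] by auto
    ultimately show ?thesis by (simp add: J_def b_def algebra_simps)
  qed
  have U': "U t x = P t x + Q t x + J (r t) x" if "t \<in> {0..\<sigma> + \<tau>}" for t x
    using U[OF that, of x] Jr[OF that, of x] by (simp add: P_def Q_def r_def)
  have rc: "continuous_on Z r" for Z unfolding r_def by (intro continuous_intros)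
  have T\<sigma>: "bounded_clinear (T \<sigma>)" by (rule TD(2)) (use \<sigma> in simp)
  note T\<sigma>D = bounded_clinearD[OF T\<sigma>]
  have Sr_cont: "continuous_on {0..\<sigma> + \<tau>} (\<lambda>t. S (r t) x)" for x
    by (rule continuous_on_compose2[OF SD(3) rc]) (use r in auto)
  have P_cont: "continuous_on {0..\<sigma> + \<tau>} (\<lambda>t. P t x)" for x
    unfolding P_def by (rule bounded_linear.continuous_on[OF T\<sigma>D(1) Sr_cont])
  have Q_cont: "continuous_on {0..\<sigma> + \<tau>} (\<lambda>t. Q t x)" for x
    unfolding Q_def by (rule conv_vector_continuous(2)[OF ki TD(3) \<sigma>])
  have J_cont: "continuous_on {0..\<tau>} (\<lambda>q. J q x)" for x
    unfolding J_def by (rule conv_vector_continuous(2)[OF bi SD(3) \<tau>])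
  have Jr_cont: "continuous_on {0..\<sigma> + \<tau>} (\<lambda>t. J (r t) x)" for x
    by (rule continuous_on_compose2[OF J_cont rc]) (use r in auto)
  have U_cont: "continuous_on {0..\<sigma> + \<tau>} (\<lambda>t. U t x)" for x
    by (rule continuous_on_eq[OF continuous_on_add[OF continuous_on_add[OF P_cont Q_cont] Jr_cont]])
      (simp add: U')
  have kT: "(\<lambda>s. k (t - s)) absolutely_integrable_on {0..min t \<sigma>}" if "t \<in> {0..\<sigma> + \<tau>}" for t
    by (intro absolutely_integrable_reflect_shift absolutely_integrable_subinterval_Icc[OF ki[of t]]) auto
  have bS: "(\<lambda>s. b (q - s)) absolutely_integrable_on {0..min q \<tau>}" for q
    by (intro absolutely_integrable_reflect_shift absolutely_integrable_subinterval_Icc[OF bi[of q]]) auto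
  have T_sub: "continuous_on {0..min t \<sigma>} (\<lambda>s. T s x)" and S_sub: "continuous_on {0..min t \<tau>} (\<lambda>s. S s x)" for t x
    by (rule continuous_on_subset[OF TD(3)] continuous_on_subset[OF SD(3)], auto)+
  have U_lin: "bounded_clinear (U t)" if t: "t \<in> {0..\<sigma> + \<tau>}" for t
  proof -
    have "bounded_clinear (\<lambda>x. P t x + Q t x + J (r t) x)"
      unfolding P_def Q_def J_def
      by (intro bounded_clinear_add bounded_clinear_compose[OF T\<sigma>] SD(2) r[OF t]
          strong_integral_bounded_clinear kT[OF t] bS T_sub S_sub TD(2)) (use t in auto)
    moreover have "U t = (\<lambda>x. P t x + Q t x + J (r t) x)" using U'[OF t] by auto
    ultimately show ?thesis by simp
  qed
  have U_comm: "U t x \<in> D \<and> A (U t x) = U t (A x)" if t: "t \<in> {0..\<sigma> + \<tau>}" and x: "x \<in> D" for t x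
  proof -
    have 1: "P t x \<in> D" "A (P t x) = P t (A x)"
      using SD(4,5)[OF r[OF t] x] TD(4,5)[of \<sigma> "S (r t) x"] \<sigma> by (auto simp: P_def)
    have 2: "Q t x \<in> D" "A (Q t x) = Q t (A x)"
      unfolding Q_def by (intro closed_operator_weighted_integral[OF clo kT[OF t] T_sub T_sub], use TD(4,5) x in auto)+
    have 3: "J (r t) x \<in> D" "A (J (r t) x) = J (r t) (A x)"
      unfolding J_def by (intro closed_operator_weighted_integral[OF clo bS S_sub S_sub], use SD(4,5) x in auto)+
    show ?thesis using 1 2 3 cloD(2,3) by (simp add: U'[OF t])
  qed
  have main: "integral {0..t} (\<lambda>s. U s x) \<in> D \<and>
      A (integral {0..t} (\<lambda>s. U s x)) = U t x - integral {0..t} (conv k l) *\<^sub>C x" if t: "t \<in> {0..\<sigma> + \<tau>}" for t x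
  proof -
    have t0: "0 \<le> t" using t by simp
    define VS where "VS q = integral {0..q} (\<lambda>s. S s x)" for q
    define VT where "VT q = integral {0..q} (\<lambda>s. T s x)" for q
    have SI: "(\<lambda>s. S s x) integrable_on {0..q}" if "q \<le> \<tau>" for q
      by (rule integrable_continuous_real) (rule continuous_on_subset[OF SD(3)], use that in auto)
    have TI: "(\<lambda>s. T s x) integrable_on {0..q}" if "q \<le> \<sigma>" for q
      by (rule integrable_continuous_real) (rule continuous_on_subset[OF TD(3)], use that in auto)
    have VS_cont: "continuous_on {0..\<tau>} VS" unfolding VS_def
      by (rule indefinite_integral_continuous_1[OF SI]) simp
    have VT_cont: "continuous_on {0..\<sigma>} VT" unfolding VT_def
      by (rule indefinite_integral_continuous_1[OF TI]) simp
    have K_cont: "continuous_on {0..q} (\<lambda>s. integral {0..s} k)" and L_cont: "continuous_on {0..q} (\<lambda>s. integral {0..s} l)" for q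
      by (rule indefinite_integral_continuous_1 kI lI)+
    have sub: "{0..t} \<subseteq> {0..\<sigma> + \<tau>}" using t by auto
    have iP: "(\<lambda>s. P s x) integrable_on {0..t}" and iQ: "(\<lambda>s. Q s x) integrable_on {0..t}" and iJ: "(\<lambda>s. J (r s) x) integrable_on {0..t}"
      by (rule integrable_continuous_real, rule continuous_on_subset[OF _ sub], rule P_cont Q_cont Jr_cont)+
    have zero: "S 0 x = 0" by (rule local_convoluted_semigroup_0[OF S \<tau>])
    \<comment> \<open>On [0, \<sigma>] the argument \<open>r s\<close> is 0, which explains the
      condition \<open>f 0 = 0\<close>. It is met by the two summands depending on \<open>r\<close>,
      because of S 0 = 0 and of an empty interval.\<close>
    have head: "integral {0..t} (\<lambda>s. f (r s)) = integral {0..r t} f"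
      if f: "continuous_on {0..\<tau>} f" "f 0 = 0" for f :: "real \<Rightarrow> 'a"
    proof (cases "t \<le> \<sigma>")
      case True
      have "integral {0..t} (\<lambda>s. f (r s)) = integral {0..t} (\<lambda>s. 0)"
        by (intro integral_cong) (use True f(2) in \<open>auto simp: r_def\<close>)
      then show ?thesis using True by (simp add: r_def)
    next
      case False
      have i: "(\<lambda>s. f (r s)) integrable_on {0..t}"
        by (intro integrable_continuous_real continuous_on_compose2[OF f(1) rc]) (use r sub in auto)
      have "integral {0..\<sigma>} (\<lambda>s. f (r s)) = integral {0..\<sigma>} (\<lambda>s. 0)"
        by (intro integral_cong) (use f(2) in \<open>auto simp: r_def\<close>)
      moreover have "integral {\<sigma>..t} (\<lambda>s. f (r s)) = integral {\<sigma>..t} (\<lambda>s. f (s - \<sigma>))"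
        by (intro integral_cong) (auto simp: r_def)
      moreover have "\<dots> = integral {0..t - \<sigma>} f"
        using integral_shift_real_ivl[where a = \<sigma> and b = t and c = \<sigma> and f = "\<lambda>s. f (s - \<sigma>)"] by simp
      ultimately show ?thesis
        using Henstock_Kurzweil_Integration.integral_combine[OF \<sigma> _ i] False by (simp add: r_def)
    qed
    have eP: "integral {0..t} (\<lambda>s. P s x) = T \<sigma> (VS (r t))"
    proof -
      have "integral {0..t} (\<lambda>s. P s x) = integral {0..r t} (\<lambda>q. T \<sigma> (S q x))"
        unfolding P_def by (rule head[OF bounded_linear.continuous_on[OF T\<sigma>D(1) SD(3)]]) (simp add: zero T\<sigma>D)
      also have "\<dots> = T \<sigma> (VS (r t))"
        using integral_linear[OF SI T\<sigma>D(1), of "r t"] r[OF t] by (simp add: o_def VS_def)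
      finally show ?thesis .
    qed
    have eQ: "integral {0..t} (\<lambda>s. Q s x) = integral {0..t} (\<lambda>s. k (t - s) *\<^sub>C VT (min s \<sigma>))"
      unfolding Q_def VT_def by (rule integral_conv_vector[OF ki TD(3) \<sigma> t0])
    have eJ: "integral {0..t} (\<lambda>s. J (r s) x) = integral {0..r t} (\<lambda>s. b (r t - s) *\<^sub>C VS s)"
    proof -
      have "integral {0..t} (\<lambda>s. J (r s) x) = integral {0..r t} (\<lambda>q. J q x)"
        by (rule head[OF J_cont]) (use \<tau> in \<open>simp add: J_def\<close>)
      also have "\<dots> = integral {0..r t} (\<lambda>s. b (r t - s) *\<^sub>C VS (min s \<tau>))"
        unfolding J_def VS_def by (rule integral_conv_vector[OF bi SD(3) \<tau>]) (use r[OF t] in simp)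
      also have "\<dots> = integral {0..r t} (\<lambda>s. b (r t - s) *\<^sub>C VS s)"
        by (intro integral_cong) (use r[OF t] in auto)
      finally show ?thesis .
    qed
    have split: "integral {0..t} (\<lambda>s. U s x) = T \<sigma> (VS (r t)) + integral {0..t} (\<lambda>s. k (t - s) *\<^sub>C VT (min s \<sigma>))
        + integral {0..r t} (\<lambda>s. b (r t - s) *\<^sub>C VS s)"
    proof -
      have "integral {0..t} (\<lambda>s. U s x) = integral {0..t} (\<lambda>s. P s x + Q s x + J (r s) x)"
        by (intro integral_cong) (use U' sub in auto)
      also have "\<dots> = integral {0..t} (\<lambda>s. P s x) + integral {0..t} (\<lambda>s. Q s x) + integral {0..t} (\<lambda>s. J (r s) x)"
        using iP iQ iJ by (simp add: Henstock_Kurzweil_Integration.integral_add Henstock_Kurzweil_Integration.integrable_add)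
      finally show ?thesis by (simp add: eP eQ eJ)
    qed
    let ?K = "\<lambda>q. integral {0..q} k" and ?L = "\<lambda>q. integral {0..q} l"
    \<comment> \<open>The stray term \<open>?K (r t) *\<^sub>C T \<sigma> x\<close> cancels against
      the one in \<open>AQ\<close>.\<close>
    have AP: "T \<sigma> (VS (r t)) \<in> D" "A (T \<sigma> (VS (r t))) = P t x - ?K (r t) *\<^sub>C T \<sigma> x"
      using TD(4,5)[of \<sigma> "VS (r t)"] SD(6,7)[OF r[OF t], of x] \<sigma>
      by (auto simp: VS_def T\<sigma>D P_def)
    have kt: "(\<lambda>s. k (t - s)) absolutely_integrable_on {0..t}"
      by (intro absolutely_integrable_reflect_shift) (use ki in auto)
    have cTm: "continuous_on {0..t} (\<lambda>s. T (min s \<sigma>) x)"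
      by (rule continuous_on_compose2[OF TD(3)]) (use \<sigma> in \<open>auto intro!: continuous_intros\<close>)
    have cLm: "continuous_on {0..t} (\<lambda>s. ?L (min s \<sigma>))"
      by (rule continuous_on_compose2[OF L_cont[of \<sigma>]]) (use \<sigma> in \<open>auto intro!: continuous_intros\<close>)
    have AQ: "integral {0..t} (\<lambda>s. k (t - s) *\<^sub>C VT (min s \<sigma>)) \<in> D"
      "A (integral {0..t} (\<lambda>s. k (t - s) *\<^sub>C VT (min s \<sigma>))) =
        Q t x + ?K (r t) *\<^sub>C T \<sigma> x - integral {0..t} (\<lambda>s. k (t - s) * ?L (min s \<sigma>)) *\<^sub>C x"
    proof -
      have c1: "continuous_on {0..t} (\<lambda>s. VT (min s \<sigma>))"
        by (rule continuous_on_compose2[OF VT_cont]) (use \<sigma> in \<open>auto intro!: continuous_intros\<close>)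
      have c2: "continuous_on {0..t} (\<lambda>s. T (min s \<sigma>) x - ?L (min s \<sigma>) *\<^sub>C x)"
        by (intro continuous_on_diff cTm continuous_on_scaleC continuous_on_const cLm)
      have gr: "VT (min s \<sigma>) \<in> D \<and> A (VT (min s \<sigma>)) = T (min s \<sigma>) x - ?L (min s \<sigma>) *\<^sub>C x" if "s \<in> {0..t}" for s
        unfolding VT_def using TD(6,7)[of "min s \<sigma>" x] that \<sigma> by auto
      note w = closed_operator_weighted_integral[OF clo kt c1 c2 gr]
      show "integral {0..t} (\<lambda>s. k (t - s) *\<^sub>C VT (min s \<sigma>)) \<in> D" by (rule w(1))
      have i1: "(\<lambda>s. k (t - s) *\<^sub>C T (min s \<sigma>) x) integrable_on {0..t}" by (rule scaleC_integrable[OF kt cTm])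
      have i2: "(\<lambda>s. k (t - s) * ?L (min s \<sigma>)) integrable_on {0..t}"
        by (intro set_lebesgue_integral_eq_integral(1) absolutely_integrable_mult_continuous kt cLm)
      have "integral {0..t} (\<lambda>s. k (t - s) *\<^sub>C (T (min s \<sigma>) x - ?L (min s \<sigma>) *\<^sub>C x)) =
        integral {0..t} (\<lambda>s. k (t - s) *\<^sub>C T (min s \<sigma>) x) - integral {0..t} (\<lambda>s. k (t - s) * ?L (min s \<sigma>)) *\<^sub>C x"
        using i1 scaleC_const_integrable[OF i2, of x]
        by (simp add: scaleC.diff_right scaleC_scaleC Henstock_Kurzweil_Integration.integral_diff)
      also have "integral {0..t} (\<lambda>s. k (t - s) *\<^sub>C T (min s \<sigma>) x) = Q t x + ?K (r t) *\<^sub>C T \<sigma> x"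
      proof -
        have "integral {0..t} (\<lambda>s. k (t - s) *\<^sub>C T (min s \<sigma>) x) =
          integral {0..min t \<sigma>} (\<lambda>s. k (t - s) *\<^sub>C T (min s \<sigma>) x) + integral {min t \<sigma>..t} (\<lambda>s. k (t - s) *\<^sub>C T (min s \<sigma>) x)"
          using Henstock_Kurzweil_Integration.integral_combine[OF _ _ i1, of "min t \<sigma>"] t0 \<sigma> by simp
        moreover have "integral {0..min t \<sigma>} (\<lambda>s. k (t - s) *\<^sub>C T (min s \<sigma>) x) = Q t x"
          unfolding Q_def by (intro integral_cong) auto
        \<comment> \<open>Past \<sigma> the operator is frozen at \<open>T \<sigma>\<close>, and
          only the integral of \<open>k\<close> remains.\<close>
        moreover have "integral {min t \<sigma>..t} (\<lambda>s. k (t - s) *\<^sub>C T (min s \<sigma>) x) = ?K (r t) *\<^sub>C T \<sigma> x"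
        proof (cases "t \<le> \<sigma>")
          case False
          have "integral {min t \<sigma>..t} (\<lambda>s. k (t - s) *\<^sub>C T (min s \<sigma>) x) = integral {\<sigma>..t} (\<lambda>s. k (t - s) *\<^sub>C T \<sigma> x)"
          proof -
            have "min t \<sigma> = \<sigma>" using False by simp
            then show ?thesis by (auto intro!: integral_cong)
          qed
          also have "\<dots> = integral {\<sigma>..t} (\<lambda>s. k (t - s)) *\<^sub>C T \<sigma> x"
            by (rule scaleC_const_integrable(2)) (rule integrable_on_subinterval_Icc[OF set_lebesgue_integral_eq_integral(1)[OF kt]], use \<sigma> in auto)
          also have "integral {\<sigma>..t} (\<lambda>s. k (t - s)) = ?K (r t)"
            using integral_reflect_shift[of \<sigma> t k t] False by (simp add: r_def)
          finally show ?thesis .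
        qed (simp add: r_def scaleC.zero_left)
        ultimately show ?thesis by simp
      qed
      finally show "A (integral {0..t} (\<lambda>s. k (t - s) *\<^sub>C VT (min s \<sigma>))) =
        Q t x + ?K (r t) *\<^sub>C T \<sigma> x - integral {0..t} (\<lambda>s. k (t - s) * ?L (min s \<sigma>)) *\<^sub>C x"
        using w(2) by simp
    qed
    have AJ: "integral {0..r t} (\<lambda>s. b (r t - s) *\<^sub>C VS s) \<in> D"
      "A (integral {0..r t} (\<lambda>s. b (r t - s) *\<^sub>C VS s)) = J (r t) x - integral {0..r t} (\<lambda>s. b (r t - s) * ?K s) *\<^sub>C x"
    proof -
      have m: "min (r t) \<tau> = r t" using r[OF t] by auto
      have bt: "(\<lambda>s. b (r t - s)) absolutely_integrable_on {0..r t}" using bS[of "r t"] m by simp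
      have cS: "continuous_on {0..r t} (\<lambda>s. S s x)" using S_sub[of "r t" x] m by simp
      have c1: "continuous_on {0..r t} VS" by (rule continuous_on_subset[OF VS_cont]) (use r[OF t] in auto)
      have c2: "continuous_on {0..r t} (\<lambda>s. S s x - ?K s *\<^sub>C x)"
        by (intro continuous_on_diff cS continuous_on_scaleC continuous_on_const K_cont)
      have gr: "VS s \<in> D \<and> A (VS s) = S s x - ?K s *\<^sub>C x" if "s \<in> {0..r t}" for s
        unfolding VS_def using SD(6,7)[of s x] that r[OF t] by auto
      note w = closed_operator_weighted_integral[OF clo bt c1 c2 gr]
      show "integral {0..r t} (\<lambda>s. b (r t - s) *\<^sub>C VS s) \<in> D" by (rule w(1))
      have i1: "(\<lambda>s. b (r t - s) *\<^sub>C S s x) integrable_on {0..r t}" by (rule scaleC_integrable[OF bt cS])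
      have i2: "(\<lambda>s. b (r t - s) * ?K s) integrable_on {0..r t}"
        by (intro set_lebesgue_integral_eq_integral(1) absolutely_integrable_mult_continuous bt K_cont)
      have "integral {0..r t} (\<lambda>s. b (r t - s) *\<^sub>C (S s x - ?K s *\<^sub>C x)) =
        integral {0..r t} (\<lambda>s. b (r t - s) *\<^sub>C S s x) - integral {0..r t} (\<lambda>s. b (r t - s) * ?K s) *\<^sub>C x"
        using i1 scaleC_const_integrable[OF i2, of x]
        by (simp add: scaleC.diff_right scaleC_scaleC Henstock_Kurzweil_Integration.integral_diff)
      then show "A (integral {0..r t} (\<lambda>s. b (r t - s) *\<^sub>C VS s)) = J (r t) x - integral {0..r t} (\<lambda>s. b (r t - s) * ?K s) *\<^sub>C x"
        using w(2) m by (simp add: J_def)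
    qed
    have scal: "integral {0..t} (conv k l) = integral {0..t} (\<lambda>s. k (t - s) * ?L (min s \<sigma>)) + integral {0..r t} (\<lambda>s. b (r t - s) * ?K s)"
    proof -
      have "integral {0..r t} (\<lambda>s. b (r t - s) * ?K s) = integral {0..r t} (\<lambda>s. l (t - s) * ?K s)"
      proof (cases "t \<le> \<sigma>")
        case False
        then show ?thesis by (simp add: b_def r_def)
      qed (simp add: r_def)
      then show ?thesis using convolution_power_split[OF k l t0 \<sigma>] by (simp add: r_def)
    qed
    show ?thesis
      unfolding split scal U'[OF t]
      using AP AQ AJ cloD(2,3) by (simp add: scaleC_add_left algebra_simps)
  qed
  show ?thesis
    unfolding local_convoluted_semigroup_def
    using clo U_lin U_cont U_comm main by auto
qed

section \<open>Uniqueness for the abstract Cauchy problem\<close>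

text \<open>The product rule for a family that is only strongly differentiable: the uniform bound
  \<open>M\<close> absorbs the remainder of \<open>v\<close>, strong continuity at the fixed vector
  \<open>v'\<close> the second error, strong differentiability at \<open>v s\<close> the
  third.\<close>

lemma strong_product_derivative:
  fixes T :: "real \<Rightarrow> 'a::real_normed_vector \<Rightarrow> 'b::real_normed_vector"
  assumes lin: "\<And>y. y \<in> Z \<Longrightarrow> bounded_linear (T y)"
    and M: "0 \<le> M" "\<And>y x. y \<in> Z \<Longrightarrow> norm (T y x) \<le> M * norm x" and s: "s \<in> Z"
    and c: "continuous (at s within Z) (\<lambda>y. T y v')"
    and d: "((\<lambda>y. T y (v s)) has_vector_derivative d) (at s within Z)"
    and v: "(v has_vector_derivative v') (at s within Z)"
  shows "((\<lambda>y. T y (v y)) has_vector_derivative (T s v' + d)) (at s within Z)"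
  unfolding has_vector_derivative_def has_derivative_iff_norm
proof (rule conjI[OF bounded_linear_scaleR_left])
  let ?E = "\<lambda>y. norm (T y (v y) - T s (v s) - (y - s) *\<^sub>R (T s v' + d)) / norm (y - s)"
  let ?e1 = "\<lambda>y. norm (v y - v s - (y - s) *\<^sub>R v') / norm (y - s)"
  let ?e2 = "\<lambda>y. norm (T y v' - T s v')"
  let ?e3 = "\<lambda>y. norm (T y (v s) - T s (v s) - (y - s) *\<^sub>R d) / norm (y - s)"
  have 1: "(?e1 \<longlongrightarrow> 0) (at s within Z)" and 3: "(?e3 \<longlongrightarrow> 0) (at s within Z)"
    using v d unfolding has_vector_derivative_def has_derivative_iff_norm by blast+
  have 2: "(?e2 \<longlongrightarrow> 0) (at s within Z)"
    using c unfolding continuous_within by (rule LIM_zero[THEN tendsto_norm_zero])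
  have "((\<lambda>y. M * ?e1 y + ?e2 y + ?e3 y) \<longlongrightarrow> M * 0 + 0 + 0) (at s within Z)"
    by (intro tendsto_add tendsto_mult_left 1 2 3)
  then have lim: "((\<lambda>y. M * ?e1 y + ?e2 y + ?e3 y) \<longlongrightarrow> 0) (at s within Z)" by simp
  show "(?E \<longlongrightarrow> 0) (at s within Z)"
  proof (rule Lim_null_comparison[OF _ lim])
    have "norm (?E y) \<le> M * ?e1 y + ?e2 y + ?e3 y" if y: "y \<in> Z" "y \<noteq> s" for y
    proof -
      interpret Ty: bounded_linear "T y" by (rule lin[OF y(1)])
      have "T y (v y) - T s (v s) - (y - s) *\<^sub>R (T s v' + d) =
        T y (v y - v s - (y - s) *\<^sub>R v') + (y - s) *\<^sub>R (T y v' - T s v') + (T y (v s) - T s (v s) - (y - s) *\<^sub>R d)"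
        by (simp only: Ty.diff Ty.scaleR) (simp add: algebra_simps)
      then have "norm (T y (v y) - T s (v s) - (y - s) *\<^sub>R (T s v' + d)) \<le>
        norm (T y (v y - v s - (y - s) *\<^sub>R v')) + norm ((y - s) *\<^sub>R (T y v' - T s v')) + norm (T y (v s) - T s (v s) - (y - s) *\<^sub>R d)"
        by (metis norm_triangle_ineq norm_triangle_mono order_refl)
      also have "\<dots> \<le> M * norm (v y - v s - (y - s) *\<^sub>R v') + norm (y - s) * ?e2 y + norm (T y (v s) - T s (v s) - (y - s) *\<^sub>R d)"
        using M(2)[OF y(1)] by (intro add_mono) auto
      finally have "?E y \<le> (M * norm (v y - v s - (y - s) *\<^sub>R v') + norm (y - s) * ?e2 y + norm (T y (v s) - T s (v s) - (y - s) *\<^sub>R d)) / norm (y - s)"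
        by (intro divide_right_mono) auto
      also have "\<dots> = M * ?e1 y + ?e2 y + ?e3 y" using y(2) by (simp add: add_divide_distrib)
      finally show ?thesis by simp
    qed
    then show "\<forall>\<^sub>F y in at s within Z. norm (?E y) \<le> M * ?e1 y + ?e2 y + ?e3 y"
      by (auto simp: eventually_at_filter)
  qed
qed

text \<open>Differentiating \<open>s \<mapsto> V(t - s) v(s)\<close> with \<open>V(t) = \<integral>\<^sub>0\<^sup>t S(s) ds\<close> shows that the convolution of
  \<open>v\<close> with the primitive of \<open>k\<close> vanishes.\<close>

lemma abstract_cauchy_problem_unique:
  fixes S :: "real \<Rightarrow> 'a::complex_banach \<Rightarrow> 'a"
  assumes k: "locally_integrable k" "zero_in_supp k" and S: "local_convoluted_semigroup k \<tau> D A S"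
    and c: "0 < c" "c \<le> \<tau>"
    and v: "\<And>s. s \<in> {0..c} \<Longrightarrow> v s \<in> D" "\<And>s. s \<in> {0..c} \<Longrightarrow> (v has_vector_derivative A (v s)) (at s within {0..c})"
    and v0: "v 0 = 0" and s: "s \<in> {0..c}"
  shows "v s = 0"
proof -
  note SD = local_convoluted_semigroupD[OF S]
  note clo = SD(1)
  define K where "K q = integral {0..q} k" for q
  have K_cont: "continuous_on UNIV K" unfolding K_def by (rule continuous_on_primitive[OF k(1)])
  define V where "V q x = integral {0..q} (\<lambda>r. S r x)" for q x
  have SI: "(\<lambda>r. S r x) integrable_on {0..q}" if "q \<le> \<tau>" for q x
    by (rule integrable_continuous_real) (rule continuous_on_subset[OF SD(3)], use that in auto)
  have S_lin: "bounded_clinear (S r)" if "r \<in> {0..\<tau>}" for r using SD(2) that .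
  have V_lin: "bounded_linear (V q)" if q: "q \<in> {0..\<tau>}" for q
  proof -
    have "bounded_clinear (\<lambda>x. integral {0..q} (\<lambda>r. 1 *\<^sub>C S r x))"
      by (rule strong_integral_bounded_clinear)
        (use q S_lin continuous_on_subset[OF SD(3)] in \<open>auto intro!: absolutely_integrable_continuous_real\<close>)
    then show ?thesis by (auto simp: V_def[abs_def] dest: bounded_clinearD(1))
  qed
  have V_deriv: "((\<lambda>q. V q x) has_vector_derivative S q x) (at q within {0..\<tau>})" if "q \<in> {0..\<tau>}" for q x
    unfolding V_def by (rule integral_has_vector_derivative[OF SD(3) that])
  have V_cont: "continuous_on {0..\<tau>} (\<lambda>q. V q x)" for x
    unfolding V_def by (rule indefinite_integral_continuous_1[OF SI]) simp
  obtain M where M: "0 \<le> M" "\<And>q x. q \<in> {0..\<tau>} \<Longrightarrow> norm (V q x) \<le> M * norm x"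
  proof (rule uniform_boundedness[of "{0..\<tau>}" V])
    show "\<exists>B. \<forall>q\<in>{0..\<tau>}. norm (V q x) \<le> B" for x
      by (rule continuous_on_Icc_bound[OF V_cont[of x]]) blast
  qed (use that V_lin in blast)+
  \<comment> \<open>By closedness \<open>V q\<close> commutes with \<open>A\<close> on the domain.
    In the product rule \<open>S\<close> then cancels and only the scalar \<open>K\<close> is
    left.\<close>
  have VA: "V q (A x) = S q x - K q *\<^sub>C x" if q: "q \<in> {0..\<tau>}" and x: "x \<in> D" for q x
  proof -
    have "A (integral {0..q} (\<lambda>r. S r x)) = integral {0..q} (\<lambda>r. S r (A x))"
      by (rule closed_operator_integral(2)[OF clo SI SI]) (use q x SD(4,5) in auto)
    then show ?thesis using SD(7)[OF q, of x] by (simp add: V_def K_def)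
  qed
  have v_cont: "continuous_on {0..c} v"
    unfolding continuous_on_eq_continuous_within using has_vector_derivative_continuous[OF v(2)] by blast
  have conv0: "integral {0..t} (\<lambda>s. K (t - s) *\<^sub>C v s) = 0" if t: "t \<in> {0..c}" for t
  proof -
    have tt: "t - q \<in> {0..\<tau>}" if "q \<in> {0..t}" for q using that t c by auto
    have "((\<lambda>s. V (t - s) (v s)) has_vector_derivative - (K (t - s) *\<^sub>C v s)) (at s within {0..t})"
      if s: "s \<in> {0..t}" for s
    proof -
      have sc: "s \<in> {0..c}" using s t by auto
      have "((\<lambda>y. V (t - y) (v y)) has_vector_derivative (V (t - s) (A (v s)) + - S (t - s) (v s))) (at s within {0..t})"
      proof (rule strong_product_derivative[where M = M and T = "\<lambda>y. V (t - y)" and v = v and v' = "A (v s)"])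
        show "continuous (at s within {0..t}) (\<lambda>y. V (t - y) (A (v s)))"
        proof -
          have "continuous_on {0..t} (\<lambda>y. V (t - y) (A (v s)))"
            by (rule continuous_on_compose2[OF V_cont]) (use t c in \<open>auto intro!: continuous_intros\<close>)
          then show ?thesis using s by (simp add: continuous_on_eq_continuous_within)
        qed
        show "((\<lambda>y. V (t - y) (v s)) has_vector_derivative - S (t - s) (v s)) (at s within {0..t})"
        proof -
          have a: "((\<lambda>y. t - y) has_vector_derivative -1) (at s within {0..t})"
            by (auto intro!: derivative_eq_intros)
          have "(\<lambda>y. t - y) ` {0..t} \<subseteq> {0..\<tau>}" using t c by auto
          then have "((\<lambda>q. V q (v s)) has_vector_derivative S (t - s) (v s)) (at (t - s) within (\<lambda>y. t - y) ` {0..t})"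
            by (rule has_vector_derivative_within_subset[OF V_deriv[OF tt[OF s]]])
          from vector_diff_chain_within[OF a this] show ?thesis by (simp add: o_def)
        qed
        show "(v has_vector_derivative A (v s)) (at s within {0..t})"
          by (rule has_vector_derivative_within_subset[OF v(2)[OF sc]]) (use t in auto)
      qed (use V_lin M tt s in auto)
      then show ?thesis using VA[OF tt[OF s] v(1)[OF sc]] by simp
    qed
    \<comment> \<open>Both boundary values vanish: \<open>V 0\<close> is zero and so is
      \<open>v 0\<close>.\<close>
    then have "((\<lambda>s. - (K (t - s) *\<^sub>C v s)) has_integral V (t - t) (v t) - V (t - 0) (v 0)) {0..t}"
      by (intro fundamental_theorem_of_calculus) (use t in auto)
    moreover have "V t 0 = 0"
      using V_lin[of t] t c by (auto simp: linear_0 bounded_linear.linear)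
    ultimately have "((\<lambda>s. - (K (t - s) *\<^sub>C v s)) has_integral 0) {0..t}"
      by (simp add: v0) (simp add: V_def)
    from has_integral_neg[OF this] show ?thesis by (simp add: integral_unique)
  qed
  have v_zero: "v s = 0" if s: "s \<in> {0..<c}" for s
  proof (rule eq_by_functionals)
    fix F :: "'a \<Rightarrow> complex" assume F: "bounded_linear F" "\<And>c y. F (c *\<^sub>C y) = c * F y"
    \<comment> \<open>Constant continuation beyond [0, c], as Titchmarsh's theorem is stated for
      functions continuous on the line.\<close>
    define g where "g s = F (v (max 0 (min s c)))" for s
    have g_cont: "continuous_on UNIV g"
      unfolding g_def
      by (intro bounded_linear.continuous_on[OF F(1)] continuous_on_compose2[OF v_cont] continuous_intros)
        (use c in auto)
    have gF: "g s = F (v s)" if "s \<in> {0..c}" for s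
    proof -
      have "max 0 (min s c) = s" using that by auto
      then show ?thesis by (simp add: g_def)
    qed
    have "vanishes_before (conv K g) c"
      unfolding vanishes_before_def
    proof (intro allI impI)
      fix t assume t: "0 \<le> t" "t < c"
      have "conv K g t = integral {0..t} (\<lambda>s. K (t - s) * F (v s))"
        unfolding conv_def by (intro integral_cong) (use t gF in auto)
      also have "\<dots> = F (integral {0..t} (\<lambda>s. K (t - s) *\<^sub>C v s))"
      proof (rule functional_integral[OF F, symmetric])
        show "(\<lambda>s. K (t - s) *\<^sub>C v s) integrable_on {0..t}"
          by (intro integrable_continuous_real continuous_on_scaleC continuous_on_compose2[OF K_cont]
              continuous_on_subset[OF v_cont] continuous_intros) (use t in auto)
      qed
      also have "\<dots> = 0" using conv0[of t] t F(1) by (simp add: linear_0 bounded_linear.linear)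
      finally show "conv K g t = 0" .
    qed
    note tit = titchmarsh_continuous[OF K_cont g_cont this]
    have "g s = 0"
    proof (rule ccontr)
      assume "g s \<noteq> 0"
      then have "vanishes_before K (c - s)" using tit s by auto
      then show False using primitive_not_vanishing[OF k, of "c - s"] s by (simp add: K_def[abs_def])
    qed
    then show "F (v s) = F 0" using gF[of s] s F(1) by (simp add: linear_0 bounded_linear.linear)
  qed
  show ?thesis
    by (rule continuous_constant_on_closure[of "{0..<c}" v]) (use c s v_cont v_zero in auto)
qed

section \<open>The functional calculus\<close>

locale local_semigroup = kernel k for k :: "real \<Rightarrow> complex" +
  fixes \<tau> :: real and D :: "'a::complex_banach set" and A :: "'a \<Rightarrow> 'a" and S :: "real \<Rightarrow> 'a \<Rightarrow> 'a"
  assumes \<tau>: "0 < \<tau>" and S: "local_convoluted_semigroup k \<tau> D A S"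
begin

abbreviation Sn :: "nat \<Rightarrow> real \<Rightarrow> 'a \<Rightarrow> 'a" where "Sn \<equiv> S_ext k \<tau> S"

lemma Sn_Suc:
  assumes n: "1 \<le> n" and t: "t \<in> {0..real n * \<tau>}"
  shows "Sn (Suc n) t x = integral {0..t} (\<lambda>s. k (t - s) *\<^sub>C Sn n s x)"
  using n t by (cases n) (simp_all add: Let_def)

lemma Sn_semigroup: "1 \<le> n \<Longrightarrow> local_convoluted_semigroup (kn n) (real n * \<tau>) D A (Sn n)"
proof (induction n rule: dec_induct)
  case base
  have "Sn 1 = S" by (intro ext) simp
  then show ?case using S by (simp add: conv_pow_1)
next
  case (step n)
  let ?\<sigma> = "real n * \<tau>"
  have \<sigma>: "0 \<le> ?\<sigma>" using \<tau> by simp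
  have T\<sigma>0: "Sn n ?\<sigma> 0 = 0"
    using bounded_clinearD(5)[OF local_convoluted_semigroupD(2)[OF step.IH]] \<sigma> by simp
  have "local_convoluted_semigroup (conv k (kn n)) (?\<sigma> + \<tau>) D A (Sn (Suc n))"
  proof (rule local_convoluted_semigroup_extend[OF k_int kn_int[OF step.hyps(1)] S step.IH _ \<sigma>])
    fix t x assume t: "t \<in> {0..?\<sigma> + \<tau>}"
    show "Sn (Suc n) t x = Sn n ?\<sigma> (S (max 0 (t - ?\<sigma>)) x) + integral {0..min t ?\<sigma>} (\<lambda>s. k (t - s) *\<^sub>C Sn n s x)
      + integral {0..max 0 (t - ?\<sigma>)} (\<lambda>s. kn n (t - s) *\<^sub>C S s x)"
    proof (cases "t \<le> ?\<sigma>")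
      case True
      then show ?thesis
        using Sn_Suc[OF step.hyps(1), of t x] t local_convoluted_semigroup_0[OF S] \<tau> T\<sigma>0 by simp
    next
      case False
      obtain p where "n = Suc p" using step.hyps(1) by (cases n) auto
      with False show ?thesis by (simp add: Let_def)
    qed
  qed (use \<tau> in simp)
  then show ?case using step.hyps(1) by (simp add: conv_pow_Suc algebra_simps)
qed

lemmas SnD = local_convoluted_semigroupD[OF Sn_semigroup]

definition GI :: "nat \<Rightarrow> (real \<Rightarrow> complex) \<Rightarrow> 'a \<Rightarrow> 'a" where
  "GI n f x = integral {0..real n * \<tau>} (\<lambda>t. W (kn n) f t *\<^sub>C Sn n t x)"

lemma W_continuous: "f \<in> D_inf k \<Longrightarrow> 1 \<le> n \<Longrightarrow> continuous_on {0..r} (W (kn n) f)"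
  by (rule continuous_on_subset[OF Dplus_continuous[OF D_infD(1)]]) auto

lemma integrand_integrable:
  assumes "f \<in> D_inf k" "1 \<le> n"
  shows "(\<lambda>t. W (kn n) f t *\<^sub>C Sn n t x) integrable_on {0..real n * \<tau>}"
  by (intro integrable_continuous_real continuous_on_scaleC W_continuous assms SnD)

text \<open>The preimage at level n + 1 already vanishes from n\<tau> on, so only the branch of the
  extended semigroup that is a convolution with \<open>k\<close> is seen. Transposing that
  convolution puts k \<circ> \<open>W (kn (Suc n)) f\<close> against \<open>Sn n\<close>.\<close>

lemma GI_Suc:
  assumes f: "f \<in> D_inf k" and adm: "admissible \<tau> f n"
  shows "GI (Suc n) f x = GI n f x"
proof (rule eq_by_functionals)
  fix F :: "'a \<Rightarrow> complex" assume F: "bounded_linear F" "\<And>c y. F (c *\<^sub>C y) = c * F y"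
  let ?T = "real n * \<tau>"
  have n: "1 \<le> n" and fz: "\<And>t. ?T \<le> t \<Longrightarrow> f t = 0" using adm admissible_iff[OF f \<tau>] by auto
  have T0: "0 \<le> ?T" using \<tau> by simp
  define \<phi> where "\<phi> = W (kn (Suc n)) f"
  have \<phi>: "\<phi> \<in> Dplus" unfolding \<phi>_def by (rule D_infD[OF f]) simp
  have \<phi>z: "\<phi> t = 0" if "?T \<le> t" for t
    unfolding \<phi>_def by (rule W_vanishes[OF f _ T0 fz that]) auto
  obtain B where B: "\<And>t. norm (\<phi> t) \<le> B" by (rule Dplus_bounded[OF \<phi>]) blast
  have ki: "k absolutely_integrable_on {0..q}" for q by (rule locally_integrableD[OF k_int]) simp
  define y where "y s = F (Sn n s x)" for s
  have yc: "continuous_on {0..?T} y"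
    unfolding y_def by (rule bounded_linear.continuous_on[OF F(1) SnD(3)[OF n]])
  have yi: "y absolutely_integrable_on {0..?T}" by (rule absolutely_integrable_continuous_real[OF yc])
  have "F (GI (Suc n) f x) = integral {0..real (Suc n) * \<tau>} (\<lambda>t. \<phi> t * F (Sn (Suc n) t x))"
    unfolding GI_def \<phi>_def by (rule functional_integral[OF F integrand_integrable[OF f]]) simp
  also have "\<dots> = integral {0..?T} (\<lambda>t. \<phi> t * F (Sn (Suc n) t x))"
    by (rule integral_extend_zero) (use T0 \<phi>z \<tau> in \<open>auto simp: algebra_simps\<close>)
  also have "\<dots> = integral {0..?T} (\<lambda>t. conv k y t * \<phi> t)"
  proof (rule integral_cong)
    fix t assume t: "t \<in> {0..?T}"
    have "(\<lambda>s. k (t - s) *\<^sub>C Sn n s x) integrable_on {0..t}"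
      by (intro scaleC_integrable absolutely_integrable_reflect_shift continuous_on_subset[OF SnD(3)[OF n]])
        (use t ki in auto)
    from functional_integral[OF F this] have "F (Sn (Suc n) t x) = conv k y t"
      by (simp add: Sn_Suc[OF n t] conv_def y_def)
    then show "\<phi> t * F (Sn (Suc n) t x) = conv k y t * \<phi> t" by simp
  qed
  also have "\<dots> = integral {0..?T} (\<lambda>u. y u * integral {0..?T} (\<lambda>v. k v * (if u + v \<le> ?T then \<phi> (u + v) else 0)))"
    by (rule conv_kernel(2)[OF ki yi Dplus_measurable[OF \<phi>] B])
  also have "\<dots> = integral {0..?T} (\<lambda>u. W (kn n) f u * y u)"
  proof (rule integral_cong)
    fix u assume u: "u \<in> {0..?T}"
    have "integral {0..?T} (\<lambda>v. k v * (if u + v \<le> ?T then \<phi> (u + v) else 0)) = integral {0..?T} (\<lambda>v. k v * \<phi> (u + v))"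
      by (intro integral_cong) (use \<phi>z in auto)
    also have "\<dots> = dual_conv k \<phi> u" by (rule dual_conv_eq[where R = ?T, symmetric]) (use \<phi>z u in auto)
    also have "\<dots> = W (kn n) f u" by (simp add: W_kn_Suc[OF f n] \<phi>_def)
    finally show "y u * integral {0..?T} (\<lambda>v. k v * (if u + v \<le> ?T then \<phi> (u + v) else 0)) = W (kn n) f u * y u" by simp
  qed
  also have "\<dots> = F (GI n f x)"
    unfolding GI_def y_def by (rule functional_integral[OF F integrand_integrable[OF f n], symmetric])
  finally show "F (GI (Suc n) f x) = F (GI n f x)" .
qed

lemma G_eq:
  assumes f: "f \<in> D_inf k" and adm: "admissible \<tau> f n"
  shows "G k \<tau> S f x = GI n f x"
proof -
  have le: "GI m f x = GI n f x" if "n \<le> m" "admissible \<tau> f n" for n m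
    using that
  proof (induction m rule: dec_induct)
    case (step m)
    then show ?case using GI_Suc[OF f admissible_mono[OF f \<tau> _ step.hyps(1)]] by simp
  qed simp
  let ?n = "SOME n. admissible \<tau> f n"
  have "admissible \<tau> f ?n" by (rule someI[where P = "admissible \<tau> f", OF adm])
  then have "GI ?n f x = GI n f x" using le adm by (metis nat_le_linear)
  then show ?thesis by (simp add: G_def GI_def G_integrand_def[abs_def] Let_def)
qed

lemma admissible2:
  assumes "f \<in> D_inf k" "g \<in> D_inf k"
  obtains n where "1 \<le> n" "admissible \<tau> f n" "admissible \<tau> g n"
proof -
  obtain n m where "admissible \<tau> f n" "admissible \<tau> g m"
    using admissible_ex[OF assms(1) \<tau>] admissible_ex[OF assms(2) \<tau>] by blast
  then have "admissible \<tau> f (max n m)" "admissible \<tau> g (max n m)"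
    using admissible_mono[OF _ \<tau>] assms by auto
  then show ?thesis using that[of "max n m"] by (auto simp: admissible_def)
qed

lemma G_bounded_clinear:
  assumes f: "f \<in> D_inf k"
  shows "bounded_clinear (G k \<tau> S f)"
proof -
  obtain n where adm: "admissible \<tau> f n" using admissible_ex[OF f \<tau>] by blast
  then have n: "1 \<le> n" by (simp add: admissible_def)
  have "bounded_clinear (\<lambda>x. GI n f x)"
    unfolding GI_def
    by (rule strong_integral_bounded_clinear[OF Dplus_absolutely_integrable[OF D_infD(1)[OF f n]] SnD(2,3)[OF n]])
  moreover have "G k \<tau> S f = (\<lambda>x. GI n f x)" using G_eq[OF f adm] by auto
  ultimately show ?thesis by simp
qed

text \<open>One constant per level, for an arbitrary bound \<beta> instead of the supremum, so that
  estimates on \<open>W\<close> can be inserted directly.\<close>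

lemma G_bound:
  assumes n: "1 \<le> n"
  obtains C where "0 \<le> C" "\<And>f \<beta> x. f \<in> D_inf k \<Longrightarrow> admissible \<tau> f n \<Longrightarrow> 0 \<le> \<beta> \<Longrightarrow>
    (\<And>t. t \<in> {0..real n * \<tau>} \<Longrightarrow> norm (W (kn n) f t) \<le> \<beta>) \<Longrightarrow> norm (G k \<tau> S f x) \<le> C * \<beta> * norm x"
proof -
  let ?T = "real n * \<tau>"
  have T0: "0 \<le> ?T" using \<tau> by simp
  obtain M where M: "0 \<le> M" "\<And>s x. s \<in> {0..?T} \<Longrightarrow> norm (Sn n s x) \<le> M * norm x"
    using strongly_continuous_bound[of 0 ?T "Sn n", OF SnD(2,3)[OF n]] by metis
  show ?thesis
  proof (rule that[of "M * ?T"])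
    show "0 \<le> M * ?T" using M T0 by simp
    fix f \<beta> x
    assume f: "f \<in> D_inf k" "admissible \<tau> f n" and \<beta>: "0 \<le> \<beta>" "\<And>t. t \<in> {0..?T} \<Longrightarrow> norm (W (kn n) f t) \<le> \<beta>"
    have "norm (GI n f x) \<le> (\<beta> * (M * norm x)) * (?T - 0)"
      unfolding GI_def
    proof (rule integral_norm_le[OF T0])
      show "norm (W (kn n) f t *\<^sub>C Sn n t x) \<le> \<beta> * (M * norm x)" if "t \<in> {0..?T}" for t
        unfolding norm_scaleC using \<beta> M that by (intro mult_mono) auto
    qed (use \<beta> M in auto)
    then show "norm (G k \<tau> S f x) \<le> M * ?T * \<beta> * norm x" by (simp add: G_eq[OF f] mult_ac)
  qed
qed

lemma G_add:
  assumes f: "f \<in> D_inf k" and g: "g \<in> D_inf k"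
  shows "G k \<tau> S (\<lambda>t. f t + g t) x = G k \<tau> S f x + G k \<tau> S g x"
proof -
  obtain n where n: "1 \<le> n" "admissible \<tau> f n" "admissible \<tau> g n" by (rule admissible2[OF f g]) blast
  have fg: "(\<lambda>t. f t + g t) \<in> D_inf k" by (rule D_inf_add[OF f g])
  have "admissible \<tau> (\<lambda>t. f t + g t) n"
    using n by (simp add: admissible_iff[OF _ \<tau>] f g fg)
  then show ?thesis
    using n integrand_integrable[OF f n(1)] integrand_integrable[OF g n(1)]
    by (simp add: G_eq f g fg GI_def D_inf_add(2)[OF f g n(1)] scaleC_add_left Henstock_Kurzweil_Integration.integral_add)
qed

lemma G_cmult:
  assumes f: "f \<in> D_inf k"
  shows "G k \<tau> S (\<lambda>t. c * f t) x = c *\<^sub>C G k \<tau> S f x"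
proof -
  obtain n where n: "admissible \<tau> f n" using admissible_ex[OF f \<tau>] by blast
  then have n1: "1 \<le> n" by (simp add: admissible_def)
  have cf: "(\<lambda>t. c * f t) \<in> D_inf k" by (rule D_inf_cmult[OF f])
  have "admissible \<tau> (\<lambda>t. c * f t) n"
    using n by (simp add: admissible_iff[OF _ \<tau>] f cf)
  then have "G k \<tau> S (\<lambda>t. c * f t) x = integral {0..real n * \<tau>} (\<lambda>t. c *\<^sub>C (W (kn n) f t *\<^sub>C Sn n t x))"
    by (simp add: G_eq[OF cf] GI_def D_inf_cmult(2)[OF f n1] scaleC_scaleC)
  also have "\<dots> = c *\<^sub>C GI n f x"
    using integral_linear[OF integrand_integrable[OF f n1] scaleC.bounded_linear_right] by (simp add: o_def GI_def)
  finally show ?thesis by (simp add: G_eq[OF f n])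
qed

lemma D_inf_diff: "f \<in> D_inf k \<Longrightarrow> g \<in> D_inf k \<Longrightarrow> (\<lambda>t. f t - g t) \<in> D_inf k"
  using D_inf_add(1)[OF _ D_inf_cmult(1), of f g "-1"] by simp

lemma W_diff: "f \<in> D_inf k \<Longrightarrow> g \<in> D_inf k \<Longrightarrow> 1 \<le> n \<Longrightarrow>
    W (kn n) (\<lambda>t. f t - g t) = (\<lambda>t. W (kn n) f t - W (kn n) g t)"
  using D_inf_add(2)[OF _ D_inf_cmult(1), of f g n "-1"] D_inf_cmult(2)[of g n "-1"] by simp

lemma G_diff: "f \<in> D_inf k \<Longrightarrow> g \<in> D_inf k \<Longrightarrow> G k \<tau> S (\<lambda>t. f t - g t) x = G k \<tau> S f x - G k \<tau> S g x"
  using G_add[OF _ D_inf_cmult(1), of f g "-1"] G_cmult[of g "-1"] scaleC_of_real[of "-1" "G k \<tau> S g x"] by simp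

lemma G_generator:
  assumes f: "f \<in> D_inf k"
  shows "G k \<tau> S f x \<in> D" "A (G k \<tau> S f x) = - G k \<tau> S (deriv_plus f) x - f 0 *\<^sub>C x"
proof -
  obtain n where adm: "admissible \<tau> f n" using admissible_ex[OF f \<tau>] by blast
  let ?T = "real n * \<tau>"
  have n: "1 \<le> n" and fz: "\<And>t. ?T \<le> t \<Longrightarrow> f t = 0" using adm admissible_iff[OF f \<tau>] by auto
  have T0: "0 \<le> ?T" using \<tau> by simp
  note f' = D_inf_deriv[OF f]
  have adm': "admissible \<tau> (deriv_plus f) n"
    using n Dplus_deriv_vanishes[OF D_inf_Dplus[OF f] fz _ T0] by (simp add: admissible_iff[OF f'(1) \<tau>])
  define \<phi> where "\<phi> = W (kn n) f"
  define \<phi>' where "\<phi>' = deriv_plus \<phi>"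
  have \<phi>: "\<phi> \<in> Dplus" unfolding \<phi>_def by (rule D_infD[OF f n])
  have \<phi>': "\<phi>' \<in> Dplus" unfolding \<phi>'_def by (rule Dplus_deriv[OF \<phi>])
  have W': "W (kn n) (deriv_plus f) = \<phi>'" unfolding \<phi>'_def \<phi>_def by (rule f'(2)[OF n])
  have \<phi>T: "\<phi> ?T = 0" unfolding \<phi>_def by (rule W_vanishes[OF f n T0 fz order_refl])
  have d\<phi>: "(\<phi> has_vector_derivative \<phi>' t) (at t within {p..q})" if "0 \<le> p" "p \<le> t" for p q t
    unfolding \<phi>'_def
    by (rule has_vector_derivative_within_subset[OF Dplus_has_derivative[OF \<phi>]]) (use that in auto)
  have \<phi>'i: "\<phi>' absolutely_integrable_on {0..q}" for q by (rule Dplus_absolutely_integrable[OF \<phi>'])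
  define K where "K t = integral {0..t} (kn n)" for t
  have ki: "kn n absolutely_integrable_on {0..q}" for q by (rule locally_integrableD[OF kn_int[OF n]]) simp
  have K_cont: "continuous_on {0..?T} K"
    unfolding K_def by (rule continuous_on_subset[OF continuous_on_primitive[OF kn_int[OF n]]]) simp
  define V where "V t = integral {0..t} (\<lambda>s. Sn n s x)" for t
  note Sc = SnD(3)[OF n]
  have V_cont: "continuous_on {0..?T} V"
    unfolding V_def by (rule indefinite_integral_continuous_1[OF integrable_continuous_real[OF Sc]])
  have dV: "(V has_vector_derivative Sn n t x) (at t within {0..?T})" if "t \<in> {0..?T}" for t
    unfolding V_def by (rule integral_has_vector_derivative[OF Sc that])
  \<comment> \<open>No boundary term survives: \<phi> is 0 at the right end and \<open>V\<close> at
    the left.\<close>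
  have "((\<lambda>t. \<phi> t *\<^sub>C Sn n t x + \<phi>' t *\<^sub>C V t) has_integral \<phi> ?T *\<^sub>C V ?T - \<phi> 0 *\<^sub>C V 0) {0..?T}"
    by (rule fundamental_theorem_of_calculus[OF T0])
      (use scaleC.has_vector_derivative[OF d\<phi> dV] in auto)
  then have "((\<lambda>t. \<phi> t *\<^sub>C Sn n t x + \<phi>' t *\<^sub>C V t) has_integral 0) {0..?T}"
    by (simp add: \<phi>T V_def scaleC.zero_left scaleC.zero_right)
  moreover have i\<phi>: "(\<lambda>t. \<phi> t *\<^sub>C Sn n t x) integrable_on {0..?T}"
    unfolding \<phi>_def by (rule integrand_integrable[OF f n])
  moreover have i\<phi>': "(\<lambda>t. \<phi>' t *\<^sub>C V t) integrable_on {0..?T}"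
    by (rule scaleC_integrable[OF \<phi>'i V_cont])
  ultimately have "integral {0..?T} (\<lambda>t. \<phi> t *\<^sub>C Sn n t x) + integral {0..?T} (\<lambda>t. \<phi>' t *\<^sub>C V t) = 0"
    using Henstock_Kurzweil_Integration.integral_add[OF i\<phi> i\<phi>'] by (simp add: integral_unique)
  then have Gf: "G k \<tau> S f x = - integral {0..?T} (\<lambda>t. \<phi>' t *\<^sub>C V t)"
    by (simp add: G_eq[OF f adm] GI_def \<phi>_def eq_neg_iff_add_eq_0)
  have c: "continuous_on {0..?T} (\<lambda>t. Sn n t x - K t *\<^sub>C x)"
    by (intro continuous_on_diff Sc continuous_on_scaleC K_cont continuous_on_const)
  have gr: "V t \<in> D \<and> A (V t) = Sn n t x - K t *\<^sub>C x" if "t \<in> {0..?T}" for t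
    unfolding V_def K_def using SnD(6,7)[OF n that, of x] by auto
  note clo = SnD(1)[OF n]
  note w = closed_operator_weighted_integral[OF clo \<phi>'i V_cont c gr]
  show "G k \<tau> S f x \<in> D" unfolding Gf by (rule closed_operator_minus[OF clo w(1)])
  have iK: "(\<lambda>t. \<phi>' t * K t) integrable_on {0..?T}"
    by (intro set_lebesgue_integral_eq_integral(1) absolutely_integrable_mult_continuous \<phi>'i K_cont)
  have iS: "(\<lambda>t. \<phi>' t *\<^sub>C Sn n t x) integrable_on {0..?T}" by (rule scaleC_integrable[OF \<phi>'i Sc])
  have "integral {0..?T} (\<lambda>t. \<phi>' t *\<^sub>C (Sn n t x - K t *\<^sub>C x)) =
    integral {0..?T} (\<lambda>t. \<phi>' t *\<^sub>C Sn n t x) - integral {0..?T} (\<lambda>t. \<phi>' t * K t) *\<^sub>C x"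
    using iS scaleC_const_integrable[OF iK, of x]
    by (simp add: scaleC.diff_right scaleC_scaleC Henstock_Kurzweil_Integration.integral_diff)
  moreover have "integral {0..?T} (\<lambda>t. \<phi>' t *\<^sub>C Sn n t x) = G k \<tau> S (deriv_plus f) x"
    by (simp add: G_eq[OF f'(1) adm'] GI_def W')
  \<comment> \<open>Origin of the term with f 0: integration by parts, carried out by Fubini because
    \<open>K\<close> is the primitive of a merely integrable kernel, leaves the dual convolution of
    \<phi> at 0.\<close>
  moreover have "integral {0..?T} (\<lambda>t. \<phi>' t * K t) = - f 0"
  proof -
    have "integral {0..?T} (\<lambda>t. \<phi>' t * K t) = integral {0..?T} (\<lambda>t. \<phi>' t * integral {0..?T} (\<lambda>u. kn n u * (if u \<le> t then 1 else 0)))"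
      by (intro integral_cong) (simp add: integral_upto K_def)
    also have "\<dots> = integral {0..?T} (\<lambda>u. kn n u * integral {0..?T} (\<lambda>t. \<phi>' t * (if u \<le> t then 1 else 0)))"
      by (rule fubini_kernel(2)[OF \<phi>'i ki, where M = 1]) auto
    also have "\<dots> = integral {0..?T} (\<lambda>u. - (kn n u * \<phi> (0 + u)))"
    proof (rule integral_cong)
      fix u assume u: "u \<in> {0..?T}"
      have "integral {0..?T} (\<lambda>t. \<phi>' t * (if u \<le> t then 1 else 0)) = integral {u..?T} \<phi>'"
        by (rule integral_from) (use u in auto)
      also have "\<dots> = \<phi> ?T - \<phi> u"
        by (intro integral_unique fundamental_theorem_of_calculus d\<phi>) (use u in auto)
      finally show "kn n u * integral {0..?T} (\<lambda>t. \<phi>' t * (if u \<le> t then 1 else 0)) = - (kn n u * \<phi> (0 + u))"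
        using \<phi>T by simp
    qed
    also have "\<dots> = - dual_conv (kn n) \<phi> 0"
      using dual_conv_eq[where a = "kn n" and \<phi> = \<phi> and R = ?T and T = ?T and t = 0]
        W_vanishes[OF f n T0 fz] by (simp add: \<phi>_def)
    also have "dual_conv (kn n) \<phi> 0 = f 0" unfolding \<phi>_def using D_infD(2)[OF f n] by simp
    finally show ?thesis .
  qed
  ultimately show "A (G k \<tau> S f x) = - G k \<tau> S (deriv_plus f) x - f 0 *\<^sub>C x"
    unfolding Gf using closed_operator_minus(2)[OF clo w(1)] w(2) by (simp add: scaleC.minus_left)
qed

subsection \<open>Multiplicativity\<close>

text \<open>The remainder bound is uniform in \<open>t\<close>: translation is differentiable in the
  sup norm, which is the norm that controls \<open>G\<close>.\<close>

lemma Dplus_shift_taylor: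
  assumes \<phi>: "\<phi> \<in> Dplus"
  obtains B where "0 \<le> B" "\<And>s s' t. 0 \<le> s \<Longrightarrow> 0 \<le> s' \<Longrightarrow>
    norm (shift s' \<phi> t - shift s \<phi> t - of_real (s' - s) * shift s (deriv_plus \<phi>) t) \<le> B * (s' - s)\<^sup>2"
proof -
  obtain \<Phi> \<Phi>' R where *: "\<phi> = restr \<Phi>" "smooth \<Phi>" "supported_in R \<Phi>" "deriv_plus \<phi> = restr \<Phi>'"
    "smooth \<Phi>'" "supported_in R \<Phi>'" "\<And>t. (\<Phi> has_vector_derivative \<Phi>' t) (at t)"
    by (rule Dplus_derivE[OF \<phi>]) blast
  obtain \<Phi>'' where d: "smooth \<Phi>''" "\<And>t. (\<Phi>' has_vector_derivative \<Phi>'' t) (at t)"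
    by (rule smoothE[OF *(5)]) blast
  obtain B where B: "0 \<le> B" "\<And>t. norm (\<Phi>'' t) \<le> B"
    using supported_in_bound[OF supported_in_deriv[OF *(6) d(2)] smooth_continuous[OF d(1)]] by metis
  show ?thesis
  proof (rule that[OF B(1)])
    fix s s' t :: real assume s: "0 \<le> s" "0 \<le> s'"
    show "norm (shift s' \<phi> t - shift s \<phi> t - of_real (s' - s) * shift s (deriv_plus \<phi>) t) \<le> B * (s' - s)\<^sup>2"
    proof (cases "0 \<le> t")
      case True
      then show ?thesis
        using taylor_first_order_bound[OF *(7) d(2) B(2), of "t + s'" "t + s"] s unfolding *(4)
        by (simp add: shift_def restr_def *(1) scaleR_conv_of_real)
    qed (use B(1) in \<open>simp add: shift_def\<close>)
  qed
qed

lemma conv_Dplus_integrable: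
  assumes "f \<in> Dplus" "g \<in> Dplus"
  shows "(\<lambda>s. f (t - s) * g s) integrable_on {0..t}"
proof -
  have [measurable]: "f \<in> borel_measurable borel" by (rule Dplus_measurable[OF assms(1)])
  obtain B where B: "\<And>t. norm (f t) \<le> B" by (rule Dplus_bounded[OF assms(1)]) blast
  have "(\<lambda>s. g s * f (t - s)) absolutely_integrable_on {0..t}"
    by (rule absolutely_integrable_mult_bounded[OF Dplus_absolutely_integrable[OF assms(2)], where M = B])
      (use B in auto)
  from set_lebesgue_integral_eq_integral(1)[OF this] show ?thesis by (simp add: mult.commute)
qed

lemma conv_Dplus_add_left:
  assumes "f \<in> Dplus" "h \<in> Dplus" "g \<in> Dplus"
  shows "conv (\<lambda>t. f t + h t) g = (\<lambda>t. conv f g t + conv h g t)"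
  using conv_Dplus_integrable[OF assms(1,3)] conv_Dplus_integrable[OF assms(2,3)]
  by (intro ext) (simp add: conv_def distrib_right Henstock_Kurzweil_Integration.integral_add)

lemma conv_cmult_left: "conv (\<lambda>t. c * f t) g = (\<lambda>t. c * conv f g t)"
  by (intro ext) (simp add: conv_def mult.assoc)

text \<open>Linear in \<open>q\<close>; at \<open>q = shift s f\<close> it is the function w of the
  overview.\<close>

definition defect :: "(real \<Rightarrow> complex) \<Rightarrow> 'a \<Rightarrow> (real \<Rightarrow> complex) \<Rightarrow> 'a" where
  "defect g x q = G k \<tau> S q (G k \<tau> S g x) - G k \<tau> S (conv q g) x"

lemma defect_add:
  assumes "g \<in> D_inf k" "p \<in> D_inf k" "q \<in> D_inf k"
  shows "defect g x (\<lambda>t. p t + q t) = defect g x p + defect g x q"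
  by (simp add: defect_def G_add assms conv_Dplus_add_left D_inf_Dplus D_inf_conv(1))

lemma defect_cmult:
  assumes "g \<in> D_inf k" "q \<in> D_inf k"
  shows "defect g x (\<lambda>t. c * q t) = c *\<^sub>C defect g x q"
  by (simp add: defect_def G_cmult assms conv_cmult_left D_inf_conv(1) scaleC.diff_right)

text \<open>The values at 0 cancel: \<open>q 0\<close> times \<open>G k \<tau> S g x\<close> arises
  once from (iii) for \<open>q\<close> and once from the derivative of \<open>conv q g\<close>,
  which itself vanishes at 0.\<close>

lemma defect_generator:
  assumes g: "g \<in> D_inf k" and q: "q \<in> D_inf k"
  shows "defect g x q \<in> D" "A (defect g x q) = - defect g x (deriv_plus q)"
proof -
  note q' = D_inf_deriv(1)[OF q] and qg = D_inf_conv(1)[OF q g] and q'g = D_inf_conv(1)[OF D_inf_deriv(1)[OF q] g]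
  have clo: "closed_operator D A" by (rule local_convoluted_semigroupD(1)[OF S])
  show "defect g x q \<in> D"
    unfolding defect_def by (rule closed_operator_diff[OF clo G_generator(1)[OF q] G_generator(1)[OF qg]])
  have "G k \<tau> S (deriv_plus (conv q g)) x = G k \<tau> S (conv (deriv_plus q) g) x + q 0 *\<^sub>C G k \<tau> S g x"
    unfolding conv_Dplus(2)[OF D_inf_Dplus[OF q] D_inf_Dplus[OF g]]
    by (simp add: G_add[OF q'g D_inf_cmult(1)[OF g]] G_cmult[OF g])
  then show "A (defect g x q) = - defect g x (deriv_plus q)"
    unfolding defect_def closed_operator_diff(2)[OF clo G_generator(1)[OF q] G_generator(1)[OF qg]]
      G_generator(2)[OF q] G_generator(2)[OF qg]
    by (simp add: conv_eq_0_nonpos scaleC.zero_left)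
qed

text \<open>The estimate behind the differentiability of w. Level m + m is admissible for
  \<open>q\<close>, \<open>g\<close> and \<open>conv q g\<close> alike, and the product formula
  bounds \<open>W\<close> of the convolution by a multiple of \<beta>.\<close>

lemma defect_bound:
  assumes g: "g \<in> D_inf k" and m: "1 \<le> m" and gz: "\<And>t. real m * \<tau> \<le> t \<Longrightarrow> g t = 0"
  obtains C where "0 \<le> C" "\<And>q \<beta>. q \<in> D_inf k \<Longrightarrow> (\<And>t. real m * \<tau> \<le> t \<Longrightarrow> q t = 0) \<Longrightarrow> 0 \<le> \<beta> \<Longrightarrow>
    (\<And>t. norm (W (kn (m + m)) q t) \<le> \<beta>) \<Longrightarrow> norm (defect g x q) \<le> C * \<beta>"
proof -
  define N where "N = m + m"
  define R where "R = real m * \<tau>"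
  have N: "1 \<le> N" using m by (simp add: N_def)
  have R: "0 < R" using m \<tau> by (simp add: R_def)
  have NR: "real N * \<tau> = R + R" by (simp add: N_def R_def algebra_simps)
  define y where "y = G k \<tau> S g x"
  define \<psi> where "\<psi> = W (kn N) g"
  have \<psi>: "\<psi> \<in> Dplus" unfolding \<psi>_def by (rule D_infD(1)[OF g N])
  obtain Bg where Bg: "0 \<le> Bg" "\<And>t. norm (g t) \<le> Bg" by (rule Dplus_bounded[OF D_inf_Dplus[OF g]]) blast
  obtain B\<psi> where B\<psi>: "0 \<le> B\<psi>" "\<And>t. norm (\<psi> t) \<le> B\<psi>" by (rule Dplus_bounded[OF \<psi>]) blast
  have ki: "kn N absolutely_integrable_on {0..2 * R}" by (rule locally_integrableD[OF kn_int[OF N]]) simp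
  define I where "I = integral {0..2 * R} (\<lambda>u. norm (kn N u))"
  have nI: "(\<lambda>u. norm (kn N u)) integrable_on {0..2 * R}" using ki by (simp add: absolutely_integrable_on_def)
  have I0: "0 \<le> I" unfolding I_def by (rule integral_nonneg[OF nI]) simp
  obtain C where C: "0 \<le> C" "\<And>f \<beta> x. f \<in> D_inf k \<Longrightarrow> admissible \<tau> f N \<Longrightarrow> 0 \<le> \<beta> \<Longrightarrow>
    (\<And>t. t \<in> {0..real N * \<tau>} \<Longrightarrow> norm (W (kn N) f t) \<le> \<beta>) \<Longrightarrow> norm (G k \<tau> S f x) \<le> C * \<beta> * norm x"
    by (rule G_bound[OF N]) blast
  \<comment> \<open>First the convolution of \<open>W q\<close> with \<open>g\<close> over a length
    of at most R + R, then the cross term: kernel at most \<beta> I, times the bound of \<psi>, over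
    length \<open>R\<close>.\<close>
  define E where "E = Bg * (R + R) + I * B\<psi> * R"
  have E0: "0 \<le> E" unfolding E_def using Bg(1) B\<psi>(1) I0 R by simp
  show ?thesis
  proof (rule that[of "C * norm y + C * E * norm x"])
    show "0 \<le> C * norm y + C * E * norm x" using C(1) E0 by simp
    fix q \<beta>
    assume q: "q \<in> D_inf k" and qz: "\<And>t. real m * \<tau> \<le> t \<Longrightarrow> q t = 0" and \<beta>: "0 \<le> \<beta>"
      and b: "\<And>t. norm (W (kn (m + m)) q t) \<le> \<beta>"
    define \<phi> where "\<phi> = W (kn N) q"
    have \<phi>: "\<phi> \<in> Dplus" unfolding \<phi>_def by (rule D_infD(1)[OF q N])
    have \<phi>b: "norm (\<phi> t) \<le> \<beta>" for t using b by (simp add: \<phi>_def N_def)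
    have [measurable]: "\<phi> \<in> borel_measurable borel" by (rule Dplus_measurable[OF \<phi>])
    have z: "q t = 0" "g t = 0" if "R \<le> t" for t using qz gz that by (auto simp: R_def)
    have qg: "conv q g \<in> D_inf k" by (rule D_inf_conv(1)[OF q g])
    have adm: "admissible \<tau> q N"
      using N z R by (simp add: admissible_iff[OF q \<tau>] NR)
    have adm2: "admissible \<tau> (conv q g) N"
      using N conv_vanishes[of R q R g] z by (simp add: admissible_iff[OF qg \<tau>] NR)
    have kern: "norm (cross_kernel (kn N) \<phi> R v) \<le> \<beta> * I" for v
    proof -
      let ?c = "\<lambda>u. if v \<le> u then \<phi> (u - v) else 0"
      have "norm (cross_kernel (kn N) \<phi> R v) \<le> integral {0..2 * R} (\<lambda>u. \<beta> * norm (kn N u))"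
        unfolding cross_kernel_def
      proof (rule integral_norm_bound_integral)
        have "(\<lambda>u. kn N u * ?c u) absolutely_integrable_on {0..2 * R}"
          by (rule absolutely_integrable_mult_bounded[OF ki, where M = \<beta>]) (use \<phi>b \<beta> in auto)
        then show "(\<lambda>u. kn N u * ?c u) integrable_on {0..2 * R}" by (rule set_lebesgue_integral_eq_integral)
        show "(\<lambda>u. \<beta> * norm (kn N u)) integrable_on {0..2 * R}" by (rule integrable_on_mult_right[OF nI])
        show "norm (kn N u * ?c u) \<le> \<beta> * norm (kn N u)" for u
          using mult_right_mono[OF \<phi>b[of "u - v"], of "norm (kn N u)"] \<beta> by (simp add: norm_mult mult.commute)
      qed
      then show ?thesis by (simp add: I_def)
    qed
    have bound: "norm (W (kn N) (conv q g) t) \<le> E * \<beta>" if t: "t \<in> {0..real N * \<tau>}" for t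
    proof -
      have "norm (conv \<phi> g t) \<le> \<beta> * Bg * (t - 0)"
        unfolding conv_def
      proof (rule integral_norm_le)
        show "norm (\<phi> (t - s) * g s) \<le> \<beta> * Bg" for s
          unfolding norm_mult using \<phi>b Bg \<beta> by (intro mult_mono) auto
      qed (use t \<beta> Bg in auto)
      also have "\<dots> \<le> \<beta> * Bg * (R + R)" using t \<beta> Bg(1) by (intro mult_left_mono) (auto simp: NR)
      finally have 1: "norm (conv \<phi> g t) \<le> \<beta> * Bg * (R + R)" .
      have "norm (integral {0..R} (\<lambda>v. cross_kernel (kn N) \<phi> R v * \<psi> (t + v))) \<le> (\<beta> * I * B\<psi>) * (R - 0)"
      proof (rule integral_norm_le)
        show "norm (cross_kernel (kn N) \<phi> R v * \<psi> (t + v)) \<le> \<beta> * I * B\<psi>" for v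
          unfolding norm_mult using kern B\<psi> \<beta> I0 by (intro mult_mono) auto
      qed (use R \<beta> I0 B\<psi> in auto)
      then have 2: "norm (cross_term (kn N) \<phi> \<psi> R t) \<le> \<beta> * I * B\<psi> * R" using t by (simp add: cross_term_def)
      have "W (kn N) (conv q g) t = conv \<phi> g t - cross_term (kn N) \<phi> \<psi> R t"
        using D_inf_conv(2)[OF q g N R z] by (simp add: \<phi>_def \<psi>_def)
      then have "norm (W (kn N) (conv q g) t) \<le> norm (conv \<phi> g t) + norm (cross_term (kn N) \<phi> \<psi> R t)"
        by (simp add: norm_triangle_ineq4)
      also have "\<dots> \<le> E * \<beta>" using 1 2 by (simp add: E_def algebra_simps)
      finally show ?thesis .
    qed
    have "norm (defect g x q) \<le> norm (G k \<tau> S q y) + norm (G k \<tau> S (conv q g) x)"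
      unfolding defect_def y_def by (rule norm_triangle_ineq4)
    also have "\<dots> \<le> C * \<beta> * norm y + C * (E * \<beta>) * norm x"
      using \<beta> E0 \<phi>b bound by (intro add_mono C(2) q qg adm adm2) (auto simp: \<phi>_def)
    finally show "norm (defect g x q) \<le> (C * norm y + C * E * norm x) * \<beta>" by (simp add: algebra_simps)
  qed
qed

lemma defect_zero:
  assumes g: "g \<in> D_inf k" and f: "f \<in> D_inf k"
  shows "defect g x f = 0"
proof -
  obtain m where m: "1 \<le> m" "admissible \<tau> f m" "admissible \<tau> g m" by (rule admissible2[OF f g]) blast
  define R where "R = real m * \<tau>"
  have fz: "f t = 0" and gz: "g t = 0" if "R \<le> t" for t
    using m that admissible_iff[OF f \<tau>] admissible_iff[OF g \<tau>] by (auto simp: R_def)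
  have R: "0 < R" using m \<tau> by (simp add: R_def)
  obtain C where C: "0 \<le> C" "\<And>q \<beta>. q \<in> D_inf k \<Longrightarrow> (\<And>t. real m * \<tau> \<le> t \<Longrightarrow> q t = 0) \<Longrightarrow> 0 \<le> \<beta> \<Longrightarrow>
    (\<And>t. norm (W (kn (m + m)) q t) \<le> \<beta>) \<Longrightarrow> norm (defect g x q) \<le> C * \<beta>"
    using defect_bound[OF g m(1), of x] gz unfolding R_def by metis
  note f' = D_inf_deriv(1)[OF f]
  have mm: "1 \<le> m + m" using m by simp
  define \<phi> where "\<phi> = W (kn (m + m)) f"
  have \<phi>: "\<phi> \<in> Dplus" unfolding \<phi>_def by (rule D_infD(1)[OF f mm])
  obtain B where B: "0 \<le> B" "\<And>s s' t. 0 \<le> s \<Longrightarrow> 0 \<le> s' \<Longrightarrow>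
    norm (shift s' \<phi> t - shift s \<phi> t - of_real (s' - s) * shift s (deriv_plus \<phi>) t) \<le> B * (s' - s)\<^sup>2"
    by (rule Dplus_shift_taylor[OF \<phi>]) blast
  define w where "w s = defect g x (shift s f)" for s
  have w_deriv: "(w has_vector_derivative - A (w s)) (at s within {0..})" if s: "0 \<le> s" for s
  proof -
    have "A (w s) = - defect g x (shift s (deriv_plus f))"
      unfolding w_def using defect_generator(2)[OF g D_inf_shift(1)[OF f s]] deriv_plus_shift[OF D_inf_Dplus[OF f] s] by simp
    moreover have "(w has_vector_derivative defect g x (shift s (deriv_plus f))) (at s within {0..})"
    proof (rule has_vector_derivative_quadratic[where C = "C * B"])
      fix s' :: real assume "s' \<in> {0..}"
      then have s': "0 \<le> s'" by simp
      note sf = D_inf_shift(1)[OF f s] and sf' = D_inf_shift(1)[OF f s'] and sd = D_inf_shift(1)[OF f' s]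
      \<comment> \<open>The Taylor remainder of the translate is itself in \<open>D_inf k\<close>.
        By linearity its \<open>W\<close> is the remainder for \<phi>, and its defect is the
        remainder for \<open>w\<close>.\<close>
      define q where "q = (\<lambda>t. (shift s' f t + (-1) * shift s f t) + (- of_real (s' - s)) * shift s (deriv_plus f) t)"
      have p: "(\<lambda>t. shift s' f t + (-1) * shift s f t) \<in> D_inf k"
        by (rule D_inf_add(1)[OF sf' D_inf_cmult(1)[OF sf]])
      have q: "q \<in> D_inf k" unfolding q_def by (rule D_inf_add(1)[OF p D_inf_cmult(1)[OF sd]])
      have Wq: "W (kn (m + m)) q t = shift s' \<phi> t - shift s \<phi> t - of_real (s' - s) * shift s (deriv_plus \<phi>) t" for t
      proof -
        have "W (kn (m + m)) q = (\<lambda>t. (shift s' \<phi> t + (-1) * shift s \<phi> t) + (- of_real (s' - s)) * shift s (deriv_plus \<phi>) t)"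
          unfolding q_def \<phi>_def D_inf_add(2)[OF p D_inf_cmult(1)[OF sd] mm] D_inf_add(2)[OF sf' D_inf_cmult(1)[OF sf] mm]
            D_inf_cmult(2)[OF sf mm] D_inf_cmult(2)[OF sd mm] D_inf_shift(2)[OF f s mm] D_inf_shift(2)[OF f s' mm]
            D_inf_shift(2)[OF f' s mm] D_inf_deriv(2)[OF f mm] ..
        then show ?thesis by (simp add: algebra_simps)
      qed
      have dq: "defect g x q = w s' - w s - (s' - s) *\<^sub>R defect g x (shift s (deriv_plus f))"
        unfolding q_def w_def defect_add[OF g p D_inf_cmult(1)[OF sd]] defect_add[OF g sf' D_inf_cmult(1)[OF sf]]
          defect_cmult[OF g sf] defect_cmult[OF g sd]
        by (simp add: scaleC.minus_left scaleC_of_real del: of_real_diff)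
      have "norm (defect g x q) \<le> C * (B * (s' - s)\<^sup>2)"
      proof (rule C(2)[OF q])
        fix t assume "real m * \<tau> \<le> t"
        then have t: "R \<le> t" by (simp add: R_def)
        have "deriv_plus f (t + s) = 0"
          by (rule Dplus_deriv_vanishes[OF D_inf_Dplus[OF f], of R]) (use fz t s R in auto)
        then show "q t = 0" using fz[of "t + s"] fz[of "t + s'"] t s s' by (simp add: q_def shift_def)
      qed (use B s s' Wq in auto)
      then show "norm (w s' - w s - (s' - s) *\<^sub>R defect g x (shift s (deriv_plus f))) \<le> C * B * (s' - s)\<^sup>2"
        by (simp add: dq mult.assoc)
    qed
    ultimately show ?thesis by simp
  qed
  have w_D: "w s \<in> D" if "0 \<le> s" for s
    unfolding w_def by (rule defect_generator(1)[OF g D_inf_shift(1)[OF f that]])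
  \<comment> \<open>Reversing time turns w' = - A w into the Cauchy problem for \<open>A\<close>
    with initial value w b = 0.\<close>
  have backward: "w (b - t) = 0" if b: "0 \<le> b" "w b = 0" and t: "0 \<le> t" "t \<le> \<tau>" "t \<le> b" for b t
  proof (cases "b = 0")
    case False
    \<comment> \<open>Uniqueness reaches only as far as the local semigroup, and w is considered
      only at nonnegative times.\<close>
    define c where "c = min \<tau> b"
    have c: "0 < c" "c \<le> \<tau>" "c \<le> b" using b False \<tau> by (auto simp: c_def)
    show ?thesis
    proof (rule abstract_cauchy_problem_unique[OF k_int k_supp S c(1,2), where v = "\<lambda>t. w (b - t)"])
      show "w (b - s) \<in> D" if "s \<in> {0..c}" for s using w_D that c by auto
      show "((\<lambda>t. w (b - t)) has_vector_derivative A (w (b - s))) (at s within {0..c})" if s: "s \<in> {0..c}" for s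
      proof -
        have a: "((\<lambda>y. b - y) has_vector_derivative -1) (at s within {0..c})"
          by (auto intro!: derivative_eq_intros)
        have "(w has_vector_derivative - A (w (b - s))) (at (b - s) within (\<lambda>y. b - y) ` {0..c})"
          by (rule has_vector_derivative_within_subset[OF w_deriv]) (use s c in auto)
        from vector_diff_chain_within[OF a this] show ?thesis by (simp add: o_def)
      qed
    qed (use b t c in \<open>auto simp: c_def\<close>)
  qed (use that in auto)
  \<comment> \<open>The zero set grows downwards from \<open>R\<close> by \<tau> per step, so m
    steps reach 0.\<close>
  have "\<forall>s\<ge>max 0 (R - real j * \<tau>). w s = 0" for j
  proof (induction j)
    case 0
    show ?case
    proof (intro allI impI)
      fix s assume "max 0 (R - real 0 * \<tau>) \<le> s"
      then have s: "R \<le> s" "0 \<le> s" by auto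
      have "shift s f = (\<lambda>t. 0 * f t)" using fz s by (auto simp: shift_def)
      then show "w s = 0" by (simp only: w_def defect_cmult[OF g f] scaleC.zero_left)
    qed
  next
    case (Suc j)
    show ?case
    proof (intro allI impI)
      fix s assume s: "max 0 (R - real (Suc j) * \<tau>) \<le> s"
      show "w s = 0"
      proof (cases "R - real j * \<tau> \<le> s")
        case True then show ?thesis using Suc s by simp
      next
        case False
        let ?b = "R - real j * \<tau>"
        have "w (?b - (?b - s)) = 0"
          by (rule backward) (use Suc s False in \<open>auto simp: algebra_simps\<close>)
        then show ?thesis by simp
      qed
    qed
  qed
  from this[of m] have "w 0 = 0" by (simp add: R_def)
  moreover have "shift 0 f = f" using Dplus_neg[OF D_inf_Dplus[OF f]] by (auto simp: shift_def fun_eq_iff not_le)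
  ultimately show ?thesis by (simp add: w_def)
qed

lemma G_conv:
  assumes "f \<in> D_inf k" "g \<in> D_inf k"
  shows "G k \<tau> S (conv f g) = G k \<tau> S f \<circ> G k \<tau> S g"
  using defect_zero[OF assms(2,1)] by (auto simp: defect_def fun_eq_iff)

subsection \<open>Continuity\<close>

lemma G_onorm_le:
  assumes n: "1 \<le> n"
  shows "\<exists>C. \<forall>f\<in>D_inf k. admissible \<tau> f n \<longrightarrow>
    onorm (G k \<tau> S f) \<le> C * (SUP t\<in>{0..real n * \<tau>}. norm (W (kn n) f t))"
proof -
  obtain C where C: "0 \<le> C" "\<And>f \<beta> x. f \<in> D_inf k \<Longrightarrow> admissible \<tau> f n \<Longrightarrow> 0 \<le> \<beta> \<Longrightarrow>
    (\<And>t. t \<in> {0..real n * \<tau>} \<Longrightarrow> norm (W (kn n) f t) \<le> \<beta>) \<Longrightarrow> norm (G k \<tau> S f x) \<le> C * \<beta> * norm x"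
    by (rule G_bound[OF n]) blast
  show ?thesis
  proof (intro exI[of _ C] ballI impI)
    fix f assume f: "f \<in> D_inf k" "admissible \<tau> f n"
    define \<beta> where "\<beta> = (SUP t\<in>{0..real n * \<tau>}. norm (W (kn n) f t))"
    obtain B where "\<And>t. norm (W (kn n) f t) \<le> B" by (rule Dplus_bounded[OF D_infD(1)[OF f(1) n]]) blast
    then have bdd: "bdd_above ((\<lambda>t. norm (W (kn n) f t)) ` {0..real n * \<tau>})" by (intro bdd_aboveI2[of _ _ B]) auto
    have le: "norm (W (kn n) f t) \<le> \<beta>" if "t \<in> {0..real n * \<tau>}" for t
      unfolding \<beta>_def by (rule cSUP_upper[OF that bdd])
    have "0 \<le> \<beta>" using order_trans[OF norm_ge_zero le[of 0]] \<tau> by simp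
    then show "onorm (G k \<tau> S f) \<le> C * \<beta>"
      using C f le by (intro onorm_bound) auto
  qed
qed

text \<open>Convergence at level 1 supplies a common bound for the supports and hence one level n
  for all functions involved; uniform convergence at that level then suffices by
  \<open>G_bound\<close>.\<close>

lemma G_continuous:
  assumes conv: "D_inf_converges k f g"
  shows "(\<lambda>j. onorm (\<lambda>x. G k \<tau> S (f j) x - G k \<tau> S g x)) \<longlonglongrightarrow> 0"
proof -
  have f: "\<And>j. f j \<in> D_inf k" and g: "g \<in> D_inf k"
    and W: "\<And>n. 1 \<le> n \<Longrightarrow> Dplus_converges (\<lambda>j. W (kn n) (f j)) (W (kn n) g)"
    using conv by (auto simp: D_inf_converges_def)
  have unif: "uniform_limit K (\<lambda>j. W (kn n) (f j)) (W (kn n) g) sequentially" if "1 \<le> n" "compact K" for n K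
  proof -
    have "\<forall>m K. compact K \<longrightarrow> uniform_limit K (\<lambda>j. (deriv_plus ^^ m) (W (kn n) (f j)))
        ((deriv_plus ^^ m) (W (kn n) g)) sequentially"
      using W[OF that(1)] unfolding Dplus_converges_def by blast
    from this[rule_format, OF that(2), of 0] show ?thesis by simp
  qed
  obtain K where K: "compact K" "\<And>j. supp (W (kn 1) (f j)) \<subseteq> K"
    using W[of 1] by (auto simp: Dplus_converges_def)
  obtain r where r: "0 < r" "\<And>t. t \<in> K \<Longrightarrow> norm t \<le> r" using compact_imp_bounded[OF K(1)] bounded_pos by metis
  obtain n :: nat where n: "r < real n * \<tau>" using reals_Archimedean3[OF \<tau>] by blast
  have n1: "1 \<le> n" using n r(1) by (cases n) auto
  have Wf: "W (kn 1) (f j) t = 0" if "real n * \<tau> \<le> t" for j t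
  proof (rule ccontr)
    assume "W (kn 1) (f j) t \<noteq> 0"
    then have "t \<in> K" using K(2)[of j] closure_subset by (force simp: supp_def)
    then show False using r(2)[of t] that n by simp
  qed
  \<comment> \<open>\<open>Dplus_converges\<close> confines only the members of the sequence to a
    compact set; the limit inherits the bound pointwise.\<close>
  have Wg: "W (kn 1) g t = 0" if "real n * \<tau> \<le> t" for t
  proof -
    have "(\<lambda>j. W (kn 1) (f j) t) \<longlonglongrightarrow> W (kn 1) g t"
      by (rule tendsto_uniform_limitI[OF unif[of 1 "{t}"]]) auto
    moreover have "(\<lambda>j. W (kn 1) (f j) t) = (\<lambda>_. 0)" using Wf[OF that] by blast
    ultimately show ?thesis by (simp only: LIMSEQ_const_iff)
  qed
  have adm: "admissible \<tau> h n" if h: "h \<in> D_inf k" and z: "\<And>t. real n * \<tau> \<le> t \<Longrightarrow> W (kn 1) h t = 0" for h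
  proof -
    have "h t = 0" if "real n * \<tau> \<le> t" for t
      using dual_conv_vanishes[of "real n * \<tau>" "W (kn 1) h" t "kn 1"] z that \<tau> D_infD(2)[OF h, of 1] by simp
    then show ?thesis using n1 by (simp add: admissible_iff[OF h \<tau>])
  qed
  obtain C where C: "0 \<le> C" "\<And>f \<beta> x. f \<in> D_inf k \<Longrightarrow> admissible \<tau> f n \<Longrightarrow> 0 \<le> \<beta> \<Longrightarrow>
    (\<And>t. t \<in> {0..real n * \<tau>} \<Longrightarrow> norm (W (kn n) f t) \<le> \<beta>) \<Longrightarrow> norm (G k \<tau> S f x) \<le> C * \<beta> * norm x"
    by (rule G_bound[OF n1]) blast
  show ?thesis
  proof (rule LIMSEQ_I)
    fix e :: real assume e: "0 < e"
    then have e': "0 < e / (C + 1)" using C(1) by simp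
    obtain J where "\<forall>j\<ge>J. \<forall>t\<in>{0..real n * \<tau>}. dist (W (kn n) (f j) t) (W (kn n) g t) < e / (C + 1)"
      using uniform_limitD[OF unif[OF n1 compact_Icc[of 0 "real n * \<tau>"]] e'] unfolding eventually_sequentially by blast
    then have J: "\<And>j t. J \<le> j \<Longrightarrow> t \<in> {0..real n * \<tau>} \<Longrightarrow> dist (W (kn n) (f j) t) (W (kn n) g t) < e / (C + 1)"
      by blast
    show "\<exists>J. \<forall>j\<ge>J. norm (onorm (\<lambda>x. G k \<tau> S (f j) x - G k \<tau> S g x) - 0) < e"
    proof (intro exI[of _ J] allI impI)
      fix j assume j: "J \<le> j"
      let ?h = "\<lambda>t. f j t - g t"
      have h: "?h \<in> D_inf k" by (rule D_inf_diff[OF f g])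
      have ah: "admissible \<tau> ?h n"
        by (rule adm[OF h]) (use Wf Wg in \<open>simp add: W_diff[OF f g]\<close>)
      have "onorm (\<lambda>x. G k \<tau> S ?h x) \<le> C * (e / (C + 1))"
      proof (rule onorm_bound)
        show "norm (G k \<tau> S ?h x) \<le> C * (e / (C + 1)) * norm x" for x
          by (rule C(2)[OF h ah]) (use e' J[OF j] in \<open>auto simp: W_diff[OF f g n1] dist_norm intro: less_imp_le\<close>)
        show "0 \<le> C * (e / (C + 1))" using C(1) e' by (intro mult_nonneg_nonneg) auto
      qed
      also have "C * (e / (C + 1)) < e" using C(1) e by (simp add: field_simps)
      finally have "onorm (\<lambda>x. G k \<tau> S (f j) x - G k \<tau> S g x) < e" by (simp add: G_diff[OF f g])
      moreover have "(\<lambda>x. G k \<tau> S (f j) x - G k \<tau> S g x) = G k \<tau> S ?h" by (simp add: G_diff[OF f g] fun_eq_iff)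
      moreover have "0 \<le> onorm (G k \<tau> S ?h)"
        using bounded_clinearD(1)[OF G_bounded_clinear[OF h]] by (simp add: onorm_pos_le)
      ultimately show "norm (onorm (\<lambda>x. G k \<tau> S (f j) x - G k \<tau> S g x) - 0) < e" by simp
    qed
  qed
qed

end

theorem theorem1:
  fixes k :: "real \<Rightarrow> complex" and \<tau> :: real
    and D :: "'a::complex_banach set" and A :: "'a \<Rightarrow> 'a" and S :: "real \<Rightarrow> 'a \<Rightarrow> 'a"
  assumes "0 < \<tau>"
    and "locally_integrable k"
    and "zero_in_supp k"
    and "local_convoluted_semigroup k \<tau> D A S"
    and "nondegenerate \<tau> S"
  shows
    "\<comment> \<open>(i) well defined, with values in the bounded operators\<close>
     (\<forall>f\<in>D_inf k.
        (\<exists>n. admissible \<tau> f n) \<and>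
        (\<forall>n x. admissible \<tau> f n \<longrightarrow>
           G_integrand k \<tau> S n f x integrable_on {0..real n * \<tau>} \<and>
           G k \<tau> S f x = integral {0..real n * \<tau>} (G_integrand k \<tau> S n f x)) \<and>
        bounded_clinear (G k \<tau> S f)) \<and>
     \<comment> \<open>(i) linear\<close>
     (\<forall>f\<in>D_inf k. \<forall>g\<in>D_inf k. (\<lambda>t. f t + g t) \<in> D_inf k \<and>
        (\<forall>x. G k \<tau> S (\<lambda>t. f t + g t) x = G k \<tau> S f x + G k \<tau> S g x)) \<and>
     (\<forall>c. \<forall>f\<in>D_inf k. (\<lambda>t. c * f t) \<in> D_inf k \<and>
        (\<forall>x. G k \<tau> S (\<lambda>t. c * f t) x = c *\<^sub>C G k \<tau> S f x)) \<and>
     \<comment> \<open>(i) bounded\<close>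
     (\<forall>n\<ge>1. \<exists>C. \<forall>f\<in>D_inf k. admissible \<tau> f n \<longrightarrow>
        onorm (G k \<tau> S f) \<le> C * (SUP t\<in>{0..real n * \<tau>}. norm (W (conv_pow k n) f t))) \<and>
     (\<forall>f g. D_inf_converges k f g \<longrightarrow>
        (\<lambda>j. onorm (\<lambda>x. G k \<tau> S (f j) x - G k \<tau> S g x)) \<longlonglongrightarrow> 0) \<and>
     \<comment> \<open>(ii)\<close>
     (\<forall>f\<in>D_inf k. \<forall>g\<in>D_inf k. conv f g \<in> D_inf k \<and>
        G k \<tau> S (conv f g) = G k \<tau> S f \<circ> G k \<tau> S g) \<and>
     \<comment> \<open>(iii)\<close>
     (\<forall>f\<in>D_inf k. \<forall>x. deriv_plus f \<in> D_inf k \<and>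
        G k \<tau> S f x \<in> D \<and>
        A (G k \<tau> S f x) = - G k \<tau> S (deriv_plus f) x - f 0 *\<^sub>C x)"
proof -
  interpret local_semigroup k \<tau> D A S
    by unfold_locales (rule assms)+
  have G_val: "G_integrand k \<tau> S n f x integrable_on {0..real n * \<tau>} \<and>
      G k \<tau> S f x = integral {0..real n * \<tau>} (G_integrand k \<tau> S n f x)"
    if "f \<in> D_inf k" "admissible \<tau> f n" for f n x
    using integrand_integrable[OF that(1), of n x] G_eq[OF that, of x] that(2)
    by (simp add: G_integrand_def[abs_def] GI_def admissible_def)
  show ?thesis
    by (intro conjI ballI allI impI G_add G_cmult G_onorm_le G_continuous G_conv G_generator G_bounded_clinear
        D_inf_add(1) D_inf_cmult(1) D_inf_conv(1) D_inf_deriv(1) admissible_ex[OF _ assms(1)]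
        G_val[THEN conjunct1] G_val[THEN conjunct2])
qed

end
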